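(* Let $C$ be a smooth projective algebraic curve over $\mathbb{C}$ of arbitrary genus, with a projective coordinate system $C=\bigcup_\alpha U_\alpha$ subordinating its complex structure and a fixed theta characteristic $K_C^{1/2}$, and let $r\ge2$. Let $D$ be an effective divisor of $C$, and $$\mathbf{q}=(q_2,\dots,q_r)\in B(D):=\bigoplus_{\ell=2}^r H^0\big(C,K_C(D)^{\otimes\ell}\big).$$ Define a meromorphic Higgs bundle $(E_0,\phi(\mathbf{q}))$ by $E_0=\bigoplus_{i=1}^r(K_C^{1/2})^{\otimes(r-2i+1)}$, $\phi(\mathbf{q})=X_-+\sum_{\ell=2}^r q_\ell X_+^{\ell-1}$, and a meromorphic oper $(E_\hbar,\nabla^\hbar(\mathbf{q}))$ by the local formula $\nabla^\hbar_\alpha(\mathbf{q})=d+\frac1\hbar\phi_\alpha(\mathbf{q})dx_\alpha$. The meromorphic oper defines a meromorphic Rees $\mathcal{D}$-module $\mathcal{E}(\mathbf{q})=\big(E_\hbar,\hbar\nabla^\hbar(\mathbf{q})\big)$ on $C$. Then the semi-classical limit of $\mathcal{E}(\mathbf{q})$ is the spectral curve $$\big(\det(\eta+\phi(\mathbf{q}))\big)_0\subset\overline{T^*C}$$ of $-\phi(\mathbf{q})$, where $\eta$ is the tautological $1$-form of $T^*C$ extended as a meromorphic form to $\overline{T^*C}$.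
   Context: Projective coordinate system: a covering of $C$ by simply connected coordinate neighborhoods $U_\alpha$ with coordinates $x_\alpha$ related on overlaps by Möbius transformations $x_\alpha=\frac{a_{\alpha\beta}x_\beta+b_{\alpha\beta}}{c_{\alpha\beta}x_\beta+d_{\alpha\beta}}$ with matrix in $\mathrm{SL}(2,\mathbb{C})$. The theta characteristic $K_C^{1/2}$ (a line bundle with square $K_C$) has cocycle $\xi_{\alpha\beta}=\pm(c_{\alpha\beta}x_\beta+d_{\alpha\beta})$, $\xi_{\alpha\beta}^2=dx_\beta/dx_\alpha$. With $s_i=i(r-i)$: $X_-=[\sqrt{s_{i-1}}\,\delta_{i-1,j}]_{i,j=1,\dots,r}$, $X_+=X_-^t$, $H=[X_+,X_-]=\mathrm{diag}(r-1,r-3,\dots,-(r-1))$. $E_\hbar$ is the bundle with transition functions $f_{\alpha\beta}^\hbar=\exp(H\log\xi_{\alpha\beta})\exp(\hbar\,\partial_\beta\log\xi_{\alpha\beta}X_+)$, $\partial_\beta=d/dx_\beta$. On $U_\alpha$, $q_\ell=(q_\ell)_\alpha dx_\alpha^\ell$ and $\phi_\alpha(\mathbf{q})=X_-+\sum_\ell(q_\ell)_\alpha X_+^{\ell-1}$. $\overline{T^*C}=\mathbb{P}(K_C\oplus\mathcal{O}_C)$ is the compactified cotangent bundle, with projection $\pi$ to $C$; $(\cdot)_0$ denotes the divisor of zeros. The spectral curve of a meromorphic Higgs field with poles along $D$ is the closure in $\overline{T^*C}$ (complex topology) of the zero divisor of the characteristic polynomial over $C\setminus\mathrm{supp}(D)$.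 Rees ring: $\widetilde{\mathcal{D}_C}=\bigoplus_{m\ge0}\hbar^mF_m\mathcal{D}_C\subset\mathbb{C}[[\hbar]]\otimes\mathcal{D}_C$, where $F_m\mathcal{D}_C$ is the sheaf of differential operators of order $\le m$. Over $C\setminus\mathrm{supp}(D)$, $(E_\hbar,\hbar\nabla^\hbar(\mathbf{q}))$ is a Rees $\mathcal{D}$-module; its meromorphic extension (direct image under the open inclusion $C\setminus\mathrm{supp}(D)\hookrightarrow C$) is the meromorphic Rees $\mathcal{D}$-module $\mathcal{E}(\mathbf{q})$ on $C$. Locally on $U_\alpha\cap(C\setminus\mathrm{supp}(D))$, the system $(\hbar d+\phi_\alpha(\mathbf{q})dx_\alpha)\Psi=0$ for $\Psi=(\psi_{r-1},\dots,\psi_1,\psi)^t$ reduces, by eliminating $\psi_1,\dots,\psi_{r-1}$, to one equation $P_\alpha\psi=0$ with $P_\alpha$ monic of order $r$ in $\hbar\frac{d}{dx_\alpha}$, and the module is $\widetilde{\mathcal{D}_C}/\widetilde{\mathcal{D}_C}P_\alpha$. Semi-classical limit: for a Rees module locally of the form $\widetilde{\mathcal{D}_C}/\widetilde{\mathcal{D}_C}P$ with $P=\sum_{\ell=0}^r a_\ell(x,\hbar)(\hbar\frac{d}{dx})^{r-\ell}$, the semi-classical limit over that open set is the zero divisor of $\sum_{\ell=0}^r a_\ell(x,0)y^{r-\ell}$, with $y$ the fiber coordinate of $T^*C$ such that $\eta=y\,dx$, these divisors being glued over $C\setminus\mathrm{supp}(D)$; the semi-classical limit of the meromorphic extension is the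 closure in $\overline{T^*C}$ (complex topology) of the resulting divisor over $C\setminus\mathrm{supp}(D)$. *)

theory Defs
  imports
    "HOL-Complex_Analysis.Meromorphic"
    "Jordan_Normal_Form.Char_Poly"
begin

hide_const (open) Finite_Cartesian_Product.mat Determinants.det

section \<open>Curves with a projective coordinate system\<close>

text \<open>
  The curve is the type \<open>'a\<close>; \<open>'i\<close> indexes the charts. A smooth projective curve over the
  complex numbers is treated as a compact connected Riemann surface, whose complex structure is
  the one given by the projective atlas.
\<close>

record ('i, 'a) atlas =
  nbd :: "'i \<Rightarrow> 'a set"
  crd :: "'i \<Rightarrow> 'a \<Rightarrow> complex"

definition pt :: "('i, 'a) atlas \<Rightarrow> 'i \<Rightarrow> complex \<Rightarrow> 'a" where
  "pt X \<alpha> = inv_into (nbd X \<alpha>) (crd X \<alpha>)"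

definition projective_coordinate_system ::
  "('i, 'a::t2_space) atlas \<Rightarrow> ('i \<Rightarrow> 'i \<Rightarrow> complex) \<Rightarrow> ('i \<Rightarrow> 'i \<Rightarrow> complex)
    \<Rightarrow> ('i \<Rightarrow> 'i \<Rightarrow> complex) \<Rightarrow> ('i \<Rightarrow> 'i \<Rightarrow> complex) \<Rightarrow> bool" where
  "projective_coordinate_system X a b c d \<longleftrightarrow>
     compact (UNIV :: 'a set) \<and> connected (UNIV :: 'a set) \<and>
     (\<Union>\<alpha>. nbd X \<alpha>) = UNIV \<and>
     (\<forall>\<alpha>. open (nbd X \<alpha>) \<and> simply_connected (nbd X \<alpha>) \<and>
        open (crd X \<alpha> ` nbd X \<alpha>) \<and>
        homeomorphism (nbd X \<alpha>) (crd X \<alpha> ` nbd X \<alpha>) (crd X \<alpha>) (pt X \<alpha>)) \<and>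
     (\<forall>\<alpha> \<beta>. nbd X \<alpha> \<inter> nbd X \<beta> \<noteq> {} \<longrightarrow>
        a \<alpha> \<beta> * d \<alpha> \<beta> - b \<alpha> \<beta> * c \<alpha> \<beta> = 1 \<and>
        (\<forall>p \<in> nbd X \<alpha> \<inter> nbd X \<beta>.
           c \<alpha> \<beta> * crd X \<beta> p + d \<alpha> \<beta> \<noteq> 0 \<and>
           crd X \<alpha> p = (a \<alpha> \<beta> * crd X \<beta> p + b \<alpha> \<beta>) / (c \<alpha> \<beta> * crd X \<beta> p + d \<alpha> \<beta>)))"

text \<open>The sign is continuous, hence constant on each component of an overlap.\<close>

definition theta_characteristic ::
  "('i, 'a::t2_space) atlas \<Rightarrow> ('i \<Rightarrow> 'i \<Rightarrow> complex) \<Rightarrow> ('i \<Rightarrow> 'i \<Rightarrow> complex)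
    \<Rightarrow> ('i \<Rightarrow> 'i \<Rightarrow> 'a \<Rightarrow> complex) \<Rightarrow> bool" where
  "theta_characteristic X c d \<xi> \<longleftrightarrow>
     (\<forall>\<alpha> \<beta>. continuous_on (nbd X \<alpha> \<inter> nbd X \<beta>) (\<xi> \<alpha> \<beta>) \<and>
        (\<forall>p \<in> nbd X \<alpha> \<inter> nbd X \<beta>.
           \<xi> \<alpha> \<beta> p = c \<alpha> \<beta> * crd X \<beta> p + d \<alpha> \<beta> \<or>
           \<xi> \<alpha> \<beta> p = - (c \<alpha> \<beta> * crd X \<beta> p + d \<alpha> \<beta>))) \<and>
     (\<forall>\<alpha> \<beta> \<gamma>. \<forall>p \<in> nbd X \<alpha> \<inter> nbd X \<beta> \<inter> nbd X \<gamma>.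
        \<xi> \<alpha> \<beta> p * \<xi> \<beta> \<gamma> p = \<xi> \<alpha> \<gamma> p)"

text \<open>\<open>dcrd X \<beta> f p\<close> is the derivative \<open>df/dx\<^sub>\<beta>\<close> at \<open>p\<close>.\<close>

definition dcrd :: "('i, 'a) atlas \<Rightarrow> 'i \<Rightarrow> ('a \<Rightarrow> complex) \<Rightarrow> 'a \<Rightarrow> complex" where
  "dcrd X \<beta> f p = deriv (\<lambda>z. f (pt X \<beta> z)) (crd X \<beta> p)"

text \<open>\<open>jac X \<beta> \<alpha>\<close> is \<open>dx\<^sub>\<beta>/dx\<^sub>\<alpha>\<close>.\<close>

definition jac :: "('i, 'a) atlas \<Rightarrow> 'i \<Rightarrow> 'i \<Rightarrow> 'a \<Rightarrow> complex" where
  "jac X \<beta> \<alpha> = dcrd X \<alpha> (crd X \<beta>)"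

text \<open>Effective divisors on the curve are functions \<open>D :: 'a \<Rightarrow> nat\<close> with finite support.\<close>

definition supp :: "('a \<Rightarrow> nat) \<Rightarrow> 'a set" where
  "supp D = {p. D p \<noteq> 0}"

text \<open>
  Global sections of \<open>K(D)\<close> to the power \<open>l\<close>: the component \<open>q \<alpha>\<close>, a function of the coordinate
  \<open>x\<^sub>\<alpha>\<close>, is the coefficient of \<open>dx\<^sub>\<alpha>\<close> to the power \<open>l\<close>; its values on the support of \<open>D\<close> are
  irrelevant.
\<close>

definition sections_KD :: "('i, 'a) atlas \<Rightarrow> ('a \<Rightarrow> nat) \<Rightarrow> nat \<Rightarrow> ('i \<Rightarrow> complex \<Rightarrow> complex) set" where
  "sections_KD X D l = {q.
     (\<forall>\<alpha>. q \<alpha> holomorphic_on crd X \<alpha> ` (nbd X \<alpha> - supp D)) \<and>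
     (\<forall>\<alpha>. \<forall>p \<in> nbd X \<alpha>. \<exists>N g. open N \<and> crd X \<alpha> p \<in> N \<and> g holomorphic_on N \<and>
        (\<forall>z \<in> N - {crd X \<alpha> p}. q \<alpha> z * (z - crd X \<alpha> p) ^ (l * D p) = g z)) \<and>
     (\<forall>\<alpha> \<beta>. \<forall>p \<in> nbd X \<alpha> \<inter> nbd X \<beta> - supp D.
        q \<alpha> (crd X \<alpha> p) = q \<beta> (crd X \<beta> p) * jac X \<beta> \<alpha> p ^ l)}"


section \<open>Vector bundles, Higgs fields and connections in local frames\<close>

text \<open>
  Transition functions are \<open>\<Psi>\<^sub>\<alpha> = g \<alpha> \<beta> \<Psi>\<^sub>\<beta>\<close>; endomorphism-valued forms on the chart \<open>\<alpha>\<close> are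
  written \<open>A dx\<^sub>\<alpha>\<close> with \<open>A\<close> a matrix-valued function of the coordinate.
\<close>

definition vector_bundle ::
  "('i, 'a) atlas \<Rightarrow> nat \<Rightarrow> ('i \<Rightarrow> 'i \<Rightarrow> 'a \<Rightarrow> complex mat) \<Rightarrow> bool" where
  "vector_bundle X r g \<longleftrightarrow>
     (\<forall>\<alpha> \<beta>. \<forall>p \<in> nbd X \<alpha> \<inter> nbd X \<beta>. g \<alpha> \<beta> p \<in> carrier_mat r r \<and> det (g \<alpha> \<beta> p) \<noteq> 0) \<and>
     (\<forall>\<alpha> \<beta>. \<forall>i < r. \<forall>j < r.
        (\<lambda>z. g \<alpha> \<beta> (pt X \<beta> z) $$ (i, j)) holomorphic_on crd X \<beta> ` (nbd X \<alpha> \<inter> nbd X \<beta>)) \<and>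
     (\<forall>\<alpha> \<beta> \<gamma>. \<forall>p \<in> nbd X \<alpha> \<inter> nbd X \<beta> \<inter> nbd X \<gamma>. g \<alpha> \<beta> p * g \<beta> \<gamma> p = g \<alpha> \<gamma> p)"

definition meromorphic_matrix ::
  "('i, 'a) atlas \<Rightarrow> ('a \<Rightarrow> nat) \<Rightarrow> nat \<Rightarrow> 'i \<Rightarrow> (complex \<Rightarrow> complex mat) \<Rightarrow> bool" where
  "meromorphic_matrix X D r \<alpha> A \<longleftrightarrow>
     (\<forall>z \<in> crd X \<alpha> ` nbd X \<alpha>. A z \<in> carrier_mat r r) \<and>
     (\<forall>i < r. \<forall>j < r.
        (\<lambda>z. A z $$ (i, j)) holomorphic_on crd X \<alpha> ` (nbd X \<alpha> - supp D) \<and>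
        (\<lambda>z. A z $$ (i, j)) meromorphic_on crd X \<alpha> ` nbd X \<alpha>)"

definition meromorphic_higgs_bundle ::
  "('i, 'a) atlas \<Rightarrow> ('a \<Rightarrow> nat) \<Rightarrow> nat \<Rightarrow> ('i \<Rightarrow> 'i \<Rightarrow> 'a \<Rightarrow> complex mat)
    \<Rightarrow> ('i \<Rightarrow> complex \<Rightarrow> complex mat) \<Rightarrow> bool" where
  "meromorphic_higgs_bundle X D r g \<phi> \<longleftrightarrow>
     vector_bundle X r g \<and> (\<forall>\<alpha>. meromorphic_matrix X D r \<alpha> (\<phi> \<alpha>)) \<and>
     (\<forall>\<alpha> \<beta>. \<forall>p \<in> nbd X \<alpha> \<inter> nbd X \<beta> - supp D.
        \<phi> \<alpha> (crd X \<alpha> p) * g \<alpha> \<beta> p =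
          jac X \<beta> \<alpha> p \<cdot>\<^sub>m (g \<alpha> \<beta> p * \<phi> \<beta> (crd X \<beta> p)))"

definition dmat ::
  "('i, 'a) atlas \<Rightarrow> nat \<Rightarrow> 'i \<Rightarrow> ('a \<Rightarrow> complex mat) \<Rightarrow> 'a \<Rightarrow> complex mat" where
  "dmat X r \<beta> g p = Matrix.mat r r (\<lambda>ij. dcrd X \<beta> (\<lambda>p'. g p' $$ ij) p)"

text \<open>
  The gauge law of the \<open>h\<close>-connection \<open>h d + A\<^sub>\<alpha> dx\<^sub>\<alpha>\<close> away from the support of \<open>D\<close>; for
  \<open>h = 1\<close> that of a connection.
\<close>

definition gauge_compatible ::
  "('i, 'a) atlas \<Rightarrow> ('a \<Rightarrow> nat) \<Rightarrow> nat \<Rightarrow> complex \<Rightarrow> ('i \<Rightarrow> 'i \<Rightarrow> 'a \<Rightarrow> complex mat)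
    \<Rightarrow> ('i \<Rightarrow> complex \<Rightarrow> complex mat) \<Rightarrow> bool" where
  "gauge_compatible X D r h g A \<longleftrightarrow>
     (\<forall>\<alpha> \<beta>. \<forall>p \<in> nbd X \<alpha> \<inter> nbd X \<beta> - supp D.
        A \<alpha> (crd X \<alpha> p) * g \<alpha> \<beta> p =
          jac X \<beta> \<alpha> p \<cdot>\<^sub>m (g \<alpha> \<beta> p * A \<beta> (crd X \<beta> p) - h \<cdot>\<^sub>m dmat X r \<beta> (g \<alpha> \<beta>) p))"

text \<open>
  A family of bundles with connections \<open>d + conn \<alpha> h dx\<^sub>\<alpha>\<close> indexed by \<open>h\<close>. In the definition of
  an oper the filtration is the one spanned by the first frame vectors: the transition functions
  preserve it, the connection moves it by one step, and the induced maps on the graded pieces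
  are isomorphisms off the support of \<open>D\<close>.
\<close>

record ('i, 'a) hbar_family =
  frank :: nat
  ftrans :: "'i \<Rightarrow> 'i \<Rightarrow> complex \<Rightarrow> 'a \<Rightarrow> complex mat"
  fconn :: "'i \<Rightarrow> complex \<Rightarrow> complex \<Rightarrow> complex mat"

definition meromorphic_oper ::
  "('i, 'a) atlas \<Rightarrow> ('a \<Rightarrow> nat) \<Rightarrow> ('i, 'a) hbar_family \<Rightarrow> bool" where
  "meromorphic_oper X D F \<longleftrightarrow> (\<forall>h. h \<noteq> 0 \<longrightarrow>
     vector_bundle X (frank F) (\<lambda>\<alpha> \<beta>. ftrans F \<alpha> \<beta> h) \<and>
     (\<forall>\<alpha>. meromorphic_matrix X D (frank F) \<alpha> (fconn F \<alpha> h)) \<and>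
     gauge_compatible X D (frank F) 1 (\<lambda>\<alpha> \<beta>. ftrans F \<alpha> \<beta> h) (\<lambda>\<alpha>. fconn F \<alpha> h) \<and>
     (\<forall>\<alpha> \<beta>. \<forall>p \<in> nbd X \<alpha> \<inter> nbd X \<beta>. upper_triangular (ftrans F \<alpha> \<beta> h p)) \<and>
     (\<forall>\<alpha>. \<forall>p \<in> nbd X \<alpha> - supp D. \<forall>i < frank F. \<forall>j < frank F.
        (Suc j < i \<longrightarrow> fconn F \<alpha> h (crd X \<alpha> p) $$ (i, j) = 0) \<and>
        (i = Suc j \<longrightarrow> fconn F \<alpha> h (crd X \<alpha> p) $$ (i, j) \<noteq> 0)))"


section \<open>Meromorphic Rees D-modules\<close>

text \<open>
  A Rees D-module is a bundle over \<open>O[h]\<close> with an action of \<open>h d/dx\<close>, that is, with an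
  \<open>h\<close>-connection \<open>h d + rconn \<alpha> dx\<^sub>\<alpha>\<close>; the entries of \<open>rconn\<close> are polynomials in \<open>h\<close>. The
  meromorphic extension over the support of \<open>D\<close> is a direct image, so it is determined by these
  data off the support.
\<close>

record ('i, 'a) rees_module =
  rrank :: nat
  rtrans :: "'i \<Rightarrow> 'i \<Rightarrow> complex \<Rightarrow> 'a \<Rightarrow> complex mat"
  rconn :: "'i \<Rightarrow> complex \<Rightarrow> complex poly mat"

definition meromorphic_rees_module ::
  "('i, 'a) atlas \<Rightarrow> ('a \<Rightarrow> nat) \<Rightarrow> ('i, 'a) rees_module \<Rightarrow> bool" where
  "meromorphic_rees_module X D M \<longleftrightarrow>
     (\<forall>h. vector_bundle X (rrank M) (\<lambda>\<alpha> \<beta>. rtrans M \<alpha> \<beta> h)) \<and>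
     (\<forall>\<alpha> \<beta>. \<forall>i < rrank M. \<forall>j < rrank M. \<exists>n t.
        (\<forall>m \<le> n. t m holomorphic_on crd X \<beta> ` (nbd X \<alpha> \<inter> nbd X \<beta>)) \<and>
        (\<forall>p \<in> nbd X \<alpha> \<inter> nbd X \<beta>. \<forall>h.
           rtrans M \<alpha> \<beta> h p $$ (i, j) = (\<Sum>m\<le>n. t m (crd X \<beta> p) * h ^ m))) \<and>
     (\<forall>\<alpha>. \<exists>n. \<forall>z \<in> crd X \<alpha> ` nbd X \<alpha>. \<forall>i < rrank M. \<forall>j < rrank M.
        degree (rconn M \<alpha> z $$ (i, j)) \<le> n) \<and>
     (\<forall>\<alpha> m. meromorphic_matrix X D (rrank M) \<alpha> (\<lambda>z. map_mat (\<lambda>p. coeff p m) (rconn M \<alpha> z))) \<and>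
     (\<forall>h. gauge_compatible X D (rrank M) h (\<lambda>\<alpha> \<beta>. rtrans M \<alpha> \<beta> h)
        (\<lambda>\<alpha> z. map_mat (\<lambda>p. poly p h) (rconn M \<alpha> z)))"

text \<open>The pair consisting of the bundle and \<open>h\<close> times the connection.\<close>

definition rees_of :: "('i, 'a) hbar_family \<Rightarrow> ('i, 'a) rees_module" where
  "rees_of F = \<lparr>rrank = frank F, rtrans = ftrans F,
     rconn = (\<lambda>\<alpha> z. Matrix.mat (frank F) (frank F)
       (\<lambda>ij. THE p. \<forall>h. h \<noteq> 0 \<longrightarrow> poly p h = h * fconn F \<alpha> h z $$ ij))\<rparr>"

text \<open>
  Sections of the Rees ring over an open subset \<open>V\<close> of a coordinate domain. Since
  \<open>h\<^sup>m a (d/dx)\<^sup>k\<close> with \<open>k \<le> m\<close> equals \<open>a h\<^bsup>m - k\<^esup> (h d/dx)\<^sup>k\<close>, the ring is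
  \<open>O(V)[h]\<langle>h d/dx\<rangle>\<close>; the operator \<open>P\<close> has \<open>P k m\<close> as the coefficient of \<open>h\<^sup>m (h d/dx)\<^sup>k\<close>.
  Functions on \<open>V\<close> are extended by \<open>0\<close>, so that equality of sections is equality.
\<close>

type_synonym hop = "nat \<Rightarrow> nat \<Rightarrow> complex \<Rightarrow> complex"

definition rees_ring :: "complex set \<Rightarrow> hop set" where
  "rees_ring V = {P. (\<forall>k m. P k m holomorphic_on V \<and> (\<forall>z. z \<notin> V \<longrightarrow> P k m z = 0)) \<and>
     finite {(k, m). P k m \<noteq> (\<lambda>z. 0)}}"

definition hop_restrict :: "complex set \<Rightarrow> hop \<Rightarrow> hop" where
  "hop_restrict V P = (\<lambda>k m z. if z \<in> V then P k m z else 0)"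

text \<open>
  Composition of operators, from
  \<open>(h d/dx)\<^sup>k b = \<Sum>j\<le>k. (k choose j) h\<^sup>j b\<^bsup>(j)\<^esup> (h d/dx)\<^bsup>k - j\<^esup>\<close>.
\<close>

definition hop_mult :: "hop \<Rightarrow> hop \<Rightarrow> hop" (infixl \<open>\<odot>\<close> 70) where
  "(A \<odot> B) = (\<lambda>k m z. \<Sum>j\<le>m. \<Sum>n\<le>m - j. \<Sum>l\<le>k.
     of_nat ((k + j - l) choose j) * A (k + j - l) (m - j - n) z * (deriv ^^ j) (B l n) z)"

text \<open>Row vectors over the Rees ring, with entries \<open>v i\<close> for \<open>i < r\<close>.\<close>

definition rees_rows :: "complex set \<Rightarrow> nat \<Rightarrow> (nat \<Rightarrow> hop) set" where
  "rees_rows V r = {v. (\<forall>i < r. v i \<in> rees_ring V) \<and> (\<forall>i \<ge> r. v i = (\<lambda>k m z. 0))}"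

text \<open>
  The entry \<open>(i, j)\<close> of \<open>h d/dx + A\<close>, so that row \<open>i\<close> is the \<open>i\<close>-th equation of the system
  \<open>(h d/dx + A) \<Psi> = 0\<close>.
\<close>

definition system_entry :: "complex set \<Rightarrow> (complex \<Rightarrow> complex poly mat) \<Rightarrow> nat \<Rightarrow> nat \<Rightarrow> hop" where
  "system_entry V A i j = (\<lambda>k m z. if z \<notin> V then 0
     else if k = 0 then coeff (A z $$ (i, j)) m
     else if k = 1 \<and> m = 0 \<and> i = j then 1 else 0)"

definition system_relations ::
  "complex set \<Rightarrow> nat \<Rightarrow> (complex \<Rightarrow> complex poly mat) \<Rightarrow> (nat \<Rightarrow> hop) set" where
  "system_relations V r A = {v \<in> rees_rows V r. \<exists>B \<in> rees_rows V r. \<forall>j < r.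
     v j = (\<lambda>k m z. \<Sum>i<r. (B i \<odot> system_entry V A i j) k m z)}"

text \<open>
  As usual for systems of linear differential equations, the left module of
  \<open>(h d/dx + A) \<Psi> = 0\<close> has the components of \<open>\<Psi>\<close> as generators and the equations as relations;
  it is \<open>rees_rows\<close> modulo \<open>system_relations\<close>. (Letting \<open>h d/dx\<close> act on the frame by \<open>A\<close> would give
  the dual module and the opposite sign of the Higgs field below.)

  The predicate says that over \<open>W\<close>, contained in the chart \<open>\<alpha>\<close> and disjoint from the support of
  \<open>D\<close>, this module is isomorphic to the Rees ring modulo the left ideal of \<open>P\<close>. A homomorphism
  from the latter is \<open>B \<mapsto> B e\<close> for a section \<open>e\<close>, and the two clauses are its well-definedness with
  injectivity, and its surjectivity. They are required over all connected open subsets, as for an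
  isomorphism of sheaves.
\<close>

definition locally_cyclic ::
  "('i, 'a::topological_space) atlas \<Rightarrow> ('a \<Rightarrow> nat) \<Rightarrow> ('i, 'a) rees_module
    \<Rightarrow> 'i \<Rightarrow> 'a set \<Rightarrow> hop \<Rightarrow> bool" where
  "locally_cyclic X D M \<alpha> W P \<longleftrightarrow>
     open W \<and> W \<subseteq> nbd X \<alpha> - supp D \<and> P \<in> rees_ring (crd X \<alpha> ` W) \<and>
     (\<exists>e \<in> rees_rows (crd X \<alpha> ` W) (rrank M).
        \<forall>V. open V \<and> connected V \<and> V \<subseteq> crd X \<alpha> ` W \<longrightarrow>
          (\<forall>B \<in> rees_ring V.
             (\<lambda>i. B \<odot> hop_restrict V (e i)) \<in> system_relations V (rrank M) (rconn M \<alpha>) \<longleftrightarrow>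
             (\<exists>Q \<in> rees_ring V. B = Q \<odot> hop_restrict V P)) \<and>
          (\<forall>v \<in> rees_rows V (rrank M). \<exists>B \<in> rees_ring V.
             (\<lambda>i k m z. v i k m z - (B \<odot> hop_restrict V (e i)) k m z)
               \<in> system_relations V (rrank M) (rconn M \<alpha>)))"

text \<open>The symbol at \<open>h = 0\<close>, as a function of the coordinates \<open>(x, y)\<close> of the cotangent bundle.\<close>

definition symbol0 :: "hop \<Rightarrow> complex \<times> complex \<Rightarrow> complex" where
  "symbol0 P = (\<lambda>(x, y). \<Sum>k | P k 0 \<noteq> (\<lambda>z. 0). P k 0 x * y ^ k)"


section \<open>The compactified cotangent bundle\<close>

text \<open>
  A cotangent vector \<open>\<omega>\<close> at \<open>p\<close> is given by its coefficients, \<open>\<omega> \<alpha> dx\<^sub>\<alpha>\<close> in each chart around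
  \<open>p\<close>. Points of \<open>P(K \<oplus> O)\<close> over \<open>p\<close> are lines in the space of pairs of a cotangent vector and a
  number.
\<close>

type_synonym ('i, 'a) bundle_pt = "'a \<times> (('i \<Rightarrow> complex) \<times> complex) set"

definition cotangent_space :: "('i, 'a) atlas \<Rightarrow> 'a \<Rightarrow> ('i \<Rightarrow> complex) set" where
  "cotangent_space X p = {\<omega>.
     (\<forall>\<alpha> \<beta>. p \<in> nbd X \<alpha> \<inter> nbd X \<beta> \<longrightarrow> \<omega> \<alpha> = \<omega> \<beta> * jac X \<beta> \<alpha> p) \<and>
     (\<forall>\<alpha>. p \<notin> nbd X \<alpha> \<longrightarrow> \<omega> \<alpha> = 0)}"

definition line :: "('i \<Rightarrow> complex) \<Rightarrow> complex \<Rightarrow> (('i \<Rightarrow> complex) \<times> complex) set" where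
  "line \<omega> c = range (\<lambda>t. (\<lambda>\<alpha>. t * \<omega> \<alpha>, t * c))"

definition compact_cotangent :: "('i, 'a) atlas \<Rightarrow> ('i, 'a) bundle_pt set" where
  "compact_cotangent X =
     {(p, line \<omega> c) | p \<omega> c. \<omega> \<in> cotangent_space X p \<and> (\<omega>, c) \<noteq> (\<lambda>\<alpha>. 0, 0)}"

text \<open>The part of the cotangent bundle lying over the complement of \<open>S\<close>.\<close>

definition cotangent_off :: "('i, 'a) atlas \<Rightarrow> 'a set \<Rightarrow> ('i, 'a) bundle_pt set" where
  "cotangent_off X S = {(p, line \<omega> 1) | p \<omega>. \<omega> \<in> cotangent_space X p \<and> p \<notin> S}"

text \<open>
  The inverse charts \<open>(x\<^sub>\<alpha>, y) \<mapsto> [y dx\<^sub>\<alpha> : 1]\<close>, in which the tautological form is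
  \<open>\<eta> = y dx\<^sub>\<alpha>\<close>, and \<open>(x\<^sub>\<alpha>, w) \<mapsto> [dx\<^sub>\<alpha> : w]\<close> around the section at infinity, where
  \<open>\<eta> = dx\<^sub>\<alpha> / w\<close>.
\<close>

definition form_at :: "('i, 'a) atlas \<Rightarrow> 'i \<Rightarrow> 'a \<Rightarrow> complex \<Rightarrow> 'i \<Rightarrow> complex" where
  "form_at X \<alpha> p y = (\<lambda>\<beta>. if p \<in> nbd X \<beta> then y * jac X \<alpha> \<beta> p else 0)"

definition par_fin :: "('i, 'a) atlas \<Rightarrow> 'i \<Rightarrow> complex \<times> complex \<Rightarrow> ('i, 'a) bundle_pt" where
  "par_fin X \<alpha> = (\<lambda>(x, y). (pt X \<alpha> x, line (form_at X \<alpha> (pt X \<alpha> x) y) 1))"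

definition par_inf :: "('i, 'a) atlas \<Rightarrow> 'i \<Rightarrow> complex \<times> complex \<Rightarrow> ('i, 'a) bundle_pt" where
  "par_inf X \<alpha> = (\<lambda>(x, w). (pt X \<alpha> x, line (form_at X \<alpha> (pt X \<alpha> x) 1) w))"

definition par_dom :: "('i, 'a) atlas \<Rightarrow> 'i \<Rightarrow> (complex \<times> complex) set" where
  "par_dom X \<alpha> = crd X \<alpha> ` nbd X \<alpha> \<times> UNIV"

definition compact_cotangent_open :: "('i, 'a) atlas \<Rightarrow> ('i, 'a) bundle_pt set \<Rightarrow> bool" where
  "compact_cotangent_open X S \<longleftrightarrow> S \<subseteq> compact_cotangent X \<and>
     (\<forall>\<alpha>. open {c \<in> par_dom X \<alpha>. par_fin X \<alpha> c \<in> S} \<and>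
          open {c \<in> par_dom X \<alpha>. par_inf X \<alpha> c \<in> S})"

definition compact_cotangent_topology :: "('i, 'a) atlas \<Rightarrow> ('i, 'a) bundle_pt topology" where
  "compact_cotangent_topology X = topology (compact_cotangent_open X)"

lemma openin_compact_cotangent:
  "openin (compact_cotangent_topology X) = compact_cotangent_open X"
proof -
  have "istopology (compact_cotangent_open X)"
    unfolding istopology_def
  proof (intro conjI allI impI)
    fix S T assume "compact_cotangent_open X S" "compact_cotangent_open X T"
    moreover have "{c \<in> par_dom X \<alpha>. f c \<in> S \<inter> T} =
        {c \<in> par_dom X \<alpha>. f c \<in> S} \<inter> {c \<in> par_dom X \<alpha>. f c \<in> T}" for f \<alpha> by auto
    ultimately show "compact_cotangent_open X (S \<inter> T)"
      unfolding compact_cotangent_open_def by (auto simp only: intro!: open_Int)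
  next
    fix K assume "\<forall>S\<in>K. compact_cotangent_open X S"
    moreover have "{c \<in> par_dom X \<alpha>. f c \<in> \<Union>K} = (\<Union>S\<in>K. {c \<in> par_dom X \<alpha>. f c \<in> S})"
      for f \<alpha> by auto
    ultimately show "compact_cotangent_open X (\<Union>K)"
      unfolding compact_cotangent_open_def by (auto simp only: intro!: open_UN)
  qed
  then show ?thesis by (simp add: compact_cotangent_topology_def topology_inverse')
qed


section \<open>Divisors\<close>

definition holomorphic2_on :: "(complex \<times> complex \<Rightarrow> complex) \<Rightarrow> (complex \<times> complex) set \<Rightarrow> bool"
    where
  "holomorphic2_on f N \<longleftrightarrow>
     (\<forall>c \<in> N. \<exists>a b. (f has_derivative (\<lambda>(s, t). a * s + b * t)) (at c))"

definition holomorphic_near ::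
  "('i, 'a) atlas \<Rightarrow> (('i, 'a) bundle_pt \<Rightarrow> complex) \<Rightarrow> ('i, 'a) bundle_pt \<Rightarrow> bool" where
  "holomorphic_near X g P \<longleftrightarrow>
     (\<forall>\<alpha>. \<forall>f \<in> {par_fin X \<alpha>, par_inf X \<alpha>}. \<forall>c \<in> par_dom X \<alpha>. f c = P \<longrightarrow>
        (\<exists>N. open N \<and> c \<in> N \<and> N \<subseteq> par_dom X \<alpha> \<and> holomorphic2_on (g \<circ> f) N))"

text \<open>
  An effective divisor on an open part of the surface is represented by the stalks of its ideal
  sheaf: a point is mapped to the set of functions whose germ there lies in the ideal (functions
  serve as representatives of their germs). This records multiplicities. The divisor of zeros of
  \<open>F\<close> has the germs divisible by \<open>F\<close> as its ideal, and its support is where the ideal is proper.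
\<close>

type_synonym ('i, 'a) divisor = "('i, 'a) bundle_pt \<Rightarrow> (('i, 'a) bundle_pt \<Rightarrow> complex) set"

definition multiples_at ::
  "('i, 'a) atlas \<Rightarrow> 'i \<Rightarrow> (complex \<times> complex \<Rightarrow> complex) \<Rightarrow> complex \<times> complex
    \<Rightarrow> (('i, 'a) bundle_pt \<Rightarrow> complex) set" where
  "multiples_at X \<alpha> F c = {g. \<exists>N h. open N \<and> c \<in> N \<and> N \<subseteq> par_dom X \<alpha> \<and>
     holomorphic2_on h N \<and> (\<forall>c' \<in> N. g (par_fin X \<alpha> c') = h c' * F c')}"

text \<open>
  The zero divisor, over the complement of \<open>S\<close>, of the section of a line bundle on the cotangent
  bundle which is given by the function \<open>F \<alpha>\<close> of \<open>(x\<^sub>\<alpha>, y)\<close> in the chart \<open>\<alpha>\<close>.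
\<close>

definition divisor_of_zeros ::
  "('i, 'a) atlas \<Rightarrow> 'a set \<Rightarrow> ('i \<Rightarrow> complex \<times> complex \<Rightarrow> complex) \<Rightarrow> ('i, 'a) divisor" where
  "divisor_of_zeros X S F = (\<lambda>P. {g. P \<in> cotangent_off X S \<and>
     (\<forall>\<alpha>. \<forall>c \<in> par_dom X \<alpha>. par_fin X \<alpha> c = P \<longrightarrow> g \<in> multiples_at X \<alpha> (F \<alpha>) c)})"

definition divisor_support ::
  "('i, 'a) bundle_pt set \<Rightarrow> ('i, 'a) divisor \<Rightarrow> ('i, 'a) bundle_pt set" where
  "divisor_support Y Z = {P \<in> Y. (\<lambda>_. 1) \<notin> Z P}"

text \<open>
  The closure in the compactified cotangent bundle of a divisor over the complement of \<open>S\<close>. A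
  germ belongs to its ideal when its restriction to the open part does, which keeps the
  multiplicity of every component; the support is the topological closure of the support, as the
  lemma shows.
\<close>

definition divisor_closure :: "('i, 'a) atlas \<Rightarrow> 'a set \<Rightarrow> ('i, 'a) divisor \<Rightarrow> ('i, 'a) divisor"
    where
  "divisor_closure X S Z = (\<lambda>P. {g. holomorphic_near X g P \<and>
     (\<exists>T. openin (compact_cotangent_topology X) T \<and> P \<in> T \<and>
        (\<forall>P' \<in> T \<inter> cotangent_off X S. g \<in> Z P'))})"

lemma divisor_support_closure:
  assumes "projective_coordinate_system X a b c d"
  shows "divisor_support (topspace (compact_cotangent_topology X)) (divisor_closure X S Z) =
    compact_cotangent_topology X closure_of divisor_support (cotangent_off X S) Z"
proof -
  have "open (par_dom X \<alpha>)" for \<alpha>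
    using assms by (auto simp: projective_coordinate_system_def par_dom_def intro!: open_Times)
  moreover have "holomorphic2_on ((\<lambda>_. 1) \<circ> f) N"
    for f :: "complex \<times> complex \<Rightarrow> 'b \<times> (('a \<Rightarrow> complex) \<times> complex) set" and N
    unfolding holomorphic2_on_def
  proof (intro ballI exI)
    fix c
    have "(\<lambda>(s, t). 0 * s + 0 * t) = (\<lambda>_::complex \<times> complex. 0::complex)" by auto
    then show "((\<lambda>_. 1) \<circ> f has_derivative (\<lambda>(s, t). 0 * s + 0 * t)) (at c)"
      by (simp add: o_def)
  qed
  ultimately have "holomorphic_near X (\<lambda>_. 1) P" for P
    unfolding holomorphic_near_def by blast
  then show ?thesis
    unfolding divisor_support_def divisor_closure_def closure_of_def by blast
qed

text \<open>
  The first clause of the semi-classical limit says that the module is locally of the form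
  required, the second that the zero divisors of all its local presentations glue to \<open>Z\<^sub>0\<close>.
\<close>

definition is_semiclassical_limit ::
  "('i, 'a::topological_space) atlas \<Rightarrow> ('a \<Rightarrow> nat) \<Rightarrow> ('i, 'a) rees_module
    \<Rightarrow> ('i, 'a) divisor \<Rightarrow> bool" where
  "is_semiclassical_limit X D M Z \<longleftrightarrow>
     (\<forall>p. p \<notin> supp D \<longrightarrow> (\<exists>\<alpha> W P. p \<in> W \<and> locally_cyclic X D M \<alpha> W P)) \<and>
     (\<exists>Z\<^sub>0.
        (\<forall>\<alpha> W P. locally_cyclic X D M \<alpha> W P \<longrightarrow>
           (\<forall>c \<in> crd X \<alpha> ` W \<times> UNIV. Z\<^sub>0 (par_fin X \<alpha> c) = multiples_at X \<alpha> (symbol0 P) c)) \<and>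
        Z = divisor_closure X (supp D) Z\<^sub>0)"

text \<open>
  The characteristic polynomial \<open>det (\<eta> - \<phi>)\<close>, with \<open>\<eta> = y dx\<^sub>\<alpha>\<close>, is \<open>poly (char_poly (\<phi> \<alpha> x)) y\<close>
  in the chart \<open>\<alpha>\<close>.
\<close>

definition spectral_curve ::
  "('i, 'a) atlas \<Rightarrow> ('a \<Rightarrow> nat) \<Rightarrow> ('i \<Rightarrow> complex \<Rightarrow> complex mat) \<Rightarrow> ('i, 'a) divisor" where
  "spectral_curve X D \<phi> = divisor_closure X (supp D)
     (divisor_of_zeros X (supp D) (\<lambda>\<alpha> (x, y). poly (char_poly (\<phi> \<alpha> x)) y))"


section \<open>The Higgs bundle and the oper of a tuple of differentials\<close>

text \<open>Matrix indices start at \<open>0\<close>.\<close>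

definition X_minus :: "nat \<Rightarrow> complex mat" where
  "X_minus r = Matrix.mat r r
     (\<lambda>(i, j). if i = Suc j then complex_of_real (sqrt (real (i * (r - i)))) else 0)"

definition X_plus :: "nat \<Rightarrow> complex mat" where
  "X_plus r = transpose_mat (X_minus r)"

definition H_mat :: "nat \<Rightarrow> complex mat" where
  "H_mat r = X_plus r * X_minus r - X_minus r * X_plus r"

definition mat_exp :: "complex mat \<Rightarrow> complex mat" where
  "mat_exp A = Matrix.mat (dim_row A) (dim_row A) (\<lambda>ij. \<Sum>k. (A ^\<^sub>m k) $$ ij / fact k)"

definition higgs_field :: "nat \<Rightarrow> (nat \<Rightarrow> 'i \<Rightarrow> complex \<Rightarrow> complex) \<Rightarrow> 'i \<Rightarrow> complex \<Rightarrow> complex mat"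
    where
  "higgs_field r q \<alpha> x = Matrix.mat r r (\<lambda>ij.
     X_minus r $$ ij + (\<Sum>l = 2..r. q l \<alpha> x * (X_plus r ^\<^sub>m (l - 1)) $$ ij))"

definition E0_trans ::
  "('i \<Rightarrow> 'i \<Rightarrow> 'a \<Rightarrow> complex) \<Rightarrow> nat \<Rightarrow> 'i \<Rightarrow> 'i \<Rightarrow> 'a \<Rightarrow> complex mat" where
  "E0_trans \<xi> r \<alpha> \<beta> p = Matrix.mat r r
     (\<lambda>(i, j). if i = j then \<xi> \<alpha> \<beta> p powi (int r - 2 * int (Suc i) + 1) else 0)"

text \<open>
  The eigenvalues of \<open>H_mat\<close> are integers, so the branch of the logarithm does not matter; its
  derivative is \<open>\<xi>'/\<xi>\<close>.
\<close>

definition Eh_trans ::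
  "('i, 'a) atlas \<Rightarrow> ('i \<Rightarrow> 'i \<Rightarrow> 'a \<Rightarrow> complex) \<Rightarrow> nat \<Rightarrow> 'i \<Rightarrow> 'i \<Rightarrow> complex \<Rightarrow> 'a \<Rightarrow> complex mat"
    where
  "Eh_trans X \<xi> r \<alpha> \<beta> h p =
     mat_exp (Ln (\<xi> \<alpha> \<beta> p) \<cdot>\<^sub>m H_mat r) *
     mat_exp ((h * (dcrd X \<beta> (\<xi> \<alpha> \<beta>) p / \<xi> \<alpha> \<beta> p)) \<cdot>\<^sub>m X_plus r)"

definition oper_of ::
  "('i, 'a) atlas \<Rightarrow> ('i \<Rightarrow> 'i \<Rightarrow> 'a \<Rightarrow> complex) \<Rightarrow> nat
    \<Rightarrow> (nat \<Rightarrow> 'i \<Rightarrow> complex \<Rightarrow> complex) \<Rightarrow> ('i, 'a) hbar_family" where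
  "oper_of X \<xi> r q = \<lparr>frank = r, ftrans = Eh_trans X \<xi> r,
     fconn = (\<lambda>\<alpha> h x. (1 / h) \<cdot>\<^sub>m higgs_field r q \<alpha> x)\<rparr>"

end

theory Submission
  imports Defs "HOL-Library.Function_Algebras"
begin

text \<open>
  In a chart the connection matrix is Hessenberg with nonzero constants on the subdiagonal, so the
  equations of the system eliminate all unknowns but the last one, and the module is the Rees ring
  modulo one operator. Conversely let \<open>P\<close> be the operator of any cyclic presentation. Modulo \<open>h\<close> the
  module is the cokernel of \<open>y + \<phi>\<close> over \<open>O[y]\<close>. Multiplying by the adjugate, \<open>det (y + \<phi>)\<close>
  annihilates it, while an element annihilating it is a multiple of \<open>det (y + \<phi>)\<close> because one cofactor
  is a nonzero constant. Hence the symbol of \<open>P\<close> and \<open>det (y + \<phi>)\<close> generate the same ideal, and these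
  ideals glue because the gauge law at \<open>h = 0\<close> conjugates the Higgs fields of two charts up to the
  Jacobian. The gauge law itself is the commutation rule
  \<open>exp (t X\<^sub>+) X\<^sub>- = (X\<^sub>- + t H - t\<^sup>2 X\<^sub>+) exp (t X\<^sub>+)\<close> together with \<open>u' = -u\<^sup>2\<close> for the logarithmic
  derivative \<open>u = c / (c x + d)\<close> of \<open>\<xi>\<close>.
\<close>

section \<open>The Rees ring\<close>

text \<open>The limit quantifies over all local presentations, so computing the operator produced by
  elimination does not settle it: the generator \<open>e\<close> and the operator \<open>P\<close>
  are arbitrary, and \<open>P\<close> is known only as generator of the left annihilator of
  \<open>e\<close> over a noncommutative ring, whereas adjugates need the commutative ring of
  symbols. Two facts connect the rings: \<open>sym0\<close> is multiplicative, and an operator with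
  zero symbol is h times an operator. The adjugate only shows that det (y + \<phi>) annihilates
  \<open>e\<close> modulo h. The error is h v, and v equals B e modulo relations because
  \<open>e\<close> generates; hence det (y + \<phi>) - h B annihilates \<open>e\<close> exactly, is
  a left multiple of \<open>P\<close>, and still has symbol det (y + \<phi>). In the other direction
  the cofactor is constant, so dividing by it creates no poles. Both quotients are thus polynomials
  in y with holomorphic coefficients in x, which is what equality of stalks, and not merely of
  supports, requires.\<close>

lemma sum_fun_apply: "(\<Sum>i\<in>I. f i) x = (\<Sum>i\<in>I. f i x)"
  for f :: "'b \<Rightarrow> 'c \<Rightarrow> 'd::comm_monoid_add"
  by (induction I rule: infinite_finite_induct) auto

definition hop_h :: "hop \<Rightarrow> hop" where
  "hop_h B = (\<lambda>k m z. case m of 0 \<Rightarrow> 0 | Suc n \<Rightarrow> B k n z)"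

text \<open>Left multiplication by \<open>h d/dx\<close>: passing a coefficient b costs the
  commutator h b', which raises the power m of h; the other term raises the order k.\<close>

definition hop_d :: "complex set \<Rightarrow> hop \<Rightarrow> hop" where
  "hop_d V B = (\<lambda>k m z. if z \<in> V then (case k of 0 \<Rightarrow> 0 | Suc l \<Rightarrow> B l m z) +
     (case m of 0 \<Rightarrow> 0 | Suc n \<Rightarrow> deriv (B k n) z) else 0)"

definition hop_scalar :: "complex set \<Rightarrow> complex \<Rightarrow> hop" where
  "hop_scalar V a = (\<lambda>k m z. if z \<in> V \<and> k = 0 \<and> m = 0 then a else 0)"

definition bounded_order :: "nat \<Rightarrow> hop \<Rightarrow> bool" where
  "bounded_order N A \<longleftrightarrow> (\<forall>k m. k > N \<or> m > N \<longrightarrow> A k m = (\<lambda>z. 0))"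

lemma bounded_order_mono: "bounded_order N A \<Longrightarrow> N \<le> N' \<Longrightarrow> bounded_order N' A"
  by (auto simp: bounded_order_def)

lemma finite_support_iff_bounded_order:
  "finite {(k, m). A k m \<noteq> (\<lambda>z. 0)} \<longleftrightarrow> (\<exists>N. bounded_order N A)" for A :: hop
proof
  assume fin: "finite {(k, m). A k m \<noteq> (\<lambda>z. 0)}"
  let ?S = "{(k, m). A k m \<noteq> (\<lambda>z. 0)}"
  obtain N where N: "\<forall>x \<in> fst ` ?S \<union> snd ` ?S. x \<le> N"
    using fin by (meson finite_UnI finite_imageI finite_nat_set_iff_bounded_le)
  have "k \<le> N \<and> m \<le> N" if "A k m \<noteq> (\<lambda>z. 0)" for k m
  proof -
    have "fst (k, m) \<in> fst ` ?S" "snd (k, m) \<in> snd ` ?S"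
      using that by (intro imageI; simp)+
    then show ?thesis using N by simp
  qed
  then have "bounded_order N A" unfolding bounded_order_def by (meson leD)
  then show "\<exists>N. bounded_order N A" ..
next
  assume "\<exists>N. bounded_order N A"
  then obtain N where "bounded_order N A" ..
  then have "{(k, m). A k m \<noteq> (\<lambda>z. 0)} \<subseteq> {..N} \<times> {..N}"
    unfolding bounded_order_def by (auto intro: leI)
  then show "finite {(k, m). A k m \<noteq> (\<lambda>z. 0)}"
    by (rule finite_subset) simp
qed

lemma rees_ring_iff:
  "A \<in> rees_ring V \<longleftrightarrow>
    (\<forall>k m. A k m holomorphic_on V) \<and> (\<forall>k m z. z \<notin> V \<longrightarrow> A k m z = 0) \<and> (\<exists>N. bounded_order N A)"
  unfolding rees_ring_def finite_support_iff_bounded_order by auto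

lemma rees_ring_holomorphic: "A \<in> rees_ring V \<Longrightarrow> A k m holomorphic_on V"
  by (simp add: rees_ring_iff)

lemma rees_ring_outside: "A \<in> rees_ring V \<Longrightarrow> z \<notin> V \<Longrightarrow> A k m z = 0"
  by (simp add: rees_ring_iff)

lemma rees_ring_bounded: "A \<in> rees_ring V \<Longrightarrow> \<exists>N. bounded_order N A"
  by (simp add: rees_ring_iff)

lemma higher_deriv_zero [simp]: "(deriv ^^ j) (\<lambda>z. 0) = (\<lambda>z. 0 :: complex)"
  by (induction j) auto

lemma hop_h_funpow: "(hop_h ^^ M) B k m z = (if M \<le> m then B k (m - M) z else 0)"
  by (induction M arbitrary: m) (auto simp: hop_h_def split: nat.splits)

text \<open>Pascal's rule in summed form, the inductive step of Leibniz's rule below.\<close>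

lemma sum_choose_Suc:
  "(\<Sum>j\<le>Suc K. of_nat (Suc K choose j) * g j) =
    (\<Sum>j\<le>K. of_nat (K choose j) * (g j + g (Suc j)))" for g :: "nat \<Rightarrow> complex"
proof -
  have "(\<Sum>j\<le>Suc K. of_nat (Suc K choose j) * g j) =
      g 0 + (\<Sum>j\<le>K. of_nat (Suc K choose Suc j) * g (Suc j))"
    by (subst sum.atMost_Suc_shift) simp
  also have "\<dots> = (g 0 + (\<Sum>j\<le>K. of_nat (K choose Suc j) * g (Suc j))) +
      (\<Sum>j\<le>K. of_nat (K choose j) * g (Suc j))"
    by (simp add: algebra_simps sum.distrib)
  also have "g 0 + (\<Sum>j\<le>K. of_nat (K choose Suc j) * g (Suc j)) =
      (\<Sum>j\<le>Suc K. of_nat (K choose j) * g j)"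
    by (subst sum.atMost_Suc_shift) simp
  also have "\<dots> = (\<Sum>j\<le>K. of_nat (K choose j) * g j)"
    by simp
  finally show ?thesis by (simp add: algebra_simps sum.distrib)
qed

context
  fixes V :: "complex set"
  assumes V: "open V"
begin

lemma holomorphic_hop_d:
  assumes "\<And>k m. B k m holomorphic_on V"
  shows "hop_d V B k m holomorphic_on V"
proof -
  have "(\<lambda>z. (case k of 0 \<Rightarrow> 0 | Suc l \<Rightarrow> B l m z) +
      (case m of 0 \<Rightarrow> 0 | Suc n \<Rightarrow> deriv (B k n) z)) holomorphic_on V"
    using assms V by (cases k; cases m) (auto intro!: holomorphic_intros)
  then show ?thesis
    by (rule holomorphic_transform) (simp add: hop_d_def)
qed

lemma higher_deriv_hop_d:
  assumes B: "\<And>k m. B k m holomorphic_on V" and z: "z \<in> V"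
  shows "(deriv ^^ j) (hop_d V B k m) z =
    (case k of 0 \<Rightarrow> 0 | Suc l \<Rightarrow> (deriv ^^ j) (B l m) z) +
    (case m of 0 \<Rightarrow> 0 | Suc n \<Rightarrow> (deriv ^^ Suc j) (B k n) z)"
proof -
  let ?f = "\<lambda>w. case k of 0 \<Rightarrow> 0 | Suc l \<Rightarrow> B l m w"
  let ?g = "\<lambda>w. case m of 0 \<Rightarrow> 0 | Suc n \<Rightarrow> deriv (B k n) w"
  have f: "?f holomorphic_on V" using B by (cases k) auto
  have g: "?g holomorphic_on V" using B V by (cases m) (auto intro!: holomorphic_intros)
  have "(deriv ^^ j) (hop_d V B k m) z = (deriv ^^ j) (\<lambda>w. ?f w + ?g w) z"
    by (rule higher_deriv_transform_within_open[OF holomorphic_hop_d _ V z])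
      (use f g B in \<open>auto simp: hop_d_def intro!: holomorphic_intros\<close>)
  also have "\<dots> = (deriv ^^ j) ?f z + (deriv ^^ j) ?g z"
    by (rule higher_deriv_add[OF f g V z])
  finally show ?thesis
    by (cases k; cases m) (simp_all add: funpow_Suc_right del: funpow.simps)
qed

text \<open>Iterating the commutation rule yields Leibniz's formula for (h d/dx)^K, the one built
  into \<open>hop_mult\<close>. The guard keeps the natural subtractions exact.\<close>

lemma hop_d_funpow:
  assumes "\<And>k m. B k m holomorphic_on V" and z: "z \<in> V"
  shows "(hop_d V ^^ K) B k m z = (\<Sum>j\<le>K. of_nat (K choose j) *
    (if j \<le> m \<and> K \<le> k + j then (deriv ^^ j) (B (k + j - K) (m - j)) z else 0))"
  using assms(1)
proof (induction K arbitrary: B)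
  case 0
  then show ?case by simp
next
  case (Suc K)
  let ?g = "\<lambda>j. if j \<le> m \<and> Suc K \<le> k + j then (deriv ^^ j) (B (k + j - Suc K) (m - j)) z else 0"
  have "(hop_d V ^^ Suc K) B k m z = (hop_d V ^^ K) (hop_d V B) k m z"
    by (simp add: funpow_swap1)
  also have "\<dots> = (\<Sum>j\<le>K. of_nat (K choose j) *
     (if j \<le> m \<and> K \<le> k + j then (deriv ^^ j) (hop_d V B (k + j - K) (m - j)) z else 0))"
    by (rule Suc.IH) (rule holomorphic_hop_d[OF Suc.prems])
  also have "\<dots> = (\<Sum>j\<le>K. of_nat (K choose j) * (?g j + ?g (Suc j)))"
  proof (rule sum.cong[OF refl])
    fix j
    have "(if j \<le> m \<and> K \<le> k + j then (deriv ^^ j) (hop_d V B (k + j - K) (m - j)) z else 0) =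
        ?g j + ?g (Suc j)"
    proof (cases "j \<le> m \<and> K \<le> k + j")
      case True
      then obtain n l where m: "m = j + n" and l: "k + j = K + l" by (metis le_iff_add)
      have l': "k + Suc j = Suc (K + l)" using l by simp
      show ?thesis
        unfolding m l l' higher_deriv_hop_d[OF Suc.prems z]
        by (cases n; cases l) (simp_all del: funpow.simps)
    next
      case False
      then show ?thesis by auto
    qed
    then show "of_nat (K choose j) *
        (if j \<le> m \<and> K \<le> k + j then (deriv ^^ j) (hop_d V B (k + j - K) (m - j)) z else 0) =
        of_nat (K choose j) * (?g j + ?g (Suc j))" by simp
  qed
  also have "\<dots> = (\<Sum>j\<le>Suc K. of_nat (Suc K choose j) * ?g j)"
    by (rule sum_choose_Suc[symmetric])
  finally show ?case .
qed

text \<open>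
  Reduces associativity to the facts that \<open>hop_h\<close> and \<open>hop_d\<close> commute with multiplication from the
  right.
\<close>

lemma hop_mult_expansion:
  assumes A: "bounded_order N A"
    and B: "\<And>k m. B k m holomorphic_on V" and z: "z \<in> V"
  shows "(A \<odot> B) k m z = (\<Sum>K\<le>N. \<Sum>M\<le>N. A K M z * (hop_h ^^ M) ((hop_d V ^^ K) B) k m z)"
proof -
  let ?f = "\<lambda>(j, n, l). of_nat ((k + j - l) choose j) * A (k + j - l) (m - j - n) z *
     (deriv ^^ j) (B l n) z"
  let ?g = "\<lambda>(K, M, j). if M \<le> m \<and> j \<le> m - M \<and> K \<le> k + j
     then A K M z * (of_nat (K choose j) * (deriv ^^ j) (B (k + j - K) (m - M - j)) z) else 0"
  let ?S = "SIGMA j:{..m}. SIGMA n:{..m - j}. {..k}"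
  let ?T = "SIGMA K:{..N}. SIGMA M:{..N}. {..K}"
  have A0: "A K M z = 0" if "K > N \<or> M > N" for K M
    using A that unfolding bounded_order_def by (metis (full_types))
  have "(A \<odot> B) k m z = sum ?f ?S"
    by (simp add: hop_mult_def sum.Sigma split_def)
  also have "\<dots> = sum ?g ?T"
  \<comment> \<open>K = k + j - l is the order and M = m - j - n the power of h taken from
    \<open>A\<close>; solving for l and n gives the inverse. Indices in \<open>S'\<close> carry a
    vanishing coefficient of \<open>A\<close>, those in \<open>T'\<close> violate the guard, so no
    subtraction is truncated on the matched terms.\<close>
  proof (rule sum.reindex_bij_witness_not_neutral[where
        S' = "{(j, n, l) \<in> ?S. k + j - l > N \<or> m - j - n > N}" and
        T' = "{(K, M, j) \<in> ?T. \<not> (M \<le> m \<and> j \<le> m - M \<and> K \<le> k + j)}" and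
        i = "\<lambda>(K, M, j). (j, m - M - j, k + j - K)" and
        j = "\<lambda>(j, n, l). (k + j - l, m - j - n, j)"])
    show "finite {(j, n, l) \<in> ?S. k + j - l > N \<or> m - j - n > N}"
      by (rule finite_subset[of _ ?S]) auto
    show "finite {(K, M, j) \<in> ?T. \<not> (M \<le> m \<and> j \<le> m - M \<and> K \<le> k + j)}"
      by (rule finite_subset[of _ ?T]) auto
  next
    fix x assume "x \<in> ?S - {(j, n, l) \<in> ?S. k + j - l > N \<or> m - j - n > N}"
    then obtain j n l where "x = (j, n, l)"
      "(j, n, l) \<in> ?S - {(j, n, l) \<in> ?S. k + j - l > N \<or> m - j - n > N}" by (cases x) blast
    then have x: "x = (j, n, l)" "j \<le> m" "n \<le> m - j" "l \<le> k"
      "k + j - l \<le> N" "m - j - n \<le> N" by auto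
    show "(case case x of (j, n, l) \<Rightarrow> (k + j - l, m - j - n, j) of
        (K, M, j) \<Rightarrow> (j, m - M - j, k + j - K)) = x"
      using x by auto
    show "(case x of (j, n, l) \<Rightarrow> (k + j - l, m - j - n, j))
        \<in> ?T - {(K, M, j) \<in> ?T. \<not> (M \<le> m \<and> j \<le> m - M \<and> K \<le> k + j)}"
      using x by auto
  next
    fix x assume "x \<in> ?T - {(K, M, j) \<in> ?T. \<not> (M \<le> m \<and> j \<le> m - M \<and> K \<le> k + j)}"
    then obtain K M j where x: "x = (K, M, j)" "K \<le> N" "M \<le> N" "j \<le> K"
      "M \<le> m" "j \<le> m - M" "K \<le> k + j" by auto
    have e: "k + j - (k + j - K) = K" "m - j - (m - M - j) = M" using x by auto
    show "(case case x of (K, M, j) \<Rightarrow> (j, m - M - j, k + j - K) of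
        (j, n, l) \<Rightarrow> (k + j - l, m - j - n, j)) = x"
      using x e by simp
    show "(case x of (K, M, j) \<Rightarrow> (j, m - M - j, k + j - K))
        \<in> ?S - {(j, n, l) \<in> ?S. k + j - l > N \<or> m - j - n > N}"
      using x e by auto
  next
    fix x assume "x \<in> {(j, n, l) \<in> ?S. k + j - l > N \<or> m - j - n > N}"
    then show "?f x = 0" using A0 by auto
  next
    fix x assume "x \<in> {(K, M, j) \<in> ?T. \<not> (M \<le> m \<and> j \<le> m - M \<and> K \<le> k + j)}"
    then show "?g x = 0" by auto
  next
    fix x assume "x \<in> ?S"
    then obtain j n l where x: "x = (j, n, l)" "j \<le> m" "n \<le> m - j" "l \<le> k" by auto
    have e: "k + j - (k + j - l) = l" "m - (m - j - n) - j = n" using x by auto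
    show "?g (case x of (j, n, l) \<Rightarrow> (k + j - l, m - j - n, j)) = ?f x"
      using x e by simp
  qed
  also have "\<dots> = (\<Sum>K\<le>N. \<Sum>M\<le>N. \<Sum>j\<le>K. ?g (K, M, j))"
    by (simp add: sum.Sigma case_prod_beta' cong: if_cong)
  also have "\<dots> = (\<Sum>K\<le>N. \<Sum>M\<le>N. A K M z * (hop_h ^^ M) ((hop_d V ^^ K) B) k m z)"
  proof (intro sum.cong refl)
    fix K M
    have "(hop_h ^^ M) ((hop_d V ^^ K) B) k m z = (\<Sum>j\<le>K. if M \<le> m \<and> j \<le> m - M \<and> K \<le> k + j
        then of_nat (K choose j) * (deriv ^^ j) (B (k + j - K) (m - M - j)) z else 0)"
      unfolding hop_h_funpow hop_d_funpow[OF B z] by (auto intro!: sum.cong)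
    then show "(\<Sum>j\<le>K. ?g (K, M, j)) = A K M z * (hop_h ^^ M) ((hop_d V ^^ K) B) k m z"
      by (auto simp: sum_distrib_left intro!: sum.cong)
  qed
  finally show ?thesis .
qed

end

text \<open>In a nonzero term all four indices are at most N, and l \<le> k then forces j \<le> N.
  Hence k \<le> 2 N and m \<le> 3 N, and 4 N is a convenient overestimate.\<close>

lemma bounded_order_hop_mult:
  assumes "bounded_order N A" "bounded_order N B"
  shows "bounded_order (4 * N) (A \<odot> B)"
  unfolding bounded_order_def
proof (intro allI impI ext)
  fix k m z assume km: "4 * N < k \<or> 4 * N < m"
  have "A (k + j - l) (m - j - n) z * (deriv ^^ j) (B l n) z = 0"
    if "j \<le> m" "n \<le> m - j" "l \<le> k" for j n l
  proof (cases "k + j - l > N \<or> m - j - n > N \<or> l > N \<or> n > N")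
    case True
    then show ?thesis using assms by (auto simp: bounded_order_def)
  next
    case False
    then show ?thesis using that km by linarith
  qed
  then show "(A \<odot> B) k m z = 0"
    unfolding hop_mult_def by (intro sum.neutral ballI) (simp add: mult.assoc)
qed

section \<open>Closure of the Rees ring under its operations\<close>

lemma rees_ring_common_bound:
  assumes "A \<in> rees_ring V" "B \<in> rees_ring V"
  obtains N where "bounded_order N A" "bounded_order N B"
proof -
  obtain N1 N2 where "bounded_order N1 A" "bounded_order N2 B"
    using assms rees_ring_bounded by blast
  then show ?thesis
    by (intro that[of "max N1 N2"]) (auto elim: bounded_order_mono)
qed

lemma rees_ring_hop_mult:
  assumes V: "open V" and A: "A \<in> rees_ring V" and B: "B \<in> rees_ring V"
  shows "A \<odot> B \<in> rees_ring V"
proof -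
  obtain N where "bounded_order N A" "bounded_order N B"
    using rees_ring_common_bound[OF A B] .
  then have "\<exists>N. bounded_order N (A \<odot> B)" using bounded_order_hop_mult by blast
  moreover have "(A \<odot> B) k m holomorphic_on V" for k m
    unfolding hop_mult_def using rees_ring_holomorphic[OF A] rees_ring_holomorphic[OF B] V
    by (intro holomorphic_intros holomorphic_higher_deriv) auto
  moreover have "(A \<odot> B) k m z = 0" if "z \<notin> V" for k m z
    unfolding hop_mult_def using rees_ring_outside[OF A that] by simp
  ultimately show ?thesis by (simp add: rees_ring_iff)
qed

lemma rees_ring_0 [simp]: "0 \<in> rees_ring V"
  by (auto simp: rees_ring_iff bounded_order_def zero_fun_def)

lemma rees_ring_add:
  assumes A: "A \<in> rees_ring V" and B: "B \<in> rees_ring V"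
  shows "A + B \<in> rees_ring V"
proof -
  obtain N where "bounded_order N A" "bounded_order N B"
    using rees_ring_common_bound[OF A B] .
  then have "bounded_order N (A + B)" by (auto simp: bounded_order_def plus_fun_def)
  then show ?thesis
    using A B by (auto simp: rees_ring_iff plus_fun_def intro!: holomorphic_intros)
qed

lemma rees_ring_diff:
  assumes A: "A \<in> rees_ring V" and B: "B \<in> rees_ring V"
  shows "A - B \<in> rees_ring V"
proof -
  obtain N where "bounded_order N A" "bounded_order N B"
    using rees_ring_common_bound[OF A B] .
  then have "bounded_order N (A - B)" by (auto simp: bounded_order_def fun_diff_def)
  then show ?thesis
    using A B by (auto simp: rees_ring_iff fun_diff_def intro!: holomorphic_intros)
qed

lemma rees_ring_sum: "(\<And>i. i \<in> I \<Longrightarrow> F i \<in> rees_ring V) \<Longrightarrow> (\<Sum>i\<in>I. F i) \<in> rees_ring V"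
  by (induction I rule: infinite_finite_induct) (auto intro: rees_ring_add)

lemma rees_ring_scalar [simp]: "hop_scalar V a \<in> rees_ring V"
proof -
  have "hop_scalar V a k m holomorphic_on V" for k m
    by (rule holomorphic_transform[of "\<lambda>z. if k = 0 \<and> m = 0 then a else 0"])
      (auto simp: hop_scalar_def)
  moreover have "bounded_order 0 (hop_scalar V a)"
    by (auto simp: bounded_order_def hop_scalar_def)
  ultimately show ?thesis by (auto simp: rees_ring_iff hop_scalar_def)
qed

lemma bounded_order_hop_h: "bounded_order N A \<Longrightarrow> bounded_order (Suc N) (hop_h A)"
  by (auto simp: bounded_order_def hop_h_def split: nat.splits)

lemma bounded_order_hop_d:
  assumes N: "bounded_order N A"
  shows "bounded_order (Suc N) (hop_d V A)"
  unfolding bounded_order_def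
proof (intro allI impI ext)
  fix k m z assume "Suc N < k \<or> Suc N < m"
  then show "hop_d V A k m z = 0"
    using N by (cases k; cases m) (auto simp: bounded_order_def hop_d_def)
qed

lemma rees_ring_hop_h:
  assumes A: "A \<in> rees_ring V"
  shows "hop_h A \<in> rees_ring V"
proof -
  obtain N where "bounded_order N A" using rees_ring_bounded[OF A] ..
  then have "bounded_order (Suc N) (hop_h A)" by (rule bounded_order_hop_h)
  moreover have "hop_h A k m holomorphic_on V" for k m
    using A by (cases m) (auto simp: rees_ring_iff hop_h_def)
  ultimately show ?thesis using A
    by (auto simp: rees_ring_iff hop_h_def split: nat.splits)
qed

lemma rees_ring_hop_d:
  assumes V: "open V" and A: "A \<in> rees_ring V"
  shows "hop_d V A \<in> rees_ring V"
proof -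
  obtain N where N: "bounded_order N A" using rees_ring_bounded[OF A] ..
  have "bounded_order (Suc N) (hop_d V A)" by (rule bounded_order_hop_d[OF N])
  then show ?thesis
    using holomorphic_hop_d[OF V rees_ring_holomorphic[OF A]]
    by (auto simp: rees_ring_iff hop_d_def)
qed

lemma hop_h_commute_hop_d: "hop_d V (hop_h B) = hop_h (hop_d V B)"
proof (intro ext)
  fix k m z
  show "hop_d V (hop_h B) k m z = hop_h (hop_d V B) k m z"
    by (cases k; cases m) (auto simp: hop_d_def hop_h_def split: nat.splits)
qed

lemma hop_h_funpow_commute_hop_d: "hop_d V ((hop_h ^^ M) B) = (hop_h ^^ M) (hop_d V B)"
  by (induction M) (simp_all add: hop_h_commute_hop_d)

lemma rees_ring_funpow:
  assumes "open V" "A \<in> rees_ring V"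
  shows "(hop_h ^^ M) ((hop_d V ^^ K) A) \<in> rees_ring V"
proof -
  have "(hop_d V ^^ K) A \<in> rees_ring V"
    using assms by (induction K) (auto intro: rees_ring_hop_d)
  then show ?thesis by (induction M) (auto intro: rees_ring_hop_h)
qed

text \<open>The left factor enters a product only through its values at z and is never
  differentiated, so the coefficients \<open>c\<close> may be numbers frozen at that point. This is
  what allows the expansion of a left factor to be substituted pointwise in the proof of
  associativity.\<close>

lemma hop_mult_linear_left:
  assumes "\<And>k m. Y k m z = (\<Sum>i\<in>I. c i * F i k m z)"
  shows "(Y \<odot> C) k m z = (\<Sum>i\<in>I. c i * (F i \<odot> C) k m z)"
proof -
  have "(\<Sum>i\<in>I. c i * (F i \<odot> C) k m z) = (\<Sum>j\<le>m. \<Sum>n\<le>m - j. \<Sum>l\<le>k. \<Sum>i\<in>I. c i *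
     (of_nat ((k + j - l) choose j) * F i (k + j - l) (m - j - n) z * (deriv ^^ j) (C l n) z))"
    unfolding hop_mult_def sum_distrib_left
    by (subst sum.swap, rule sum.cong[OF refl], subst sum.swap, rule sum.cong[OF refl], rule sum.swap)
  also have "\<dots> = (Y \<odot> C) k m z"
    unfolding hop_mult_def assms
    by (intro sum.cong refl) (simp add: sum_distrib_left sum_distrib_right mult_ac)
  finally show ?thesis by simp
qed

section \<open>Distributivity, units and associativity of composition\<close>

lemma hop_mult_add_left: "(A + B) \<odot> C = A \<odot> C + B \<odot> C"
  by (intro ext) (simp add: hop_mult_def sum.distrib algebra_simps)

lemma hop_mult_diff_left: "(A - B) \<odot> C = A \<odot> C - B \<odot> C"
  by (intro ext) (simp add: hop_mult_def sum_subtractf algebra_simps)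

lemma hop_mult_0_left [simp]: "0 \<odot> C = 0"
  by (intro ext) (simp add: hop_mult_def)

lemma hop_mult_0_right [simp]: "A \<odot> 0 = 0"
  by (intro ext) (simp add: hop_mult_def zero_fun_def)

lemma hop_mult_sum_left: "(\<Sum>i\<in>I. F i) \<odot> C = (\<Sum>i\<in>I. F i \<odot> C)"
  by (induction I rule: infinite_finite_induct)
    (simp_all only: not_False_eq_True sum.infinite sum.empty sum.insert hop_mult_0_left hop_mult_add_left)

lemma hop_mult_add_right:
  assumes V: "open V" and A: "A \<in> rees_ring V" and B: "B \<in> rees_ring V" and C: "C \<in> rees_ring V"
  shows "A \<odot> (B + C) = A \<odot> B + A \<odot> C"
proof (intro ext)
  fix k m z
  show "(A \<odot> (B + C)) k m z = (A \<odot> B + A \<odot> C) k m z"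
  proof (cases "z \<in> V")
    case True
    have "(deriv ^^ j) ((B + C) l n) z = (deriv ^^ j) (B l n) z + (deriv ^^ j) (C l n) z" for j l n
      using higher_deriv_add[OF rees_ring_holomorphic[OF B] rees_ring_holomorphic[OF C] V True]
      by (simp add: plus_fun_def)
    then show ?thesis by (simp add: hop_mult_def sum.distrib algebra_simps)
  next
    case False
    then show ?thesis by (simp add: hop_mult_def rees_ring_outside[OF A])
  qed
qed

lemma hop_mult_sum_right:
  assumes "open V" "A \<in> rees_ring V" "\<And>i. i \<in> I \<Longrightarrow> F i \<in> rees_ring V"
  shows "A \<odot> (\<Sum>i\<in>I. F i) = (\<Sum>i\<in>I. A \<odot> F i)"
  using assms(3)
  by (induction I rule: infinite_finite_induct)
    (auto simp: hop_mult_add_right[OF assms(1,2)] rees_ring_sum)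

lemma hop_mult_diff_right:
  assumes V: "open V" and A: "A \<in> rees_ring V" and B: "B \<in> rees_ring V" and C: "C \<in> rees_ring V"
  shows "A \<odot> (B - C) = A \<odot> B - A \<odot> C"
  using hop_mult_add_right[OF V A rees_ring_diff[OF B C] C] by (simp add: algebra_simps)

lemma hop_mult_scalar_left:
  assumes V: "open V" and B: "B \<in> rees_ring V"
  shows "hop_scalar V a \<odot> B = (\<lambda>k m z. a * B k m z)"
proof (intro ext)
  fix k m z
  have b: "bounded_order 0 (hop_scalar V a)"
    by (auto simp: bounded_order_def hop_scalar_def)
  show "(hop_scalar V a \<odot> B) k m z = a * B k m z"
  proof (cases "z \<in> V")
    case True
    then show ?thesis
      using hop_mult_expansion[OF V b rees_ring_holomorphic[OF B] True]
      by (simp add: hop_scalar_def)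
  next
    case False
    then show ?thesis
      by (simp add: rees_ring_outside[OF B] hop_mult_def hop_scalar_def)
  qed
qed

lemma hop_mult_one_left: "open V \<Longrightarrow> B \<in> rees_ring V \<Longrightarrow> hop_scalar V 1 \<odot> B = B"
  by (simp add: hop_mult_scalar_left)

text \<open>The coefficients stay constant on V, so each further \<open>hop_d\<close> only shifts
  the order. Expanding a product with the unit on the right therefore reads off the coefficients of
  the left factor.\<close>

lemma hop_d_funpow_one:
  assumes V: "open V" and z: "z \<in> V"
  shows "(hop_d V ^^ K) (hop_scalar V 1) k m z = (if k = K \<and> m = 0 then 1 else 0)"
  using z
proof (induction K arbitrary: k m z)
  case 0
  then show ?case by (simp add: hop_scalar_def)
next
  case (Suc K)
  have d: "deriv ((hop_d V ^^ K) (hop_scalar V 1) k m) z = 0" for k m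
  proof -
    have "eventually (\<lambda>w. w \<in> V) (nhds z)"
      using V Suc.prems eventually_nhds by blast
    then have "eventually (\<lambda>w. (hop_d V ^^ K) (hop_scalar V 1) k m w =
        (if k = K \<and> m = 0 then 1 else 0)) (nhds z)"
      by eventually_elim (rule Suc.IH)
    then have "deriv ((hop_d V ^^ K) (hop_scalar V 1) k m) z =
        deriv (\<lambda>_. if k = K \<and> m = 0 then 1 else 0) z"
      by (rule deriv_cong_ev) simp
    then show ?thesis by simp
  qed
  show ?case
    using Suc by (auto simp: hop_d_def[of V "(hop_d V ^^ K) _"] d split: nat.splits)
qed

lemma hop_mult_one_right:
  assumes V: "open V" and A: "A \<in> rees_ring V"
  shows "A \<odot> hop_scalar V 1 = A"
proof (intro ext)
  fix k m z
  obtain N where N: "bounded_order N A" using rees_ring_bounded[OF A] ..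
  show "(A \<odot> hop_scalar V 1) k m z = A k m z"
  proof (cases "z \<in> V")
    case True
    have "(A \<odot> hop_scalar V 1) k m z =
        (\<Sum>K\<le>N. \<Sum>M\<le>N. A K M z * (hop_h ^^ M) ((hop_d V ^^ K) (hop_scalar V 1)) k m z)"
      by (rule hop_mult_expansion[OF V N _ True]) (rule rees_ring_holomorphic[OF rees_ring_scalar])
    also have "\<dots> = (\<Sum>K\<le>N. \<Sum>M\<le>N. if K = k \<and> M = m then A K M z else 0)"
      by (intro sum.cong refl) (auto simp: hop_h_funpow hop_d_funpow_one[OF V True])
    also have "\<dots> = (\<Sum>K\<le>N. if K = k then (\<Sum>M\<le>N. if M = m then A K M z else 0) else 0)"
      by (intro sum.cong refl) auto
    also have "\<dots> = A k m z"
      using N by (auto simp: bounded_order_def)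
    finally show ?thesis .
  next
    case False
    then show ?thesis by (simp add: hop_mult_def rees_ring_outside[OF A])
  qed
qed

lemma hop_h_mult:
  assumes V: "open V" and B: "B \<in> rees_ring V" and C: "C \<in> rees_ring V"
  shows "hop_h (B \<odot> C) = hop_h B \<odot> C"
proof (intro ext)
  fix k m z
  obtain N where N: "bounded_order N B" using rees_ring_bounded[OF B] ..
  define X where "X K M = (hop_h ^^ M) ((hop_d V ^^ K) C)" for K M
  show "hop_h (B \<odot> C) k m z = (hop_h B \<odot> C) k m z"
  proof (cases "z \<in> V")
    case True
    have B0: "B (Suc N) M z = 0" for M using N by (simp add: bounded_order_def)
    have "(hop_h B \<odot> C) k m z = (\<Sum>K\<le>Suc N. \<Sum>M\<le>Suc N. hop_h B K M z * X K M k m z)"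
      unfolding X_def
      by (rule hop_mult_expansion[OF V bounded_order_hop_h[OF N] rees_ring_holomorphic[OF C] True])
    also have "\<dots> = (\<Sum>K\<le>Suc N. \<Sum>M\<le>N. B K M z * X K (Suc M) k m z)"
      by (simp add: sum.atMost_Suc_shift[of _ N] hop_h_def del: sum.atMost_Suc)
    also have "\<dots> = (\<Sum>K\<le>N. \<Sum>M\<le>N. B K M z * X K (Suc M) k m z)"
      by (simp add: B0)
    also have "\<dots> = hop_h (B \<odot> C) k m z"
      using hop_mult_expansion[OF V N rees_ring_holomorphic[OF C] True]
      by (cases m) (auto simp: X_def hop_h_def)
    finally show ?thesis by simp
  next
    case False
    then show ?thesis
      using rees_ring_outside[OF rees_ring_hop_mult[OF V rees_ring_hop_h[OF B] C]]
        rees_ring_outside[OF rees_ring_hop_h[OF rees_ring_hop_mult[OF V B C]]] by simp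
  qed
qed

text \<open>The product rule applied to each term \<open>B K M w * X K M k n w\<close> of the
  expansion: differentiating the coefficient pays with a factor h, which is the second summand of
  \<open>hop_d V B\<close>, and differentiating \<open>X\<close> turns K into K + 1, which is its
  first summand.\<close>

lemma hop_d_mult:
  assumes V: "open V" and B: "B \<in> rees_ring V" and C: "C \<in> rees_ring V"
  shows "hop_d V (B \<odot> C) = hop_d V B \<odot> C"
proof (intro ext)
  fix k m z
  obtain N where N: "bounded_order N B" using rees_ring_bounded[OF B] ..
  define X where "X K M = (hop_h ^^ M) ((hop_d V ^^ K) C)" for K M
  have X: "X K M \<in> rees_ring V" for K M
    unfolding X_def by (rule rees_ring_funpow[OF V C])
  have XS: "X K (Suc M) = hop_h (X K M)" "X (Suc K) M = hop_d V (X K M)" for K M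
    by (simp_all add: X_def hop_h_funpow_commute_hop_d)
  have E: "(B \<odot> C) k m w = (\<Sum>K\<le>N. \<Sum>M\<le>N. B K M w * X K M k m w)" if "w \<in> V" for k m w
    unfolding X_def by (rule hop_mult_expansion[OF V N rees_ring_holomorphic[OF C] that])
  show "hop_d V (B \<odot> C) k m z = (hop_d V B \<odot> C) k m z"
  proof (cases "z \<in> V")
    case z: True
    have D: "deriv ((B \<odot> C) k n) z = (\<Sum>K\<le>N. \<Sum>M\<le>N.
        deriv (B K M) z * X K M k n z + B K M z * deriv (X K M k n) z)" for k n
    proof -
      have "((\<lambda>w. \<Sum>K\<le>N. \<Sum>M\<le>N. B K M w * X K M k n w) has_field_derivative
          (\<Sum>K\<le>N. \<Sum>M\<le>N. deriv (B K M) z * X K M k n z + B K M z * deriv (X K M k n) z)) (at z)"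
      proof (intro DERIV_sum)
        fix K M
        show "((\<lambda>w. B K M w * X K M k n w) has_field_derivative
            deriv (B K M) z * X K M k n z + B K M z * deriv (X K M k n) z) (at z)"
          using DERIV_mult[OF holomorphic_derivI[OF rees_ring_holomorphic[OF B] V z]
              holomorphic_derivI[OF rees_ring_holomorphic[OF X] V z]]
          by (simp add: mult.commute)
      qed
      then have "((B \<odot> C) k n has_field_derivative
          (\<Sum>K\<le>N. \<Sum>M\<le>N. deriv (B K M) z * X K M k n z + B K M z * deriv (X K M k n) z)) (at z)"
        by (rule has_field_derivative_transform_within_open[OF _ V z]) (simp add: E)
      then show ?thesis by (rule DERIV_imp_deriv)
    qed
    \<comment> \<open>With the coefficients at N + 1 equal to zero, both indices may run to N + 1,
      and the shifts of K and of M by one become reindexings.\<close>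
    have B0: "B (Suc N) M = (\<lambda>z. 0)" "B K (Suc N) = (\<lambda>z. 0)" for K M
      using N by (simp_all add: bounded_order_def)
    have "hop_d V (B \<odot> C) k m z = (\<Sum>K\<le>N. \<Sum>M\<le>N.
        deriv (B K M) z * X K (Suc M) k m z + B K M z * X (Suc K) M k m z)"
      using z by (cases k; cases m)
        (simp_all add: hop_d_def hop_h_def XS E D sum.distrib algebra_simps)
    also have "\<dots> = (\<Sum>K\<le>N. \<Sum>M\<le>N. B K M z * X (Suc K) M k m z) +
        (\<Sum>K\<le>N. \<Sum>M\<le>N. deriv (B K M) z * X K (Suc M) k m z)"
      by (simp add: sum.distrib)
    also have "(\<Sum>K\<le>N. \<Sum>M\<le>N. B K M z * X (Suc K) M k m z) =
        (\<Sum>K\<le>Suc N. \<Sum>M\<le>Suc N. (case K of 0 \<Rightarrow> 0 | Suc L \<Rightarrow> B L M z) * X K M k m z)"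
      by (subst sum.atMost_Suc_shift) (simp add: B0)
    also have "(\<Sum>K\<le>N. \<Sum>M\<le>N. deriv (B K M) z * X K (Suc M) k m z) =
        (\<Sum>K\<le>Suc N. \<Sum>M\<le>Suc N. (case M of 0 \<Rightarrow> 0 | Suc n \<Rightarrow> deriv (B K n) z) * X K M k m z)"
    proof -
      have "(\<Sum>M\<le>Suc N. (case M of 0 \<Rightarrow> 0 | Suc n \<Rightarrow> deriv (B K n) z) * X K M k m z) =
          (\<Sum>M\<le>N. deriv (B K M) z * X K (Suc M) k m z)" for K
        by (subst sum.atMost_Suc_shift) simp
      then show ?thesis by (simp only:) (simp add: B0)
    qed
    also have "(\<Sum>K\<le>Suc N. \<Sum>M\<le>Suc N. (case K of 0 \<Rightarrow> 0 | Suc L \<Rightarrow> B L M z) * X K M k m z) +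
        (\<Sum>K\<le>Suc N. \<Sum>M\<le>Suc N. (case M of 0 \<Rightarrow> 0 | Suc n \<Rightarrow> deriv (B K n) z) * X K M k m z) =
        (\<Sum>K\<le>Suc N. \<Sum>M\<le>Suc N. hop_d V B K M z * X K M k m z)"
      unfolding sum.distrib[symmetric] using z
      by (intro sum.cong refl) (simp add: hop_d_def distrib_right)
    also have "\<dots> = (hop_d V B \<odot> C) k m z"
      unfolding X_def
      by (rule hop_mult_expansion[OF V bounded_order_hop_d[OF N] rees_ring_holomorphic[OF C] z,
            symmetric])
    finally show ?thesis .
  next
    case False
    then show ?thesis
      using rees_ring_outside[OF rees_ring_hop_mult[OF V rees_ring_hop_d[OF V B] C]]
        rees_ring_outside[OF rees_ring_hop_d[OF V rees_ring_hop_mult[OF V B C]]] by simp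
  qed
qed

lemma hop_mult_assoc:
  assumes V: "open V" and A: "A \<in> rees_ring V" and B: "B \<in> rees_ring V" and C: "C \<in> rees_ring V"
  shows "(A \<odot> B) \<odot> C = A \<odot> (B \<odot> C)"
proof (intro ext)
  fix k m z
  obtain N where N: "bounded_order N A" using rees_ring_bounded[OF A] ..
  have d: "(hop_d V ^^ K) B \<in> rees_ring V" for K
    using rees_ring_funpow[OF V B, of 0 K] by simp
  have dm: "(hop_d V ^^ K) (B \<odot> C) = (hop_d V ^^ K) B \<odot> C" for K
    by (induction K) (simp_all add: hop_d_mult[OF V d C])
  have hm: "(hop_h ^^ M) ((hop_d V ^^ K) (B \<odot> C)) = (hop_h ^^ M) ((hop_d V ^^ K) B) \<odot> C" for K M
    by (induction M) (simp_all add: dm hop_h_mult[OF V rees_ring_funpow[OF V B] C])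
  show "((A \<odot> B) \<odot> C) k m z = (A \<odot> (B \<odot> C)) k m z"
  proof (cases "z \<in> V")
    case True
    have "((A \<odot> B) \<odot> C) k m z = (\<Sum>x\<in>{..N} \<times> {..N}. A (fst x) (snd x) z *
        ((hop_h ^^ snd x) ((hop_d V ^^ fst x) B) \<odot> C) k m z)"
      by (rule hop_mult_linear_left)
        (simp add: hop_mult_expansion[OF V N rees_ring_holomorphic[OF B] True]
          sum.cartesian_product split_def)
    also have "\<dots> = (A \<odot> (B \<odot> C)) k m z"
      unfolding hop_mult_expansion[OF V N rees_ring_holomorphic[OF rees_ring_hop_mult[OF V B C]] True]
        hm
      by (simp add: sum.cartesian_product split_def)
    finally show ?thesis .
  next
    case False
    then show ?thesis
      using rees_ring_outside[OF rees_ring_hop_mult[OF V rees_ring_hop_mult[OF V A B] C]]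
        rees_ring_outside[OF rees_ring_hop_mult[OF V A rees_ring_hop_mult[OF V B C]]] by simp
  qed
qed

section \<open>Restriction to smaller open sets\<close>

lemma hop_restrict_mem:
  assumes "V \<subseteq> U" "A \<in> rees_ring U"
  shows "hop_restrict V A \<in> rees_ring V"
proof -
  obtain N where "bounded_order N A" using rees_ring_bounded[OF assms(2)] ..
  then have "bounded_order N (hop_restrict V A)"
    by (auto simp: bounded_order_def hop_restrict_def)
  moreover have "hop_restrict V A k m holomorphic_on V" for k m
    using holomorphic_on_subset[OF rees_ring_holomorphic[OF assms(2)] assms(1)]
    by (rule holomorphic_transform) (simp add: hop_restrict_def)
  ultimately show ?thesis by (auto simp: rees_ring_iff hop_restrict_def)
qed

lemma hop_restrict_mult:
  assumes V: "open V" "V \<subseteq> U" and B: "B \<in> rees_ring U"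
  shows "hop_restrict V (A \<odot> B) = hop_restrict V A \<odot> hop_restrict V B"
proof (intro ext)
  fix k m z
  show "hop_restrict V (A \<odot> B) k m z = (hop_restrict V A \<odot> hop_restrict V B) k m z"
  proof (cases "z \<in> V")
    case True
    have "(deriv ^^ j) (hop_restrict V B l n) z = (deriv ^^ j) (B l n) z" for j l n
    proof (rule higher_deriv_cong_ev)
      show "\<forall>\<^sub>F w in nhds z. hop_restrict V B l n w = B l n w"
        unfolding eventually_nhds using V(1) True by (auto simp: hop_restrict_def)
    qed simp
    then show ?thesis using True by (simp add: hop_restrict_def hop_mult_def)
  next
    case False
    then show ?thesis by (simp add: hop_restrict_def hop_mult_def)
  qed
qed

lemma hop_restrict_diff: "hop_restrict V (A - B) = hop_restrict V A - hop_restrict V B"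
  by (auto simp: hop_restrict_def fun_eq_iff)

lemma hop_restrict_0 [simp]: "hop_restrict V 0 = 0"
  by (auto simp: hop_restrict_def fun_eq_iff)

lemma hop_restrict_sum: "hop_restrict V (\<Sum>i\<in>I. F i) = (\<Sum>i\<in>I. hop_restrict V (F i))"
  by (auto simp: hop_restrict_def fun_eq_iff sum_fun_apply)

lemma hop_restrict_scalar: "V \<subseteq> U \<Longrightarrow> hop_restrict V (hop_scalar U a) = hop_scalar V a"
  by (auto simp: hop_restrict_def hop_scalar_def fun_eq_iff)

section \<open>Elimination of the unknowns of a Hessenberg system\<close>

text \<open>
  For a system with matrix \<open>S\<close> whose entries below the subdiagonal vanish and whose subdiagonal
  entries \<open>S (Suc i) i\<close> are nonzero constants \<open>s (Suc i)\<close>, the vector \<open>eliminate U S s r w\<close> has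
  last entry \<open>w r\<close> and solves the equations \<open>i = 1, \<dots>, r - 1\<close> with right hand side \<open>w i\<close>.
\<close>

lemma hop_mult_sum_assoc:
  assumes V: "open V" and A: "A \<in> rees_ring V"
    and F: "\<And>k. k \<in> I \<Longrightarrow> F k \<in> rees_ring V" and H: "\<And>k. k \<in> I \<Longrightarrow> H k \<in> rees_ring V"
  shows "A \<odot> (\<Sum>k\<in>I. F k \<odot> H k) = (\<Sum>k\<in>I. (A \<odot> F k) \<odot> H k)"
proof -
  have "A \<odot> (\<Sum>k\<in>I. F k \<odot> H k) = (\<Sum>k\<in>I. A \<odot> (F k \<odot> H k))"
    by (rule hop_mult_sum_right[OF V A]) (rule rees_ring_hop_mult[OF V F H])
  also have "\<dots> = (\<Sum>k\<in>I. (A \<odot> F k) \<odot> H k)"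
    by (rule sum.cong[OF refl]) (rule hop_mult_assoc[OF V A F H, symmetric])
  finally show ?thesis .
qed

function eliminate ::
  "complex set \<Rightarrow> (nat \<Rightarrow> nat \<Rightarrow> hop) \<Rightarrow> (nat \<Rightarrow> complex) \<Rightarrow> nat \<Rightarrow> (nat \<Rightarrow> hop) \<Rightarrow> nat \<Rightarrow> hop" where
  "eliminate U S s r w i = (if Suc i < r then hop_scalar U (1 / s (Suc i)) \<odot>
     (w (Suc i) - (\<Sum>j\<in>{Suc i..<r}. S (Suc i) j \<odot> eliminate U S s r w j)) else w r)"
  by pat_completeness auto
termination
  by (relation "Wellfounded.measure (\<lambda>(U, S, s, r, w, i). r - i)") auto

declare eliminate.simps [simp del]

locale hessenberg =
  fixes U :: "complex set" and S :: "nat \<Rightarrow> nat \<Rightarrow> hop" and s :: "nat \<Rightarrow> complex" and r :: nat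
  assumes U: "open U"
    and r: "r > 0"
    and S: "i < r \<Longrightarrow> j < r \<Longrightarrow> S i j \<in> rees_ring U"
    and lower: "i < r \<Longrightarrow> Suc j < i \<Longrightarrow> S i j = 0"
    and subdiag: "Suc i < r \<Longrightarrow> S (Suc i) i = hop_scalar U (s (Suc i))"
    and s: "Suc i < r \<Longrightarrow> s (Suc i) \<noteq> 0"
begin

lemma eliminate_mem:
  assumes "\<And>i. i \<le> r \<Longrightarrow> w i \<in> rees_ring U"
  shows "eliminate U S s r w i \<in> rees_ring U"
proof (induction "r - i" arbitrary: i rule: less_induct)
  case less
  show ?case
  proof (cases "Suc i < r")
    case True
    have "eliminate U S s r w j \<in> rees_ring U" if "j \<in> {Suc i..<r}" for j
      using that True by (intro less) auto
    then show ?thesis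
      unfolding eliminate.simps[of U S s r w i] using True assms S
      by (auto intro!: rees_ring_hop_mult[OF U] rees_ring_diff rees_ring_sum)
  next
    case False
    then show ?thesis unfolding eliminate.simps[of U S s r w i] using assms by simp
  qed
qed

lemma sum_row:
  assumes "Suc i < r"
  shows "(\<Sum>j<r. S (Suc i) j \<odot> F j) =
    hop_scalar U (s (Suc i)) \<odot> F i + (\<Sum>j\<in>{Suc i..<r}. S (Suc i) j \<odot> F j)"
proof -
  have "{..<r} = {..<i} \<union> {i..<r}" using assms by auto
  then have "(\<Sum>j<r. S (Suc i) j \<odot> F j) =
      (\<Sum>j<i. S (Suc i) j \<odot> F j) + (\<Sum>j\<in>{i..<r}. S (Suc i) j \<odot> F j)"
    by (simp add: sum.union_disjoint ivl_disj_int del: plus_fun_apply)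
  moreover have "(\<Sum>j<i. S (Suc i) j \<odot> F j) = 0"
    by (rule sum.neutral) (use assms lower in auto)
  moreover have "(\<Sum>j\<in>{i..<r}. S (Suc i) j \<odot> F j) =
      S (Suc i) i \<odot> F i + (\<Sum>j\<in>{Suc i..<r}. S (Suc i) j \<odot> F j)"
    using assms by (subst sum.atLeast_Suc_lessThan) auto
  ultimately show ?thesis using subdiag[OF assms] by simp
qed

lemma eliminate_solves:
  assumes w: "\<And>i. i \<le> r \<Longrightarrow> w i \<in> rees_ring U" and i: "Suc i < r"
  shows "(\<Sum>j<r. S (Suc i) j \<odot> eliminate U S s r w j) = w (Suc i)"
proof -
  let ?y = "w (Suc i) - (\<Sum>j\<in>{Suc i..<r}. S (Suc i) j \<odot> eliminate U S s r w j)"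
  have y: "?y \<in> rees_ring U"
    using w i S eliminate_mem[OF w]
    by (auto intro!: rees_ring_hop_mult[OF U] rees_ring_diff rees_ring_sum)
  have "hop_scalar U (s (Suc i)) \<odot> eliminate U S s r w i =
      hop_scalar U (s (Suc i)) \<odot> (hop_scalar U (1 / s (Suc i)) \<odot> ?y)"
    using i by (subst eliminate.simps) simp
  also have "\<dots> = ?y"
    unfolding hop_mult_scalar_left[OF U rees_ring_hop_mult[OF U rees_ring_scalar y]]
    unfolding hop_mult_scalar_left[OF U y]
    using s[OF i] by (simp add: fun_eq_iff)
  finally show ?thesis unfolding sum_row[OF i] by simp
qed

text \<open>Unit right hand sides. Index r prescribes the last unknown, so \<open>target r\<close>
  is the homogeneous system with last unknown 1, while \<open>target k\<close> with 0 < k < r puts 1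
  into equation k and makes the last unknown 0. Read as a matrix, it is also the Kronecker
  delta.\<close>

definition target :: "nat \<Rightarrow> nat \<Rightarrow> hop" where
  "target k i = (if i = k then hop_scalar U 1 else 0)"

definition T :: "nat \<Rightarrow> hop" where
  "T = eliminate U S s r (target r)"

definition G :: "nat \<Rightarrow> nat \<Rightarrow> hop" where
  "G i k = eliminate U S s r (target k) i"

definition P :: hop where
  "P = (\<Sum>j<r. S 0 j \<odot> T j)"

lemma target_mem [simp]: "target k i \<in> rees_ring U"
  by (simp add: target_def)

lemma T_mem [simp]: "T i \<in> rees_ring U"
  unfolding T_def by (rule eliminate_mem) simp

lemma G_mem [simp]: "G i k \<in> rees_ring U"
  unfolding G_def by (rule eliminate_mem) simp

lemma P_mem [simp]: "P \<in> rees_ring U"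
  unfolding P_def by (intro rees_ring_sum rees_ring_hop_mult U) (use r S in auto)

lemma T_last: "T (r - 1) = hop_scalar U 1"
  unfolding T_def using r by (subst eliminate.simps) (simp add: target_def)

lemma system_T: "i < r \<Longrightarrow> (\<Sum>j<r. S i j \<odot> T j) = (if i = 0 then P else 0)"
proof (cases i)
  case (Suc k)
  assume "i < r"
  then show ?thesis
    using eliminate_solves[of "target r" k] Suc by (auto simp: T_def target_def)
qed (simp add: P_def)

text \<open>The defect \<open>E\<close> of column j solves the homogeneous equations 1, ..., r - 1
  and vanishes at the last index; as the subdiagonal entries are invertible, descending induction
  kills it. In the quotient module every generator thus becomes \<open>T i\<close> times the last
  one, with \<open>G\<close> exhibiting the relations used.\<close>

lemma basis_mod_system:
  assumes i: "i < r" and j: "j < r"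
  shows "target i j - (if j = r - 1 then T i else 0) = (\<Sum>k<r. G i k \<odot> S k j)"
proof -
  define E where "E l = target l j - (if j = r - 1 then T l else 0) - (\<Sum>k<r. G l k \<odot> S k j)" for l
  have E_mem: "E l \<in> rees_ring U" for l
    unfolding E_def using S j
    by (auto intro!: rees_ring_diff rees_ring_sum rees_ring_hop_mult[OF U])
  have "E i = 0" using i
  proof (induction "r - i" arbitrary: i rule: less_induct)
    case less
    show ?case
    proof (cases "Suc i < r")
      case False
      then have i: "i = r - 1" using less.prems by simp
      \<comment> \<open>For k < r the last unknown is prescribed to be 0, so the last row of
        \<open>G\<close> vanishes.\<close>
      have "G i k = 0" if "k < r" for k
        unfolding G_def using i that r by (subst eliminate.simps) (auto simp: target_def)
      then have "(\<Sum>k<r. G i k \<odot> S k j) = 0"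
        by (intro sum.neutral) auto
      then show ?thesis
        unfolding E_def using T_last i by (auto simp: target_def)
    next
      case True
      have row: "S (Suc i) l \<in> rees_ring U" if "l < r" for l
        using True that S by blast
      have sum_target: "(\<Sum>l<r. S (Suc i) l \<odot> target l j) = S (Suc i) j"
      proof -
        have "(\<Sum>l<r. S (Suc i) l \<odot> target l j) =
            (\<Sum>l<r. if l = j then S (Suc i) l else 0)"
          by (intro sum.cong refl) (auto simp: target_def hop_mult_one_right[OF U row])
        then show ?thesis using j by simp
      qed
      have sum_T: "(\<Sum>l<r. S (Suc i) l \<odot> (if j = r - 1 then T l else 0)) = 0"
        using system_T[OF True] by (cases "j = r - 1") simp_all
      have sum_G: "(\<Sum>l<r. S (Suc i) l \<odot> (\<Sum>k<r. G l k \<odot> S k j)) = S (Suc i) j"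
      proof -
        have "(\<Sum>l<r. S (Suc i) l \<odot> (\<Sum>k<r. G l k \<odot> S k j)) =
            (\<Sum>l<r. \<Sum>k<r. (S (Suc i) l \<odot> G l k) \<odot> S k j)"
          using row S j by (intro sum.cong refl hop_mult_sum_assoc[OF U]) auto
        also have "\<dots> = (\<Sum>k<r. (\<Sum>l<r. S (Suc i) l \<odot> G l k) \<odot> S k j)"
          by (subst sum.swap) (simp only: hop_mult_sum_left)
        also have "\<dots> = (\<Sum>k<r. if k = Suc i then S k j else 0)"
        proof (intro sum.cong refl)
          fix k assume "k \<in> {..<r}"
          have "(\<Sum>l<r. S (Suc i) l \<odot> G l k) = target k (Suc i)"
            unfolding G_def by (rule eliminate_solves[OF _ True]) simp
          then show "(\<Sum>l<r. S (Suc i) l \<odot> G l k) \<odot> S k j = (if k = Suc i then S k j else 0)"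
            using S j \<open>k \<in> {..<r}\<close> by (auto simp: target_def hop_mult_one_left[OF U])
        qed
        finally show ?thesis using True by simp
      qed
      have "(\<Sum>l<r. S (Suc i) l \<odot> E l) = (\<Sum>l<r. S (Suc i) l \<odot> target l j -
          S (Suc i) l \<odot> (if j = r - 1 then T l else 0) -
          S (Suc i) l \<odot> (\<Sum>k<r. G l k \<odot> S k j))"
      proof (intro sum.cong refl)
        fix l assume "l \<in> {..<r}"
        then have "S (Suc i) l \<in> rees_ring U" using row by simp
        moreover have "(if j = r - 1 then T l else 0) \<in> rees_ring U" by simp
        moreover have "(\<Sum>k<r. G l k \<odot> S k j) \<in> rees_ring U"
          using S j by (auto intro!: rees_ring_sum rees_ring_hop_mult[OF U])
        ultimately show "S (Suc i) l \<odot> E l = S (Suc i) l \<odot> target l j -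
            S (Suc i) l \<odot> (if j = r - 1 then T l else 0) -
            S (Suc i) l \<odot> (\<Sum>k<r. G l k \<odot> S k j)"
          unfolding E_def by (simp only: hop_mult_diff_right[OF U] rees_ring_diff target_mem)
      qed
      also have "\<dots> = 0"
        by (simp only: sum_subtractf sum_target sum_T sum_G diff_zero diff_self)
      finally have "hop_scalar U (s (Suc i)) \<odot> E i +
          (\<Sum>l\<in>{Suc i..<r}. S (Suc i) l \<odot> E l) = 0"
        unfolding sum_row[OF True] .
      moreover have "(\<Sum>l\<in>{Suc i..<r}. S (Suc i) l \<odot> E l) = 0"
      proof (rule sum.neutral, rule ballI)
        fix l assume "l \<in> {Suc i..<r}"
        then have "E l = 0" by (intro less.hyps) auto
        then show "S (Suc i) l \<odot> E l = 0" by simp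
      qed
      ultimately have "(\<lambda>k m z. s (Suc i) * E i k m z) = 0"
        unfolding hop_mult_scalar_left[OF U E_mem] by (simp only: add_0_right)
      then show ?thesis using s[OF True] by (auto simp: fun_eq_iff)
    qed
  qed
  then show ?thesis unfolding E_def by (simp only: right_minus_eq)
qed

end

text \<open>Three matrix identities suffice: S T = (P, 0, ..., 0)^t, the last entry of T is 1, and 1
  - T b = G S with b the last basis row. They are stated for arbitrary matrices over V so that
  restrictions of the data over a larger set can be inserted.\<close>

lemma cyclic_presentation:
  fixes r :: nat
  assumes V: "open V" and r: "r > 0"
    and S: "\<And>i j. i < r \<Longrightarrow> j < r \<Longrightarrow> S i j \<in> rees_ring V"
    and T: "\<And>i. i < r \<Longrightarrow> T i \<in> rees_ring V"
    and G: "\<And>i k. i < r \<Longrightarrow> k < r \<Longrightarrow> G i k \<in> rees_ring V"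
    and T_last: "T (r - 1) = hop_scalar V 1"
    and ST: "\<And>i. i < r \<Longrightarrow> (\<Sum>j<r. S i j \<odot> T j) = (if i = 0 then P else 0)"
    and GS: "\<And>i j. i < r \<Longrightarrow> j < r \<Longrightarrow>
      (if j = i then hop_scalar V 1 else 0) - (if j = r - 1 then T i else 0) =
      (\<Sum>k<r. G i k \<odot> S k j)"
  shows "B \<in> rees_ring V \<Longrightarrow>
      (\<exists>C. (\<forall>i<r. C i \<in> rees_ring V) \<and>
        (\<forall>j<r. B \<odot> (if j = r - 1 then hop_scalar V 1 else 0) = (\<Sum>i<r. C i \<odot> S i j))) \<longleftrightarrow>
      (\<exists>Q \<in> rees_ring V. B = Q \<odot> P)"
    and "(\<forall>i<r. v i \<in> rees_ring V) \<Longrightarrow>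
      \<exists>B \<in> rees_ring V. \<exists>C. (\<forall>i<r. C i \<in> rees_ring V) \<and>
        (\<forall>j<r. v j - B \<odot> (if j = r - 1 then hop_scalar V 1 else 0) = (\<Sum>i<r. C i \<odot> S i j))"
proof -
  note mem = rees_ring_sum rees_ring_hop_mult[OF V] rees_ring_diff
  have surj: "\<exists>C. (\<forall>i<r. C i \<in> rees_ring V) \<and>
      (\<forall>j<r. v j - (\<Sum>i<r. v i \<odot> T i) \<odot> (if j = r - 1 then hop_scalar V 1 else 0) =
        (\<Sum>i<r. C i \<odot> S i j))"
    if v: "\<forall>i<r. v i \<in> rees_ring V" for v
  proof (intro exI conjI allI impI)
    \<comment> \<open>The witness is the row v G, because v - (v T) b = v (1 - T b) = v G S.\<close>
    show "(\<Sum>i<r. v i \<odot> G i k) \<in> rees_ring V" if "k < r" for k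
      using v G that by (auto intro!: mem)
    fix j assume j: "j < r"
    have "(\<Sum>k<r. (\<Sum>i<r. v i \<odot> G i k) \<odot> S k j) = (\<Sum>i<r. \<Sum>k<r. (v i \<odot> G i k) \<odot> S k j)"
      by (subst sum.swap) (simp only: hop_mult_sum_left)
    also have "\<dots> = (\<Sum>i<r. v i \<odot> (\<Sum>k<r. G i k \<odot> S k j))"
      using v G S j by (intro sum.cong refl hop_mult_sum_assoc[OF V, symmetric]) auto
    also have "\<dots> = (\<Sum>i<r. (if i = j then v i else 0) -
        (v i \<odot> T i) \<odot> (if j = r - 1 then hop_scalar V 1 else 0))"
    proof (intro sum.cong refl)
      fix i assume "i \<in> {..<r}"
      then have i: "i < r" by simp
      have "v i \<odot> (\<Sum>k<r. G i k \<odot> S k j) =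
          v i \<odot> (if j = i then hop_scalar V 1 else 0) - v i \<odot> (if j = r - 1 then T i else 0)"
        unfolding GS[OF i j, symmetric] using v i T
        by (intro hop_mult_diff_right[OF V]) auto
      also have "v i \<odot> (if j = i then hop_scalar V 1 else 0) = (if i = j then v i else 0)"
        using v i by (auto simp: hop_mult_one_right[OF V])
      also have "v i \<odot> (if j = r - 1 then T i else 0) =
          (v i \<odot> T i) \<odot> (if j = r - 1 then hop_scalar V 1 else 0)"
        using v i T by (auto simp: hop_mult_one_right[OF V] mem)
      finally show "v i \<odot> (\<Sum>k<r. G i k \<odot> S k j) = (if i = j then v i else 0) -
        (v i \<odot> T i) \<odot> (if j = r - 1 then hop_scalar V 1 else 0)" .
    qed
    also have "\<dots> = v j - (\<Sum>i<r. v i \<odot> T i) \<odot> (if j = r - 1 then hop_scalar V 1 else 0)"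
      using j by (simp only: sum_subtractf hop_mult_sum_left[symmetric]) simp
    finally show "v j - (\<Sum>i<r. v i \<odot> T i) \<odot> (if j = r - 1 then hop_scalar V 1 else 0) =
      (\<Sum>k<r. (\<Sum>i<r. v i \<odot> G i k) \<odot> S k j)" by (rule sym)
  qed
  show "\<exists>B \<in> rees_ring V. \<exists>C. (\<forall>i<r. C i \<in> rees_ring V) \<and>
        (\<forall>j<r. v j - B \<odot> (if j = r - 1 then hop_scalar V 1 else 0) = (\<Sum>i<r. C i \<odot> S i j))"
    if v: "\<forall>i<r. v i \<in> rees_ring V"
    using surj[OF v] v T by (intro bexI[of _ "\<Sum>i<r. v i \<odot> T i"]) (auto intro!: mem)
  have P: "P = (\<Sum>j<r. S 0 j \<odot> T j)" using ST r by simp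
  have P_mem: "P \<in> rees_ring V" unfolding P using r S T by (auto intro!: mem)
  show "(\<exists>C. (\<forall>i<r. C i \<in> rees_ring V) \<and>
        (\<forall>j<r. B \<odot> (if j = r - 1 then hop_scalar V 1 else 0) = (\<Sum>i<r. C i \<odot> S i j))) \<longleftrightarrow>
      (\<exists>Q \<in> rees_ring V. B = Q \<odot> P)" if B: "B \<in> rees_ring V"
  proof
    assume "\<exists>C. (\<forall>i<r. C i \<in> rees_ring V) \<and>
        (\<forall>j<r. B \<odot> (if j = r - 1 then hop_scalar V 1 else 0) = (\<Sum>i<r. C i \<odot> S i j))"
    then obtain C where C: "\<And>i. i < r \<Longrightarrow> C i \<in> rees_ring V"
      and BC: "\<And>j. j < r \<Longrightarrow>
        B \<odot> (if j = r - 1 then hop_scalar V 1 else 0) = (\<Sum>i<r. C i \<odot> S i j)" by blast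
    \<comment> \<open>Multiplying B b = C S by T on the right gives B on the left, since the last
      entry of T is 1, and C_0 P on the right, since only row 0 of S T survives.\<close>
    have "B = (\<Sum>j<r. if j = r - 1 then B else 0)" using r by simp
    also have "\<dots> = (\<Sum>j<r. (B \<odot> (if j = r - 1 then hop_scalar V 1 else 0)) \<odot> T j)"
      using B T_last by (intro sum.cong refl) (auto simp: hop_mult_one_right[OF V])
    also have "\<dots> = (\<Sum>j<r. \<Sum>i<r. (C i \<odot> S i j) \<odot> T j)"
      by (intro sum.cong refl) (simp only: BC lessThan_iff hop_mult_sum_left)
    also have "\<dots> = (\<Sum>i<r. \<Sum>j<r. (C i \<odot> S i j) \<odot> T j)"
      by (rule sum.swap)
    also have "\<dots> = (\<Sum>i<r. C i \<odot> (\<Sum>j<r. S i j \<odot> T j))"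
      using C S T by (intro sum.cong refl hop_mult_sum_assoc[OF V, symmetric]) auto
    also have "\<dots> = (\<Sum>i<r. if i = 0 then C 0 \<odot> P else 0)"
      using ST by (intro sum.cong refl) auto
    also have "\<dots> = C 0 \<odot> P" using r by simp
    finally show "\<exists>Q \<in> rees_ring V. B = Q \<odot> P" using C r by blast
  next
    assume "\<exists>Q \<in> rees_ring V. B = Q \<odot> P"
    then obtain Q where Q: "Q \<in> rees_ring V" "B = Q \<odot> P" ..
    \<comment> \<open>Applied to row 0 of S, whose product with T is \<open>P\<close>, the
      decomposition shows S_0 - P b = C S. So P b is the combination of the equations with
      coefficients (1, 0, ..., 0) - C, and left multiplication by Q treats Q P.\<close>
    have v: "\<forall>i<r. S 0 i \<in> rees_ring V" using S r by simp
    from surj[OF v] obtain C where C: "\<And>i. i < r \<Longrightarrow> C i \<in> rees_ring V"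
      and SC: "\<And>j. j < r \<Longrightarrow>
        S 0 j - P \<odot> (if j = r - 1 then hop_scalar V 1 else 0) = (\<Sum>i<r. C i \<odot> S i j)"
      unfolding P[symmetric] by blast
    let ?C = "\<lambda>i. Q \<odot> ((if i = 0 then hop_scalar V 1 else 0) - C i)"
    have "B \<odot> (if j = r - 1 then hop_scalar V 1 else 0) = (\<Sum>i<r. ?C i \<odot> S i j)" if j: "j < r" for j
    proof -
      have "(\<Sum>i<r. ?C i \<odot> S i j) =
          (\<Sum>i<r. Q \<odot> (((if i = 0 then hop_scalar V 1 else 0) - C i) \<odot> S i j))"
        using Q C S j by (intro sum.cong refl) (auto simp: hop_mult_assoc[OF V] mem)
      also have "\<dots> = Q \<odot> (\<Sum>i<r. ((if i = 0 then hop_scalar V 1 else 0) - C i) \<odot> S i j)"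
        using Q C S j by (intro hop_mult_sum_right[OF V, symmetric]) (auto simp: mem)
      also have "(\<Sum>i<r. ((if i = 0 then hop_scalar V 1 else 0) - C i) \<odot> S i j) =
          (\<Sum>i<r. (if i = 0 then S i j else 0) - C i \<odot> S i j)"
        using S j by (intro sum.cong refl)
          (auto simp: hop_mult_diff_left hop_mult_one_left[OF V])
      also have "\<dots> = S 0 j - (\<Sum>i<r. C i \<odot> S i j)"
        unfolding sum_subtractf using r by simp
      also have "\<dots> = P \<odot> (if j = r - 1 then hop_scalar V 1 else 0)"
        unfolding SC[OF j, symmetric] by (simp only: diff_diff_eq2 add_diff_cancel_left')
      also have "Q \<odot> \<dots> = B \<odot> (if j = r - 1 then hop_scalar V 1 else 0)"
        unfolding Q(2) by (rule hop_mult_assoc[OF V Q(1) P_mem, symmetric]) simp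
      finally show ?thesis by (rule sym)
    qed
    moreover have "?C i \<in> rees_ring V" if "i < r" for i
      using Q C that by (intro rees_ring_hop_mult[OF V] rees_ring_diff) auto
    ultimately show "\<exists>C. (\<forall>i<r. C i \<in> rees_ring V) \<and>
        (\<forall>j<r. B \<odot> (if j = r - 1 then hop_scalar V 1 else 0) = (\<Sum>i<r. C i \<odot> S i j))"
      by (intro exI[of _ ?C]) simp
  qed
qed

section \<open>Symbols at \<open>h = 0\<close>\<close>

text \<open>The elements of O(V)[y]. The degree bound is uniform on V because an operator of the
  Rees ring has finite support; a pointwise polynomial of locally varying degree would not
  lift.\<close>

definition hol_family :: "complex set \<Rightarrow> (complex \<Rightarrow> complex poly) \<Rightarrow> bool" where
  "hol_family V F \<longleftrightarrow> (\<forall>k. (\<lambda>z. coeff (F z) k) holomorphic_on V) \<and>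
     (\<exists>n. \<forall>z\<in>V. degree (F z) \<le> n)"

lemma hol_family_const [simp]: "hol_family V (\<lambda>z. p)"
  by (auto simp: hol_family_def)

lemma hol_family_subset: "hol_family U F \<Longrightarrow> V \<subseteq> U \<Longrightarrow> hol_family V F"
  unfolding hol_family_def by (meson holomorphic_on_subset subsetD)

lemma hol_family_pCons_0:
  "f holomorphic_on V \<Longrightarrow> hol_family V (\<lambda>z. [:f z:])"
  unfolding hol_family_def
  proof (intro conjI allI)
  show "(\<lambda>z. coeff [:f z:] k) holomorphic_on V" if "f holomorphic_on V" for k
    using that by (cases k) auto
qed (auto intro: exI[of _ 0])

lemma hol_family_add:
  assumes "hol_family V F" "hol_family V G"
  shows "hol_family V (\<lambda>z. F z + G z)"
proof -
  obtain m n where "\<forall>z\<in>V. degree (F z) \<le> m" "\<forall>z\<in>V. degree (G z) \<le> n"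
    using assms unfolding hol_family_def by blast
  then have "\<forall>z\<in>V. degree (F z + G z) \<le> max m n"
    by (meson degree_add_le max.coboundedI1 max.coboundedI2)
  then show ?thesis
    using assms unfolding hol_family_def by (auto intro!: holomorphic_intros)
qed

lemma hol_family_mult:
  assumes "hol_family V F" "hol_family V G"
  shows "hol_family V (\<lambda>z. F z * G z)"
proof -
  obtain m n where "\<forall>z\<in>V. degree (F z) \<le> m" "\<forall>z\<in>V. degree (G z) \<le> n"
    using assms unfolding hol_family_def by blast
  then have "\<forall>z\<in>V. degree (F z * G z) \<le> m + n"
    by (meson add_mono degree_mult_le order_trans)
  then show ?thesis
    using assms unfolding hol_family_def by (auto simp: coeff_mult intro!: holomorphic_intros)
qed

lemma hol_family_sum:
  "(\<And>i. i \<in> I \<Longrightarrow> hol_family V (F i)) \<Longrightarrow> hol_family V (\<lambda>z. \<Sum>i\<in>I. F i z)"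
  by (induction I rule: infinite_finite_induct) (auto intro: hol_family_add)

lemma hol_family_prod:
  "(\<And>i. i \<in> I \<Longrightarrow> hol_family V (F i)) \<Longrightarrow> hol_family V (\<lambda>z. \<Prod>i\<in>I. F i z)"
  by (induction I rule: infinite_finite_induct) (auto intro: hol_family_mult)

lemma hol_family_det:
  assumes "\<And>z. M z \<in> carrier_mat n n"
    and "\<And>i j. i < n \<Longrightarrow> j < n \<Longrightarrow> hol_family V (\<lambda>z. M z $$ (i, j))"
  shows "hol_family V (\<lambda>z. det (M z))"
proof -
  have "hol_family V (\<lambda>z. \<Sum>p\<in>{p. p permutes {0..<n}}.
      signof p * (\<Prod>i = 0..<n. M z $$ (i, p i)))"
  proof (intro hol_family_sum hol_family_mult hol_family_prod hol_family_const assms(2))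
    fix p i assume "p \<in> {p. p permutes {0..<n}}" "i \<in> {0..<n}"
    then show "i < n" "p i < n" using permutes_in_image[of p "{0..<n}" i] by auto
  qed
  then show ?thesis by (simp only: det_def'[OF assms(1)])
qed

lemma hol_family_cofactor:
  assumes M: "\<And>z. M z \<in> carrier_mat n n"
    and H: "\<And>i j. i < n \<Longrightarrow> j < n \<Longrightarrow> hol_family V (\<lambda>z. M z $$ (i, j))"
    and i: "i < n" and j: "j < n"
  shows "hol_family V (\<lambda>z. cofactor (M z) i j)"
  unfolding cofactor_def
proof (rule hol_family_mult[OF hol_family_const hol_family_det])
  show "mat_delete (M z) i j \<in> carrier_mat (n - 1) (n - 1)" for z
    by (rule mat_delete_carrier[OF M])
  fix k l assume kl: "k < n - 1" "l < n - 1"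
  let ?k = "if k < i then k else Suc k" and ?l = "if l < j then l else Suc l"
  have "mat_delete (M z) i j $$ (k, l) = M z $$ (?k, ?l)" for z
    using M[of z] kl by (auto simp: mat_delete_def)
  moreover have "hol_family V (\<lambda>z. M z $$ (?k, ?l))"
    by (rule H) (use kl in auto)
  ultimately show "hol_family V (\<lambda>z. mat_delete (M z) i j $$ (k, l))" by simp
qed

text \<open>The symbol is kept pointwise in z, as a polynomial in y, so that determinants and
  adjugates over \<open>complex poly\<close> apply at each point; holomorphy in z is recorded
  separately by \<open>hol_family\<close>.\<close>

definition sym0 :: "hop \<Rightarrow> complex \<Rightarrow> complex poly" where
  "sym0 A z = Abs_poly (\<lambda>k. A k 0 z)"

lemma coeff_sym0:
  assumes "A \<in> rees_ring V"
  shows "coeff (sym0 A z) k = A k 0 z"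
proof -
  obtain N where N: "bounded_order N A" using rees_ring_bounded[OF assms] ..
  have "coeff (sym0 A z) = (\<lambda>k. A k 0 z)"
    unfolding sym0_def
    by (rule coeff_Abs_poly[of N]) (use N in \<open>simp add: bounded_order_def\<close>)
  then show ?thesis by simp
qed

lemma degree_sym0_le:
  assumes "A \<in> rees_ring V" "bounded_order N A"
  shows "degree (sym0 A z) \<le> N"
  by (rule degree_le) (use assms(2) in \<open>simp add: coeff_sym0[OF assms(1)] bounded_order_def\<close>)

lemma hol_family_sym0:
  assumes "A \<in> rees_ring V"
  shows "hol_family V (sym0 A)"
  unfolding hol_family_def coeff_sym0[OF assms]
  using degree_sym0_le[OF assms] rees_ring_bounded[OF assms] rees_ring_holomorphic[OF assms]
  by blast

lemma symbol0_eq_poly_sym0: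
  assumes "A \<in> rees_ring V"
  shows "symbol0 A (x, y) = poly (sym0 A x) y"
proof -
  obtain N where N: "bounded_order N A" using rees_ring_bounded[OF assms] ..
  have sub: "{k. A k 0 \<noteq> (\<lambda>z. 0)} \<subseteq> {..N}"
    using N by (auto simp: bounded_order_def intro: leI)
  have "symbol0 A (x, y) = (\<Sum>k\<le>N. A k 0 x * y ^ k)"
    unfolding symbol0_def prod.case by (rule sum.mono_neutral_left[OF _ sub]) auto
  also have "\<dots> = (\<Sum>k\<le>degree (sym0 A x). A k 0 x * y ^ k)"
    using degree_sym0_le[OF assms N] coeff_eq_0[of "sym0 A x"]
    by (intro sum.mono_neutral_right) (auto simp: coeff_sym0[OF assms] not_le)
  also have "\<dots> = poly (sym0 A x) y"
    by (simp add: poly_altdef coeff_sym0[OF assms])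
  finally show ?thesis .
qed

text \<open>At m = 0 the sums over the number j of derivatives and over the power n of h collapse to
  0, leaving the Cauchy product. Modulo h composition is commutative.\<close>

lemma sym0_mult:
  assumes "open V" "A \<in> rees_ring V" "B \<in> rees_ring V"
  shows "sym0 (A \<odot> B) z = sym0 A z * sym0 B z"
proof (rule poly_eqI)
  fix k
  have "coeff (sym0 (A \<odot> B) z) k = (\<Sum>l\<le>k. A (k - l) 0 z * B l 0 z)"
    using coeff_sym0[OF rees_ring_hop_mult[OF assms]] by (simp add: hop_mult_def)
  also have "\<dots> = (\<Sum>l\<le>k. A l 0 z * B (k - l) 0 z)"
    by (rule sum.reindex_bij_witness[where i = "\<lambda>l. k - l" and j = "\<lambda>l. k - l"]) auto
  also have "\<dots> = coeff (sym0 A z * sym0 B z) k"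
    by (simp add: coeff_mult coeff_sym0[OF assms(2)] coeff_sym0[OF assms(3)])
  finally show "coeff (sym0 (A \<odot> B) z) k = coeff (sym0 A z * sym0 B z) k" .
qed

lemma sym0_0 [simp]: "sym0 0 z = 0"
  by (rule poly_eqI) (simp add: coeff_sym0[OF rees_ring_0])

lemma sym0_add:
  "A \<in> rees_ring V \<Longrightarrow> B \<in> rees_ring V \<Longrightarrow> sym0 (A + B) z = sym0 A z + sym0 B z"
  by (rule poly_eqI) (simp add: coeff_sym0[of _ V] rees_ring_add[of A V B])

lemma sym0_diff:
  "A \<in> rees_ring V \<Longrightarrow> B \<in> rees_ring V \<Longrightarrow> sym0 (A - B) z = sym0 A z - sym0 B z"
  by (rule poly_eqI) (simp only: coeff_sym0[of _ V] rees_ring_diff[of A V B] coeff_diff minus_apply)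

lemma sym0_sum:
  "(\<And>i. i \<in> I \<Longrightarrow> F i \<in> rees_ring V) \<Longrightarrow> sym0 (\<Sum>i\<in>I. F i) z = (\<Sum>i\<in>I. sym0 (F i) z)"
proof (induction I rule: infinite_finite_induct)
  case (insert i I)
  then have "sym0 (F i + (\<Sum>i\<in>I. F i)) z = sym0 (F i) z + sym0 (\<Sum>i\<in>I. F i) z"
    by (intro sym0_add[of _ V] rees_ring_sum) auto
  then show ?case using insert by (simp add: sum.insert del: plus_fun_apply)
qed simp_all

lemma sym0_scalar: "z \<in> V \<Longrightarrow> sym0 (hop_scalar V a) z = [:a:]"
  by (rule poly_eqI, unfold coeff_sym0[OF rees_ring_scalar])
    (simp add: hop_scalar_def coeff_pCons split: nat.splits)

lemma sym0_hop_h: "A \<in> rees_ring V \<Longrightarrow> sym0 (hop_h A) z = 0"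
  by (rule poly_eqI, subst coeff_sym0[OF rees_ring_hop_h]) (simp_all add: hop_h_def)

text \<open>A section of the symbol map by operators free of h. Only its symbol matters: products of
  lifts agree with lifts of products modulo h.\<close>

definition lift0 :: "complex set \<Rightarrow> (complex \<Rightarrow> complex poly) \<Rightarrow> hop" where
  "lift0 V F = (\<lambda>k m z. if z \<in> V \<and> m = 0 then coeff (F z) k else 0)"

lemma lift0_mem:
  assumes "hol_family V F"
  shows "lift0 V F \<in> rees_ring V"
proof -
  obtain n where n: "\<forall>z\<in>V. degree (F z) \<le> n" using assms unfolding hol_family_def by blast
  have "bounded_order n (lift0 V F)"
    unfolding bounded_order_def
  proof (intro allI impI ext)
    fix k m z assume "n < k \<or> n < m"
    then show "lift0 V F k m z = 0"
      using n coeff_eq_0[of "F z" k] by (auto simp: lift0_def)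
  qed
  moreover have "lift0 V F k m holomorphic_on V" for k m
    by (rule holomorphic_transform[of "\<lambda>z. if m = 0 then coeff (F z) k else 0"])
      (use assms in \<open>cases m; auto simp: lift0_def hol_family_def\<close>)+
  ultimately show ?thesis by (auto simp: rees_ring_iff lift0_def)
qed

lemma sym0_lift0: "hol_family V F \<Longrightarrow> z \<in> V \<Longrightarrow> sym0 (lift0 V F) z = F z"
  by (rule poly_eqI, subst coeff_sym0[OF lift0_mem]) (simp_all add: lift0_def)

text \<open>The kernel of the symbol map consists of operators without term of degree 0 in h, so
  shifting the powers of h down divides by h inside the ring.\<close>

lemma rees_ring_divide_h:
  assumes A: "A \<in> rees_ring V" and "\<And>z. z \<in> V \<Longrightarrow> sym0 A z = 0"
  obtains A' where "A' \<in> rees_ring V" "hop_h A' = A"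
proof
  have A0: "A k 0 z = 0" for k z
  proof (cases "z \<in> V")
    case True
    then show ?thesis using assms(2)[OF True] coeff_sym0[OF A, of z k] by simp
  qed (simp add: rees_ring_outside[OF A])
  obtain N where N: "bounded_order N A" using rees_ring_bounded[OF A] ..
  then have "bounded_order N (\<lambda>k m. A k (Suc m))" by (auto simp: bounded_order_def)
  then show "(\<lambda>k m. A k (Suc m)) \<in> rees_ring V"
    using A by (auto simp: rees_ring_iff)
  show "hop_h (\<lambda>k m. A k (Suc m)) = A"
    by (intro ext) (auto simp: hop_h_def A0 split: nat.splits)
qed

section \<open>Cyclic presentations of a Hessenberg system and their symbols\<close>

lemma system_relations_iff:
  "v \<in> system_relations V r A \<longleftrightarrow> v \<in> rees_rows V r \<and>
    (\<exists>C. (\<forall>i<r. C i \<in> rees_ring V) \<and> (\<forall>j<r. v j = (\<Sum>i<r. C i \<odot> system_entry V A i j)))"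
proof -
  have eq: "(\<lambda>k m z. \<Sum>i<r. (C i \<odot> system_entry V A i j) k m z) =
      (\<Sum>i<r. C i \<odot> system_entry V A i j)" for C j
    by (intro ext) (simp add: sum_fun_apply)
  show ?thesis
  proof
    assume "v \<in> system_relations V r A"
    then show "v \<in> rees_rows V r \<and>
      (\<exists>C. (\<forall>i<r. C i \<in> rees_ring V) \<and> (\<forall>j<r. v j = (\<Sum>i<r. C i \<odot> system_entry V A i j)))"
      unfolding system_relations_def eq by (auto simp: rees_rows_def)
  next
    assume "v \<in> rees_rows V r \<and>
      (\<exists>C. (\<forall>i<r. C i \<in> rees_ring V) \<and> (\<forall>j<r. v j = (\<Sum>i<r. C i \<odot> system_entry V A i j)))"
    then obtain C where v: "v \<in> rees_rows V r" and C: "\<forall>i<r. C i \<in> rees_ring V"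
      and vC: "\<forall>j<r. v j = (\<Sum>i<r. C i \<odot> system_entry V A i j)" by blast
    let ?C = "\<lambda>i. if i < r then C i else (\<lambda>k m z. 0)"
    have "?C \<in> rees_rows V r" using C by (simp add: rees_rows_def)
    moreover have "(\<Sum>i<r. ?C i \<odot> system_entry V A i j) = (\<Sum>i<r. C i \<odot> system_entry V A i j)" for j
      by (intro sum.cong refl) simp
    ultimately show "v \<in> system_relations V r A"
      unfolding system_relations_def eq using v vC by (intro CollectI conjI bexI[of _ ?C]) simp_all
  qed
qed

locale hessenberg_field =
  fixes U :: "complex set" and \<Phi> :: "complex \<Rightarrow> complex mat" and s :: "nat \<Rightarrow> complex" and r :: nat
  assumes U: "open U"
    and r: "r > 0"
    and carrier: "\<Phi> z \<in> carrier_mat r r"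
    and holomorphic: "i < r \<Longrightarrow> j < r \<Longrightarrow> (\<lambda>z. \<Phi> z $$ (i, j)) holomorphic_on U"
    and entry_lower: "i < r \<Longrightarrow> Suc j < i \<Longrightarrow> \<Phi> z $$ (i, j) = 0"
    and entry_subdiag: "Suc i < r \<Longrightarrow> \<Phi> z $$ (Suc i, i) = s (Suc i)"
    and s: "Suc i < r \<Longrightarrow> s (Suc i) \<noteq> 0"
begin

abbreviation A :: "complex \<Rightarrow> complex poly mat" where
  "A z \<equiv> map_mat (\<lambda>a. [:a:]) (\<Phi> z)"

text \<open>This is y + \<Phi>, the symbol of h d/dx + \<Phi>. Since the characteristic matrix of B
  is y - B, the Higgs field enters with a minus sign.\<close>

abbreviation M :: "complex \<Rightarrow> complex poly mat" where
  "M z \<equiv> char_poly_matrix (- \<Phi> z)"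

lemma dims [simp]: "dim_row (\<Phi> z) = r" "dim_col (\<Phi> z) = r"
  using carrier by auto

lemma system_entry_apply:
  "i < r \<Longrightarrow> j < r \<Longrightarrow> system_entry V A i j k m z =
    (if z \<notin> V then 0 else if k = 0 \<and> m = 0 then \<Phi> z $$ (i, j)
     else if k = 1 \<and> m = 0 \<and> i = j then 1 else 0)"
  by (auto simp: system_entry_def coeff_pCons split: nat.splits)

lemma system_entry_mem:
  assumes "V \<subseteq> U" "i < r" "j < r"
  shows "system_entry V A i j \<in> rees_ring V"
proof -
  have "bounded_order 1 (system_entry V A i j)"
    unfolding bounded_order_def by (intro allI impI ext) (auto simp: system_entry_apply assms)
  moreover have "system_entry V A i j k m holomorphic_on V" for k m
  proof -
    have "(\<lambda>z. if k = 0 \<and> m = 0 then \<Phi> z $$ (i, j)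
        else if k = 1 \<and> m = 0 \<and> i = j then 1 else 0) holomorphic_on V"
      using holomorphic_on_subset[OF holomorphic[OF assms(2,3)] assms(1)]
      by (cases "k = 0 \<and> m = 0") auto
    then show ?thesis
      by (rule holomorphic_transform) (simp add: system_entry_apply assms)
  qed
  ultimately show ?thesis by (auto simp: rees_ring_iff system_entry_apply assms)
qed

lemma restrict_system_entry:
  "V \<subseteq> U \<Longrightarrow> hop_restrict V (system_entry U A i j) = system_entry V A i j"
  by (intro ext) (auto simp: hop_restrict_def system_entry_def)

lemma sym0_system_entry:
  assumes "V \<subseteq> U" "i < r" "j < r" "z \<in> V"
  shows "sym0 (system_entry V A i j) z = M z $$ (i, j)"
  using assms
  by (intro poly_eqI, subst coeff_sym0[OF system_entry_mem])
    (auto simp: system_entry_apply char_poly_matrix_def coeff_pCons split: nat.splits)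

sublocale hessenberg U "system_entry U A" s r
proof
  show "system_entry U A i j \<in> rees_ring U" if "i < r" "j < r" for i j
    using system_entry_mem[OF order_refl that] .
  show "system_entry U A i j = 0" if "i < r" "Suc j < i" for i j
    using that entry_lower[OF that] by (intro ext) (auto simp: system_entry_apply)
  show "system_entry U A (Suc i) i = hop_scalar U (s (Suc i))" if "Suc i < r" for i
    using that entry_subdiag[OF that] by (intro ext) (auto simp: system_entry_apply hop_scalar_def)
qed (use U r s in auto)

text \<open>A single pair \<open>P\<close>, \<open>e\<close> over U serves all open subsets:
  restriction commutes with composition, so the identities for \<open>T\<close> and \<open>G\<close>
  survive it and \<open>cyclic_presentation\<close> applies over each V.\<close>

lemma cyclic_presentation_exists:
  obtains P e where "P \<in> rees_ring U" "e \<in> rees_rows U r"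
    "\<And>V. open V \<Longrightarrow> V \<subseteq> U \<Longrightarrow>
      (\<forall>B \<in> rees_ring V.
         (\<lambda>i. B \<odot> hop_restrict V (e i)) \<in> system_relations V r A \<longleftrightarrow>
         (\<exists>Q \<in> rees_ring V. B = Q \<odot> hop_restrict V P)) \<and>
      (\<forall>v \<in> rees_rows V r. \<exists>B \<in> rees_ring V.
         (\<lambda>i k m z. v i k m z - (B \<odot> hop_restrict V (e i)) k m z) \<in> system_relations V r A)"
proof
  \<comment> \<open>The generator is the last unknown, through which elimination expresses all the
    others.\<close>
  define e :: "nat \<Rightarrow> hop" where "e j = (if j = r - 1 then hop_scalar U 1 else 0)" for j
  show "P \<in> rees_ring U" by simp
  show "e \<in> rees_rows U r" using r by (auto simp: rees_rows_def e_def fun_eq_iff)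
  fix V assume V: "open V" "V \<subseteq> U"
  have e: "hop_restrict V (e j) = (if j = r - 1 then hop_scalar V 1 else 0)" for j
    by (simp add: e_def hop_restrict_scalar[OF V(2)])
  have ST: "(\<Sum>j<r. system_entry V A i j \<odot> hop_restrict V (T j)) =
      (if i = 0 then hop_restrict V P else 0)" if "i < r" for i
  proof -
    have "hop_restrict V (\<Sum>j<r. system_entry U A i j \<odot> T j) =
        hop_restrict V (if i = 0 then P else 0)"
      using system_T[OF that] by simp
    then show ?thesis
      by (simp add: hop_restrict_sum hop_restrict_mult[OF V T_mem] restrict_system_entry[OF V(2)]
          split: if_splits)
  qed
  have GS: "(if j = i then hop_scalar V 1 else 0) - (if j = r - 1 then hop_restrict V (T i) else 0) =
      (\<Sum>k<r. hop_restrict V (G i k) \<odot> system_entry V A k j)" if ij: "i < r" "j < r" for i j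
  proof -
    have "hop_restrict V (target i j - (if j = r - 1 then T i else 0)) =
        hop_restrict V (\<Sum>k<r. G i k \<odot> system_entry U A k j)"
      by (simp only: basis_mod_system[OF ij])
    also have "\<dots> = (\<Sum>k<r. hop_restrict V (G i k) \<odot> system_entry V A k j)"
      unfolding hop_restrict_sum
      using ij by (intro sum.cong refl)
        (auto simp: hop_restrict_mult[OF V system_entry_mem[OF order_refl]]
          restrict_system_entry[OF V(2)])
    also have "hop_restrict V (target i j - (if j = r - 1 then T i else 0)) =
        hop_restrict V (target i j) - hop_restrict V (if j = r - 1 then T i else 0)"
      by (rule hop_restrict_diff)
    also have "hop_restrict V (target i j) = (if j = i then hop_scalar V 1 else 0)"
      by (simp add: target_def hop_restrict_scalar[OF V(2)])
    also have "hop_restrict V (if j = r - 1 then T i else 0) =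
        (if j = r - 1 then hop_restrict V (T i) else 0)" by simp
    finally show ?thesis .
  qed
  have T_last': "hop_restrict V (T (r - 1)) = hop_scalar V 1"
    using T_last by (simp add: hop_restrict_scalar[OF V(2)])
  have S': "system_entry V A i j \<in> rees_ring V" if "i < r" "j < r" for i j
    using system_entry_mem[OF V(2) that] .
  have mem': "hop_restrict V (T i) \<in> rees_ring V" "hop_restrict V (G i k) \<in> rees_ring V" for i k
    by (simp_all add: hop_restrict_mem[OF V(2)])
  have pres1: "(\<exists>C. (\<forall>i<r. C i \<in> rees_ring V) \<and>
        (\<forall>j<r. B \<odot> (if j = r - 1 then hop_scalar V 1 else 0) = (\<Sum>i<r. C i \<odot> system_entry V A i j))) \<longleftrightarrow>
      (\<exists>Q \<in> rees_ring V. B = Q \<odot> hop_restrict V P)" if "B \<in> rees_ring V" for B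
    by (rule cyclic_presentation(1)[OF V(1) r S' mem' T_last' ST GS that])
  have pres2: "\<exists>B \<in> rees_ring V. \<exists>C. (\<forall>i<r. C i \<in> rees_ring V) \<and>
        (\<forall>j<r. v j - B \<odot> (if j = r - 1 then hop_scalar V 1 else 0) =
          (\<Sum>i<r. C i \<odot> system_entry V A i j))" if "\<forall>i<r. v i \<in> rees_ring V" for v
    by (rule cyclic_presentation(2)[OF V(1) r S' mem' T_last' ST GS that])
  have zero: "B \<odot> (if i = r - 1 then hop_scalar V 1 else 0) = 0" if "i \<ge> r" for B i
    using that r by simp
  have row: "(\<lambda>i. B \<odot> hop_restrict V (e i)) \<in> rees_rows V r" if "B \<in> rees_ring V" for B
    unfolding rees_rows_def e using that zero
    by (auto intro!: rees_ring_hop_mult[OF V(1)] simp: zero_fun_def[symmetric])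
  show "(\<forall>B \<in> rees_ring V.
         (\<lambda>i. B \<odot> hop_restrict V (e i)) \<in> system_relations V r A \<longleftrightarrow>
         (\<exists>Q \<in> rees_ring V. B = Q \<odot> hop_restrict V P)) \<and>
      (\<forall>v \<in> rees_rows V r. \<exists>B \<in> rees_ring V.
         (\<lambda>i k m z. v i k m z - (B \<odot> hop_restrict V (e i)) k m z) \<in> system_relations V r A)"
  proof (intro conjI ballI)
    fix B assume B: "B \<in> rees_ring V"
    show "(\<lambda>i. B \<odot> hop_restrict V (e i)) \<in> system_relations V r A \<longleftrightarrow>
         (\<exists>Q \<in> rees_ring V. B = Q \<odot> hop_restrict V P)"
      unfolding system_relations_iff pres1[OF B, symmetric] using row[OF B] unfolding e by simp
  next
    fix v assume v: "v \<in> rees_rows V r"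
    then have "\<forall>i<r. v i \<in> rees_ring V" by (simp add: rees_rows_def)
    from pres2[OF this] obtain B C where B: "B \<in> rees_ring V"
      and C: "\<forall>i<r. C i \<in> rees_ring V" "\<forall>j<r. v j - B \<odot> (if j = r - 1 then hop_scalar V 1 else 0) =
        (\<Sum>i<r. C i \<odot> system_entry V A i j)" by blast
    have eq: "(\<lambda>i k m z. v i k m z - (B \<odot> hop_restrict V (e i)) k m z) =
        (\<lambda>i. v i - B \<odot> hop_restrict V (e i))"
      by (simp add: fun_eq_iff)
    have "(\<lambda>i. v i - B \<odot> hop_restrict V (e i)) \<in> rees_rows V r"
      using v row[OF B] unfolding rees_rows_def by (auto intro!: rees_ring_diff simp: fun_eq_iff)
    then have "(\<lambda>i. v i - B \<odot> hop_restrict V (e i)) \<in> system_relations V r A"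
      unfolding system_relations_iff e using C by (intro conjI exI[of _ C])
    then show "\<exists>B \<in> rees_ring V.
         (\<lambda>i k m z. v i k m z - (B \<odot> hop_restrict V (e i)) k m z) \<in> system_relations V r A"
      unfolding eq[symmetric] using B by blast
  qed
qed

text \<open>Deleting row 0 and the last column moves the subdiagonal onto the diagonal and leaves an
  upper triangular matrix. The entries containing y end up strictly above the diagonal, so the minor
  is constant.\<close>

lemma cofactor_corner:
  "cofactor (M z) 0 (r - 1) = [:(-1) ^ (r - 1) * (\<Prod>i<r - 1. s (Suc i)):]"
proof -
  let ?D = "mat_delete (M z) 0 (r - 1)"
  have Mc: "M z \<in> carrier_mat r r" using carrier by simp
  have D: "?D \<in> carrier_mat (r - 1) (r - 1)" by (rule mat_delete_carrier[OF Mc])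
  have D_entry: "?D $$ (i, j) = M z $$ (Suc i, j)" if "i < r - 1" "j < r - 1" for i j
    using that Mc by (auto simp: mat_delete_def)
  have "upper_triangular ?D"
    using D
  proof (intro upper_triangularI)
    fix i j assume "j < i" "i < dim_row ?D"
    then have ij: "i < r - 1" "j < r - 1" "Suc i < r" "Suc j < Suc i" using D by auto
    show "?D $$ (i, j) = 0"
      unfolding D_entry[OF ij(1,2)] using ij entry_lower[OF ij(3,4)]
      by (auto simp: char_poly_matrix_def)
  qed
  then have "det ?D = prod_list (diag_mat ?D)" using D by (rule det_upper_triangular)
  also have "\<dots> = (\<Prod>i<r - 1. ?D $$ (i, i))"
    using D Mc by (simp add: diag_mat_def prod.list_conv_set_nth atLeast0LessThan)
  also have "\<dots> = (\<Prod>i<r - 1. [:s (Suc i):])"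
  proof (intro prod.cong refl)
    fix i assume "i \<in> {..<r - 1}"
    then have i: "i < r - 1" "Suc i < r" by auto
    show "?D $$ (i, i) = [:s (Suc i):]"
      unfolding D_entry[OF i(1,1)] using i entry_subdiag[OF i(2)] by (simp add: char_poly_matrix_def)
  qed
  also have "\<dots> = [:\<Prod>i<r - 1. s (Suc i):]"
  proof -
    have "(\<Prod>i<n. [:s (Suc i):]) = [:\<Prod>i<n. s (Suc i):]" for n
      by (induction n) (simp_all add: mult.commute)
    then show ?thesis .
  qed
  finally have d: "det ?D = [:\<Prod>i<r - 1. s (Suc i):]" .
  have "(-1) ^ n * [:c:] = [:(-1) ^ n * c:]" for n and c :: complex
    by (induction n) simp_all
  then show ?thesis unfolding cofactor_def d by simp
qed

end

context hessenberg_field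
begin

lemma M_carrier: "M z \<in> carrier_mat r r"
  using carrier by simp

lemma hol_family_M:
  assumes "i < r" "j < r"
  shows "hol_family U (\<lambda>z. M z $$ (i, j))"
proof -
  have "hol_family U (\<lambda>z. (if i = j then [:0, 1:] else 0) + [:\<Phi> z $$ (i, j):])"
    by (intro hol_family_add hol_family_const hol_family_pCons_0 holomorphic assms)
  moreover have "M z $$ (i, j) = (if i = j then [:0, 1:] else 0) + [:\<Phi> z $$ (i, j):]" for z
    using assms by (auto simp: char_poly_matrix_def)
  ultimately show ?thesis by (simp only:)
qed

lemma M_times_adjugate:
  assumes "i < r" "k < r"
  shows "(\<Sum>j<r. M z $$ (i, j) * cofactor (M z) k j) = (if i = k then char_poly (- \<Phi> z) else 0)"
    and "(\<Sum>j<r. cofactor (M z) j i * M z $$ (j, k)) = (if i = k then char_poly (- \<Phi> z) else 0)"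
proof -
  have "(M z * adj_mat (M z)) $$ (i, k) = (\<Sum>j<r. M z $$ (i, j) * cofactor (M z) k j)"
    using assms M_carrier[of z]
    by (simp add: adj_mat_def scalar_prod_def atLeast0LessThan)
  then show "(\<Sum>j<r. M z $$ (i, j) * cofactor (M z) k j) =
      (if i = k then char_poly (- \<Phi> z) else 0)"
    using assms adj_mat(2)[OF M_carrier, of z] by (cases "i = k") (simp_all add: char_poly_def)
  have "(adj_mat (M z) * M z) $$ (i, k) = (\<Sum>j<r. cofactor (M z) j i * M z $$ (j, k))"
    using assms M_carrier[of z]
    by (simp add: adj_mat_def scalar_prod_def atLeast0LessThan)
  then show "(\<Sum>j<r. cofactor (M z) j i * M z $$ (j, k)) =
      (if i = k then char_poly (- \<Phi> z) else 0)"
    using assms adj_mat(3)[OF M_carrier, of z] by (cases "i = k") (simp_all add: char_poly_def)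
qed

lemma sym0_system_combination:
  assumes V: "open V" "V \<subseteq> U" and C: "\<And>i. i < r \<Longrightarrow> C i \<in> rees_ring V"
    and j: "j < r" and z: "z \<in> V"
  shows "sym0 (\<Sum>i<r. C i \<odot> system_entry V A i j) z = (\<Sum>i<r. sym0 (C i) z * M z $$ (i, j))"
proof -
  have "sym0 (\<Sum>i<r. C i \<odot> system_entry V A i j) z = (\<Sum>i<r. sym0 (C i \<odot> system_entry V A i j) z)"
    using C j by (intro sym0_sum[of _ _ V] rees_ring_hop_mult V system_entry_mem) auto
  also have "\<dots> = (\<Sum>i<r. sym0 (C i) z * M z $$ (i, j))"
    using C j z by (intro sum.cong refl)
      (simp add: sym0_mult[OF V(1)] system_entry_mem[OF V(2)] sym0_system_entry[OF V(2)])
  finally show ?thesis .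
qed

text \<open>
  Modulo \<open>h\<close> the module is the cokernel of \<open>M\<close>. It is annihilated by its Fitting ideal, the
  multiples of \<open>det M\<close>, and nothing else annihilates the last basis vector because a cofactor in
  its row is a nonzero constant.
\<close>

lemma symbol_associated_char_poly:
  assumes V: "open V" "V \<subseteq> U" and P': "P' \<in> rees_ring V" and e: "e \<in> rees_rows V r"
    and ann: "\<And>B. B \<in> rees_ring V \<Longrightarrow>
      (\<lambda>i. B \<odot> e i) \<in> system_relations V r A \<longleftrightarrow> (\<exists>Q \<in> rees_ring V. B = Q \<odot> P')"
    and gen: "\<And>v. v \<in> rees_rows V r \<Longrightarrow>
      \<exists>B \<in> rees_ring V. (\<lambda>i. v i - B \<odot> e i) \<in> system_relations V r A"
  obtains K L where "hol_family V K" "hol_family V L"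
    "\<And>z. z \<in> V \<Longrightarrow> sym0 P' z = K z * char_poly (- \<Phi> z)"
    "\<And>z. z \<in> V \<Longrightarrow> char_poly (- \<Phi> z) = L z * sym0 P' z"
proof -
  note mem = rees_ring_hop_mult[OF V(1)]
  let ?S = "system_entry V A"
  have S: "?S i j \<in> rees_ring V" if "i < r" "j < r" for i j
    using system_entry_mem[OF V(2) that] .
  have e_mem: "e j \<in> rees_ring V" if "j < r" for j using e that by (simp add: rees_rows_def)
  have e_0: "e j = 0" if "j \<ge> r" for j using e that by (simp add: rees_rows_def zero_fun_def)
  have row: "(\<lambda>i. B \<odot> e i) \<in> rees_rows V r" if "B \<in> rees_ring V" for B
    using that e_mem e_0 unfolding rees_rows_def by (auto intro!: mem simp: zero_fun_def[symmetric])

  \<comment> \<open>As a multiple of itself, \<open>P'\<close> annihilates \<open>e\<close>: P' e =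
    C S.\<close>
  have "\<exists>Q \<in> rees_ring V. P' = Q \<odot> P'"
    using hop_mult_one_left[OF V(1) P'] by (intro bexI[of _ "hop_scalar V 1"]) simp_all
  then have "(\<lambda>i. P' \<odot> e i) \<in> system_relations V r A" using ann[OF P'] by simp
  then obtain C where C: "\<And>i. i < r \<Longrightarrow> C i \<in> rees_ring V"
    and PC: "\<And>j. j < r \<Longrightarrow> P' \<odot> e j = (\<Sum>i<r. C i \<odot> ?S i j)"
    unfolding system_relations_iff by blast
  \<comment> \<open>The last basis row is reached by the generator: b = B e + E S.\<close>
  define b where "b j = (if j = r - 1 then hop_scalar V 1 else (0 :: hop))" for j
  have "b \<in> rees_rows V r" using r by (auto simp: rees_rows_def b_def zero_fun_def[symmetric])
  then obtain B where B: "B \<in> rees_ring V"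
    and BE: "(\<lambda>i. b i - B \<odot> e i) \<in> system_relations V r A" using gen by blast
  from BE obtain E where E: "\<And>i. i < r \<Longrightarrow> E i \<in> rees_ring V"
    and bE: "\<And>j. j < r \<Longrightarrow> b j - B \<odot> e j = (\<Sum>i<r. E i \<odot> ?S i j)"
    unfolding system_relations_iff by blast
  \<comment> \<open>On symbols, where factors commute, P' b = B P' e + P' E S = (B C + P' E) S. The
    operator \<open>F\<close> is the coefficient of equation 0 in this combination.\<close>
  define F where "F = B \<odot> C 0 + P' \<odot> E 0"
  have F: "F \<in> rees_ring V"
    unfolding F_def using B C E P' r by (intro rees_ring_add mem) auto
  define \<kappa> where "\<kappa> = (-1) ^ (r - 1) * (\<Prod>i<r - 1. s (Suc i))"
  have \<kappa>: "\<kappa> \<noteq> 0" using s by (simp add: \<kappa>_def)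
  have K: "sym0 P' z = Polynomial.smult (1 / \<kappa>) (sym0 F z) * char_poly (- \<Phi> z)" if z: "z \<in> V" for z
  proof -
    let ?p = "sym0 P' z"
    let ?k = "\<lambda>i. sym0 B z * sym0 (C i) z + ?p * sym0 (E i) z"
    have pe: "?p * sym0 (e j) z = (\<Sum>i<r. sym0 (C i) z * M z $$ (i, j))" if j: "j < r" for j
      using sym0_system_combination[OF V C j z] PC[OF j] sym0_mult[OF V(1) P' e_mem[OF j], of z]
      by simp
    have be: "(if j = r - 1 then 1 else 0) =
        sym0 B z * sym0 (e j) z + (\<Sum>i<r. sym0 (E i) z * M z $$ (i, j))" if j: "j < r" for j
    proof -
      have "sym0 (b j - B \<odot> e j) z = sym0 (b j) z - sym0 (B \<odot> e j) z"
        by (rule sym0_diff[of _ V]) (use B e_mem j in \<open>auto simp: b_def intro: mem\<close>)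
      moreover have "sym0 (b j) z = (if j = r - 1 then 1 else 0)"
        using z by (simp add: b_def sym0_scalar one_pCons)
      moreover have "sym0 (B \<odot> e j) z = sym0 B z * sym0 (e j) z"
        by (rule sym0_mult[OF V(1) B e_mem[OF j]])
      moreover have "sym0 (b j - B \<odot> e j) z = (\<Sum>i<r. sym0 (E i) z * M z $$ (i, j))"
        unfolding bE[OF j] by (rule sym0_system_combination[OF V E j z])
      ultimately show ?thesis by (simp add: algebra_simps)
    qed
    have pk: "(if j = r - 1 then ?p else 0) = (\<Sum>i<r. ?k i * M z $$ (i, j))" if j: "j < r" for j
    proof -
      have "(if j = r - 1 then ?p else 0) = ?p * (if j = r - 1 then 1 else 0)" by simp
      also have "\<dots> = sym0 B z * (?p * sym0 (e j) z) + ?p * (\<Sum>i<r. sym0 (E i) z * M z $$ (i, j))"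
        unfolding be[OF j] by (simp add: algebra_simps)
      also have "\<dots> = (\<Sum>i<r. ?k i * M z $$ (i, j))"
        unfolding pe[OF j] by (simp add: sum_distrib_left sum.distrib algebra_simps)
      finally show ?thesis .
    qed
    \<comment> \<open>The identity of rows p b = k M is paired with column 0 of the adjugate. On the
      left this selects the constant corner cofactor, on the right M times the adjugate keeps only
      k_0 det M.\<close>
    have "?p * cofactor (M z) 0 (r - 1) =
        (\<Sum>j<r. (if j = r - 1 then ?p else 0) * cofactor (M z) 0 j)"
    proof -
      have "(\<Sum>j<r. (if j = r - 1 then ?p else 0) * cofactor (M z) 0 j) =
          (\<Sum>j<r. if j = r - 1 then ?p * cofactor (M z) 0 j else 0)"
        by (intro sum.cong refl) auto
      also have "\<dots> = ?p * cofactor (M z) 0 (r - 1)" using r by simp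
      finally show ?thesis by simp
    qed
    also have "\<dots> = (\<Sum>j<r. \<Sum>i<r. ?k i * (M z $$ (i, j) * cofactor (M z) 0 j))"
      by (intro sum.cong refl) (simp only: pk lessThan_iff sum_distrib_right mult.assoc)
    also have "\<dots> = (\<Sum>i<r. \<Sum>j<r. ?k i * (M z $$ (i, j) * cofactor (M z) 0 j))"
      by (rule sum.swap)
    also have "\<dots> = (\<Sum>i<r. ?k i * (if i = 0 then char_poly (- \<Phi> z) else 0))"
      using r by (intro sum.cong refl) (simp add: sum_distrib_left[symmetric] M_times_adjugate(1))
    also have "\<dots> = (\<Sum>i<r. if i = 0 then ?k 0 * char_poly (- \<Phi> z) else 0)"
      by (intro sum.cong refl) auto
    also have "\<dots> = ?k 0 * char_poly (- \<Phi> z)" using r by simp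
    also have "?k 0 = sym0 F z"
    proof -
      have "sym0 F z = sym0 (B \<odot> C 0) z + sym0 (P' \<odot> E 0) z"
        unfolding F_def by (rule sym0_add[of _ V]) (use B C P' E r in \<open>auto intro: mem\<close>)
      then show ?thesis
        using sym0_mult[OF V(1) B C[OF r], of z] sym0_mult[OF V(1) P' E[OF r], of z] by simp
    qed
    finally have "Polynomial.smult \<kappa> ?p = sym0 F z * char_poly (- \<Phi> z)"
      unfolding cofactor_corner \<kappa>_def[symmetric] by simp
    then have "Polynomial.smult (1 / \<kappa>) (Polynomial.smult \<kappa> ?p) = Polynomial.smult (1 / \<kappa>) (sym0 F z * char_poly (- \<Phi> z))"
      by simp
    then show ?thesis using \<kappa> by simp
  qed
  have hK: "hol_family V (\<lambda>z. Polynomial.smult (1 / \<kappa>) (sym0 F z))"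
  proof -
    have "hol_family V (\<lambda>z. [:1 / \<kappa>:] * sym0 F z)"
      by (intro hol_family_mult hol_family_const hol_family_sym0 F)
    then show ?thesis by simp
  qed

  have hol_cofactor: "hol_family V (\<lambda>z. cofactor (M z) i j)" if "i < r" "j < r" for i j
    by (rule hol_family_subset[OF hol_family_cofactor[OF M_carrier hol_family_M that] V(2)])
  have hol_char: "hol_family V (\<lambda>z. char_poly (- \<Phi> z))"
    unfolding char_poly_def
    by (rule hol_family_subset[OF hol_family_det[OF M_carrier hol_family_M] V(2)])
  \<comment> \<open>For the converse, det M is lifted to an operator \<open>X\<close>, which
    annihilates \<open>e\<close> modulo relations and h.\<close>
  define X where "X = lift0 V (\<lambda>z. char_poly (- \<Phi> z))"
  have X: "X \<in> rees_ring V" unfolding X_def by (rule lift0_mem[OF hol_char])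
  define N where "N k i = lift0 V (\<lambda>z. cofactor (M z) i k)" for k i
  have N: "N k i \<in> rees_ring V" if "k < r" "i < r" for k i
    unfolding N_def by (rule lift0_mem[OF hol_cofactor[OF that(2,1)]])
  \<comment> \<open>\<open>Y\<close> is the row \<open>e\<close> times the lifted adjugate, so that
    on symbols Y M = det (M) e.\<close>
  define Y where "Y i = (\<Sum>k<r. e k \<odot> N k i)" for i
  have Y: "Y i \<in> rees_ring V" if "i < r" for i
    unfolding Y_def using e_mem N that by (intro rees_ring_sum mem) auto
  have sym_Y: "sym0 (Y i) z = (\<Sum>k<r. sym0 (e k) z * cofactor (M z) i k)"
    if "i < r" "z \<in> V" for i z
  proof -
    have "sym0 (Y i) z = (\<Sum>k<r. sym0 (e k \<odot> N k i) z)"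
      unfolding Y_def using e_mem N that by (intro sym0_sum[of _ _ V] mem) auto
    also have "\<dots> = (\<Sum>k<r. sym0 (e k) z * cofactor (M z) i k)"
    proof (intro sum.cong refl)
      fix k assume "k \<in> {..<r}"
      then have k: "k < r" by simp
      show "sym0 (e k \<odot> N k i) z = sym0 (e k) z * cofactor (M z) i k"
        using sym0_mult[OF V(1) e_mem[OF k] N[OF k that(1)], of z]
          sym0_lift0[OF hol_cofactor[OF that(1) k] that(2)] by (simp add: N_def)
    qed
    finally show ?thesis .
  qed
  \<comment> \<open>The defect of the relation X e = Y S has zero symbol by the choice of
    \<open>Y\<close>, hence is h times a row \<open>v\<close>.\<close>
  define R where "R j = X \<odot> e j - (\<Sum>i<r. Y i \<odot> ?S i j)" for j
  have R: "R j \<in> rees_ring V" if "j < r" for j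
    unfolding R_def using X e_mem Y S that by (intro rees_ring_diff rees_ring_sum mem) auto
  have "sym0 (R j) z = 0" if j: "j < r" and z: "z \<in> V" for j z
  proof -
    have "sym0 (\<Sum>i<r. Y i \<odot> ?S i j) z = (\<Sum>i<r. sym0 (Y i) z * M z $$ (i, j))"
      by (rule sym0_system_combination[OF V Y j z])
    also have "\<dots> = (\<Sum>i<r. \<Sum>k<r. sym0 (e k) z * (cofactor (M z) i k * M z $$ (i, j)))"
      using z by (intro sum.cong refl) (simp add: sym_Y sum_distrib_right mult.assoc)
    also have "\<dots> = (\<Sum>k<r. sym0 (e k) z * (\<Sum>i<r. cofactor (M z) i k * M z $$ (i, j)))"
      unfolding sum_distrib_left by (rule sum.swap)
    also have "\<dots> = (\<Sum>k<r. if k = j then sym0 (e j) z * char_poly (- \<Phi> z) else 0)"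
      using j by (intro sum.cong refl) (simp add: M_times_adjugate(2))
    also have "\<dots> = sym0 (X \<odot> e j) z"
      using j sym0_mult[OF V(1) X e_mem[OF j], of z] sym0_lift0[OF hol_char z]
      by (simp add: X_def mult.commute)
    finally have "sym0 (\<Sum>i<r. Y i \<odot> ?S i j) z = sym0 (X \<odot> e j) z" .
    moreover have "sym0 (R j) z = sym0 (X \<odot> e j) z - sym0 (\<Sum>i<r. Y i \<odot> ?S i j) z"
      unfolding R_def using X e_mem Y S j
      by (intro sym0_diff[of _ V] rees_ring_sum mem) auto
    ultimately show ?thesis by simp
  qed
  then have "\<exists>v. v \<in> rees_ring V \<and> hop_h v = R j" if "j < r" for j
    using that by (blast intro: rees_ring_divide_h[OF R[OF that]])
  then have "\<forall>j\<in>{..<r}. \<exists>v. v \<in> rees_ring V \<and> hop_h v = R j" by simp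
  from bchoice[OF this]
  obtain v0 where v0: "\<And>j. j < r \<Longrightarrow> v0 j \<in> rees_ring V \<and> hop_h (v0 j) = R j" by auto
  define v where "v j = (if j < r then v0 j else 0)" for j
  have "v \<in> rees_rows V r"
    using v0 by (auto simp: rees_rows_def v_def zero_fun_def[symmetric])
  \<comment> \<open>Since \<open>e\<close> generates, v = B' e + E' S. Multiplying by h and
    inserting h v = X e - Y S gives (X - h B') e = (Y + h E') S, so the annihilation modulo h has
    become exact.\<close>
  then obtain B' where B': "B' \<in> rees_ring V"
    and BE': "(\<lambda>i. v i - B' \<odot> e i) \<in> system_relations V r A" using gen by blast
  from BE' obtain E' where E': "\<And>i. i < r \<Longrightarrow> E' i \<in> rees_ring V"
    and vE: "\<And>j. j < r \<Longrightarrow> v j - B' \<odot> e j = (\<Sum>i<r. E' i \<odot> ?S i j)"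
    unfolding system_relations_iff by blast
  have hop_h_diff: "hop_h (A1 - A2) = hop_h A1 - hop_h A2" for A1 A2
    by (intro ext) (simp add: hop_h_def split: nat.splits)
  have hop_h_sum: "hop_h (\<Sum>i<r. F i) = (\<Sum>i<r. hop_h (F i))" for F
    by (intro ext) (auto simp: hop_h_def sum_fun_apply split: nat.splits)
  have XB: "X - hop_h B' \<in> rees_ring V"
    by (intro rees_ring_diff X rees_ring_hop_h B')
  have "(X - hop_h B') \<odot> e j = (\<Sum>i<r. (Y i + hop_h (E' i)) \<odot> ?S i j)" if j: "j < r" for j
  proof -
    have vX: "hop_h (v j) = X \<odot> e j - (\<Sum>i<r. Y i \<odot> ?S i j)"
      using v0[OF j] j by (simp only: v_def R_def if_True)
    have vB: "hop_h (v j) - hop_h B' \<odot> e j = (\<Sum>i<r. hop_h (E' i) \<odot> ?S i j)"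
    proof -
      have "hop_h (v j) - hop_h B' \<odot> e j = hop_h (v j - B' \<odot> e j)"
        unfolding hop_h_diff hop_h_mult[OF V(1) B' e_mem[OF j]] ..
      also have "\<dots> = (\<Sum>i<r. hop_h (E' i) \<odot> ?S i j)"
        unfolding vE[OF j] hop_h_sum
        using E' S j by (intro sum.cong refl hop_h_mult[OF V(1)]) auto
      finally show ?thesis .
    qed
    have YE: "(\<Sum>i<r. (Y i + hop_h (E' i)) \<odot> ?S i j) =
        (\<Sum>i<r. Y i \<odot> ?S i j) + (\<Sum>i<r. hop_h (E' i) \<odot> ?S i j)"
      by (simp only: hop_mult_add_left sum.distrib)
    have "x - b = y + c" if "h = x - y" "h - b = c" for h x y b c :: hop
      unfolding that(2)[symmetric] that(1) by (simp only: diff_conv_add_uminus add_ac) simp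
    from this[OF vX vB] show ?thesis unfolding hop_mult_diff_left YE .
  qed
  then have "(\<lambda>i. (X - hop_h B') \<odot> e i) \<in> system_relations V r A"
    unfolding system_relations_iff using row[OF XB] Y E'
    by (intro conjI exI[of _ "\<lambda>i. Y i + hop_h (E' i)"])
      (auto intro!: rees_ring_add rees_ring_hop_h)
  then obtain Q where Q: "Q \<in> rees_ring V" "X - hop_h B' = Q \<odot> P'"
    using ann[OF XB] by blast
  have L: "char_poly (- \<Phi> z) = sym0 Q z * sym0 P' z" if z: "z \<in> V" for z
  proof -
    have "sym0 (X - hop_h B') z = sym0 X z"
      using sym0_diff[OF X rees_ring_hop_h[OF B'], of z] sym0_hop_h[OF B', of z] by simp
    moreover have "sym0 X z = char_poly (- \<Phi> z)" unfolding X_def by (rule sym0_lift0[OF hol_char z])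
    ultimately show ?thesis using Q sym0_mult[OF V(1) Q(1) P', of z] by simp
  qed
  show ?thesis
  proof (rule that[of "\<lambda>z. Polynomial.smult (1 / \<kappa>) (sym0 F z)" "sym0 Q"])
    show "hol_family V (sym0 Q)" by (rule hol_family_sym0[OF Q(1)])
    show "sym0 P' z = Polynomial.smult (1 / \<kappa>) (sym0 F z) * char_poly (- \<Phi> z)"
      if "z \<in> V" for z by (rule K[OF that])
    show "char_poly (- \<Phi> z) = sym0 Q z * sym0 P' z" if "z \<in> V" for z
      by (rule L[OF that])
  qed (rule hK)
qed

end

section \<open>Exponentials of the principal nilpotent matrix\<close>

text \<open>With s_l = l (r - l), the product of the entries sqrt s_l met between the 0-based
  indices i and j; it is the entry (i, j) of X_+ to the power j - i.\<close>

definition X_weight :: "nat \<Rightarrow> nat \<Rightarrow> nat \<Rightarrow> complex" where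
  "X_weight r i j = (\<Prod>l\<in>{i<..j}. complex_of_real (sqrt (real (l * (r - l)))))"

text \<open>The entries of \<open>exp (t X\<^sub>+)\<close>.\<close>

definition X_exp :: "nat \<Rightarrow> complex \<Rightarrow> nat \<Rightarrow> nat \<Rightarrow> complex" where
  "X_exp r t i j = (if i \<le> j then t ^ (j - i) / fact (j - i) * X_weight r i j else 0)"

lemma X_weight_same [simp]: "X_weight r i i = 1"
  by (simp add: X_weight_def)

lemma X_weight_trans: "i \<le> l \<Longrightarrow> l \<le> j \<Longrightarrow> X_weight r i l * X_weight r l j = X_weight r i j"
proof -
  assume "i \<le> l" "l \<le> j"
  then have "{i<..j} = {i<..l} \<union> {l<..j}" "{i<..l} \<inter> {l<..j} = {}" by auto
  then show ?thesis unfolding X_weight_def by (simp add: prod.union_disjoint)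
qed

lemma X_weight_Suc: "X_weight r i (Suc i) = complex_of_real (sqrt (real (Suc i * (r - Suc i))))"
proof -
  have "{i<..Suc i} = {Suc i}" by auto
  then show ?thesis by (simp only: X_weight_def prod.insert finite.emptyI) simp
qed

lemma X_minus_carrier [simp]: "X_minus r \<in> carrier_mat r r"
  by (simp add: X_minus_def)

lemma X_plus_carrier [simp]: "X_plus r \<in> carrier_mat r r"
  by (simp add: X_plus_def)

lemma X_dims [simp]: "dim_row (X_plus r) = r" "dim_col (X_plus r) = r"
  "dim_row (X_minus r) = r" "dim_col (X_minus r) = r"
  by (simp_all add: X_plus_def X_minus_def)

lemma X_minus_index:
  "i < r \<Longrightarrow> j < r \<Longrightarrow> X_minus r $$ (i, j) = (if i = Suc j then X_weight r j i else 0)"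
  by (auto simp: X_minus_def X_weight_Suc)

lemma X_plus_index:
  "i < r \<Longrightarrow> j < r \<Longrightarrow> X_plus r $$ (i, j) = (if j = Suc i then X_weight r i j else 0)"
  by (auto simp: X_plus_def X_minus_index)

lemma X_plus_pow_carrier: "X_plus r ^\<^sub>m k \<in> carrier_mat r r"
  by (induction k) (auto intro: mult_carrier_mat)

lemma X_plus_pow_index:
  assumes "i < r" "j < r"
  shows "(X_plus r ^\<^sub>m k) $$ (i, j) = (if j = i + k then X_weight r i j else 0)"
  using assms(2)
proof (induction k arbitrary: j)
  case 0
  then show ?case using assms by auto
next
  case (Suc k)
  have "(X_plus r ^\<^sub>m Suc k) $$ (i, j) = (\<Sum>l<r. (X_plus r ^\<^sub>m k) $$ (i, l) * X_plus r $$ (l, j))"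
    using assms(1) Suc.prems X_plus_pow_carrier[of r k]
    by (simp add: scalar_prod_def atLeast0LessThan)
  also have "\<dots> = (\<Sum>l<r. if l = i + k then (if j = Suc l then X_weight r i l * X_weight r l j else 0)
      else 0)"
    using assms(1) Suc.prems by (intro sum.cong refl) (simp add: Suc.IH X_plus_index)
  also have "\<dots> = (if j = i + Suc k then X_weight r i j else 0)"
    using Suc.prems by (auto simp: X_weight_trans)
  finally show ?case .
qed

text \<open>The diagonal entry of H at the 0-based index i, kept as an integer so that it can serve
  as exponent in \<open>powi\<close>.\<close>

definition H_weight :: "nat \<Rightarrow> nat \<Rightarrow> int" where
  "H_weight r i = int r - 1 - 2 * int i"

lemma X_weight_square:
  assumes "Suc i \<le> r"
  shows "X_weight r i (Suc i) * X_weight r i (Suc i) = of_int (int (Suc i) * (int r - int (Suc i)))"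
proof -
  have "X_weight r i (Suc i) * X_weight r i (Suc i) = complex_of_real (real (Suc i * (r - Suc i)))"
    unfolding X_weight_Suc of_real_mult[symmetric] by (simp only: real_sqrt_mult_self abs_of_nat)
  also have "\<dots> = of_int (int (Suc i * (r - Suc i)))" by simp
  also have "int (Suc i * (r - Suc i)) = int (Suc i) * (int r - int (Suc i))"
    by (simp only: of_nat_mult of_nat_diff[OF assms])
  finally show ?thesis .
qed

text \<open>The two products are diagonal with entries s_{i+1} and s_i, where s_l = l (r - l), and
  the difference is r - 1 - 2 i. In the last row the absent entry of X_+ is accounted for by s_r =
  0, in the first row that of X_- by s_0 = 0.\<close>

lemma H_mat_index:
  assumes i: "i < r" and j: "j < r"
  shows "H_mat r $$ (i, j) = (if i = j then of_int (H_weight r i) else 0)"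
proof -
  have 1: "(X_plus r * X_minus r) $$ (i, j) =
      (if i = j then of_int (int (Suc i) * (int r - int (Suc i))) else 0)"
  proof -
    have "(X_plus r * X_minus r) $$ (i, j) = (\<Sum>l<r. X_plus r $$ (i, l) * X_minus r $$ (l, j))"
      using i j by (simp add: scalar_prod_def atLeast0LessThan)
    also have "\<dots> = (\<Sum>l<r. if l = Suc i then
        (if i = j then X_weight r i (Suc i) * X_weight r i (Suc i) else 0) else 0)"
      using i j by (intro sum.cong refl) (auto simp: X_plus_index X_minus_index)
    also have "\<dots> = (if i = j then of_int (int (Suc i) * (int r - int (Suc i))) else 0)"
    proof (cases "Suc i < r")
      case True
      then show ?thesis by (simp add: X_weight_square)
    next
      case False
      then have "r = Suc i" using i by simp
      then show ?thesis by simp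
    qed
    finally show ?thesis .
  qed
  have 2: "(X_minus r * X_plus r) $$ (i, j) = (if i = j then of_int (int i * (int r - int i)) else 0)"
  proof -
    have "(X_minus r * X_plus r) $$ (i, j) = (\<Sum>l<r. X_minus r $$ (i, l) * X_plus r $$ (l, j))"
      using i j by (simp add: scalar_prod_def atLeast0LessThan)
    also have "\<dots> = (if i = j then of_int (int i * (int r - int i)) else 0)"
    proof (cases i)
      case 0
      then show ?thesis using i j by (auto simp: X_minus_index intro!: sum.neutral)
    next
      case (Suc k)
      have "(\<Sum>l<r. X_minus r $$ (i, l) * X_plus r $$ (l, j)) = (\<Sum>l<r. if l = k then
          (if i = j then X_weight r k (Suc k) * X_weight r k (Suc k) else 0) else 0)"
        using i j Suc by (intro sum.cong refl) (auto simp: X_plus_index X_minus_index)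
      then show ?thesis using i Suc X_weight_square[of k r]
        by (auto simp del: of_int_mult of_int_diff of_nat_Suc)
    qed
    finally show ?thesis .
  qed
  have "H_mat r $$ (i, j) = (X_plus r * X_minus r) $$ (i, j) - (X_minus r * X_plus r) $$ (i, j)"
    using i j by (simp add: H_mat_def)
  also have "\<dots> = (if i = j then of_int (H_weight r i) else 0)"
    unfolding 1 2 by (simp add: H_weight_def algebra_simps)
  finally show ?thesis .
qed

lemma H_mat_carrier [simp]: "H_mat r \<in> carrier_mat r r"
  unfolding H_mat_def by (intro minus_carrier_mat mult_carrier_mat[OF X_minus_carrier X_plus_carrier])

lemma H_mat_dims [simp]: "dim_row (H_mat r) = r" "dim_col (H_mat r) = r"
  using H_mat_carrier[of r] by (rule carrier_matD)+

lemma mat_exp_dims [simp]: "dim_row (mat_exp A) = dim_row A" "dim_col (mat_exp A) = dim_row A"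
  by (simp_all only: mat_exp_def dim_row_mat dim_col_mat)

lemma smult_pow_mat_index:
  fixes A :: "complex mat"
  assumes A: "A \<in> carrier_mat n n" and ij: "i < n" "j < n"
  shows "((c \<cdot>\<^sub>m A) ^\<^sub>m k) $$ (i, j) = c ^ k * (A ^\<^sub>m k) $$ (i, j)"
proof -
  have pc: "B \<in> carrier_mat n n \<Longrightarrow> B ^\<^sub>m k \<in> carrier_mat n n" for B :: "complex mat" and k
    by (induction k) (auto intro: mult_carrier_mat)
  have "(c \<cdot>\<^sub>m A) ^\<^sub>m k = c ^ k \<cdot>\<^sub>m (A ^\<^sub>m k)"
  proof (induction k)
    case 0
    then show ?case using A by (intro eq_matI) auto
  next
    case (Suc k)
    then show ?case
      using A pc[OF A, of k] by (intro eq_matI) (auto simp: scalar_prod_def sum_distrib_left mult_ac)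
  qed
  then show ?thesis using carrier_matD[OF pc[OF A, of k]] ij by simp
qed

lemma mat_exp_X_plus:
  assumes ij: "i < r" "j < r"
  shows "mat_exp (t \<cdot>\<^sub>m X_plus r) $$ (i, j) = X_exp r t i j"
proof -
  have "mat_exp (t \<cdot>\<^sub>m X_plus r) $$ (i, j) =
      (\<Sum>k. if k \<in> {k. j = i + k} then t ^ k * X_weight r i j / fact k else 0)"
    using ij by (auto simp: mat_exp_def smult_pow_mat_index[OF X_plus_carrier ij] X_plus_pow_index
        intro!: suminf_cong)
  also have "\<dots> = (\<Sum>k\<in>{k. j = i + k}. t ^ k * X_weight r i j / fact k)"
  proof -
    have "finite {k. j = i + k}" by (rule finite_subset[of _ "{..j}"]) auto
    then show ?thesis by (subst suminf_finite[of "{k. j = i + k}"]) auto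
  qed
  also have "\<dots> = X_exp r t i j"
  proof (cases "i \<le> j")
    case True
    then have "{k. j = i + k} = {j - i}" by auto
    then show ?thesis using True by (simp add: X_exp_def)
  next
    case False
    then have "{k. j = i + k} = {}" by auto
    then show ?thesis using False by (simp add: X_exp_def)
  qed
  finally show ?thesis .
qed

lemma mat_exp_H_mat:
  assumes ij: "i < r" "j < r" and "w \<noteq> 0"
  shows "mat_exp (Ln w \<cdot>\<^sub>m H_mat r) $$ (i, j) = (if i = j then w powi H_weight r i else 0)"
proof -
  have pow: "(H_mat r ^\<^sub>m k) $$ (i, j) = (if i = j then of_int (H_weight r i) ^ k else 0)" for k
    using ij(2)
  proof (induction k arbitrary: j)
    case 0
    then show ?case using ij carrier_matD[OF H_mat_carrier[of r]] by auto
  next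
    case (Suc k)
    have c: "H_mat r ^\<^sub>m k \<in> carrier_mat r r"
      using carrier_matD[OF H_mat_carrier[of r]] by (intro carrier_matI) auto
    have "(H_mat r ^\<^sub>m Suc k) $$ (i, j) = (\<Sum>l<r. (H_mat r ^\<^sub>m k) $$ (i, l) * H_mat r $$ (l, j))"
      using ij(1) Suc.prems carrier_matD[OF c] carrier_matD[OF H_mat_carrier[of r]]
      by (simp add: scalar_prod_def atLeast0LessThan)
    also have "\<dots> = (\<Sum>l<r. if l = i then
        (if i = j then of_int (H_weight r i) ^ Suc k else 0) else 0)"
      using ij(1) Suc by (intro sum.cong refl) (auto simp: H_mat_index)
    finally show ?case using ij by simp
  qed
  have "mat_exp (Ln w \<cdot>\<^sub>m H_mat r) $$ (i, j) =
      (\<Sum>k. if i = j then (Ln w * of_int (H_weight r i)) ^ k /\<^sub>R fact k else 0)"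
    using ij carrier_matD[OF H_mat_carrier[of r]]
    by (auto simp: mat_exp_def smult_pow_mat_index[OF H_mat_carrier ij] pow power_mult_distrib
        scaleR_conv_of_real divide_simps intro!: suminf_cong)
  also have "\<dots> = (if i = j then exp (Ln w * of_int (H_weight r i)) else 0)"
    by (simp add: exp_def)
  also have "exp (Ln w * of_int (H_weight r i)) = w powi H_weight r i"
    using exp_power_int[of "Ln w" "H_weight r i"] \<open>w \<noteq> 0\<close> by (simp add: mult.commute)
  finally show ?thesis .
qed

lemma X_exp_0: "X_exp r 0 i j = (if i = j then 1 else 0)"
  by (auto simp: X_exp_def)

text \<open>The binomial theorem: along i \<le> l \<le> j the weights multiply to the same
  \<open>X_weight r i j\<close>, and the factorials combine into binomial coefficients.\<close>

lemma X_exp_add: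
  assumes "i < r" "j < r"
  shows "(\<Sum>l<r. X_exp r s i l * X_exp r t l j) = X_exp r (s + t) i j"
proof (cases "i \<le> j")
  case False
  then show ?thesis by (auto simp: X_exp_def intro!: sum.neutral)
next
  case True
  define n where "n = j - i"
  have j: "j = i + n" using True by (simp add: n_def)
  have "(\<Sum>l<r. X_exp r s i l * X_exp r t l j) = (\<Sum>l\<in>{i..j}. X_exp r s i l * X_exp r t l j)"
    using assms by (intro sum.mono_neutral_right) (auto simp: X_exp_def)
  also have "\<dots> = (\<Sum>k\<le>n. X_exp r s i (i + k) * X_exp r t (i + k) j)"
    by (rule sum.reindex_bij_witness[of _ "\<lambda>k. i + k" "\<lambda>l. l - i"]) (auto simp: j)
  also have "\<dots> = (\<Sum>k\<le>n. of_nat (n choose k) * s ^ k * t ^ (n - k) / fact n * X_weight r i j)"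
  proof (intro sum.cong refl)
    fix k assume k: "k \<in> {..n}"
    have "X_exp r s i (i + k) * X_exp r t (i + k) j =
        s ^ k / fact k * (t ^ (n - k) / fact (n - k)) * (X_weight r i (i + k) * X_weight r (i + k) j)"
      using k by (simp add: X_exp_def j)
    also have "X_weight r i (i + k) * X_weight r (i + k) j = X_weight r i j"
      using k by (intro X_weight_trans) (auto simp: j)
    also have "s ^ k / fact k * (t ^ (n - k) / fact (n - k)) =
        of_nat (n choose k) * s ^ k * t ^ (n - k) / fact n"
      using k by (simp add: binomial_fact field_simps)
    finally show "X_exp r s i (i + k) * X_exp r t (i + k) j =
      of_nat (n choose k) * s ^ k * t ^ (n - k) / fact n * X_weight r i j" .
  qed
  also have "\<dots> = X_exp r (s + t) i j"
    using True by (simp add: X_exp_def binomial_ring n_def sum_distrib_right sum_divide_distrib)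
  finally show ?thesis .
qed

text \<open>The entries of \<open>t\<^sup>2 X\<^sub>+ exp (t X\<^sub>+)\<close>.\<close>

definition X_exp' :: "nat \<Rightarrow> complex \<Rightarrow> nat \<Rightarrow> nat \<Rightarrow> complex" where
  "X_exp' r t i j = (if i < j then t ^ Suc (j - i) / fact (j - i - 1) * X_weight r i j else 0)"

text \<open>For j = i + n every term is F = t^(n+1) / (n+1)! times \<open>X_weight r i j\<close>,
  multiplied by an integer. What remains is s_{j+1} = s_i + (n + 1) (r - 1 - 2 i) - n (n + 1) with
  s_l = l (r - l). Below the diagonal only the subdiagonal entry of X_- is left on both
  sides.\<close>

lemma X_exp_X_minus:
  assumes i: "i < r" and j: "j < r"
  shows "(\<Sum>l<r. X_exp r t i l * X_minus r $$ (l, j)) =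
    (\<Sum>l<r. X_minus r $$ (i, l) * X_exp r t l j) +
    t * of_int (H_weight r i) * X_exp r t i j - X_exp' r t i j"
proof -
  have L: "(\<Sum>l<r. X_exp r t i l * X_minus r $$ (l, j)) =
      (if Suc j < r then X_exp r t i (Suc j) * X_weight r j (Suc j) else 0)"
  proof -
    have "(\<Sum>l<r. X_exp r t i l * X_minus r $$ (l, j)) =
        (\<Sum>l<r. if l = Suc j then X_exp r t i (Suc j) * X_weight r j (Suc j) else 0)"
      using j by (intro sum.cong refl) (auto simp: X_minus_index)
    then show ?thesis by simp
  qed
  have R: "(\<Sum>l<r. X_minus r $$ (i, l) * X_exp r t l j) =
      (case i of 0 \<Rightarrow> 0 | Suc k \<Rightarrow> X_weight r k (Suc k) * X_exp r t k j)"
  proof (cases i)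
    case 0
    then show ?thesis using i by (auto simp: X_minus_index intro!: sum.neutral)
  next
    case (Suc k)
    have "(\<Sum>l<r. X_minus r $$ (i, l) * X_exp r t l j) =
        (\<Sum>l<r. if l = k then X_weight r k (Suc k) * X_exp r t k j else 0)"
      using i Suc by (intro sum.cong refl) (auto simp: X_minus_index)
    then show ?thesis using i Suc by simp
  qed
  consider "i > Suc j" | "i = Suc j" | "i \<le> j" by linarith
  then show ?thesis
  proof cases
    case 1
    then show ?thesis unfolding L R by (auto simp: X_exp_def X_exp'_def split: nat.splits)
  next
    case 2
    then show ?thesis unfolding L R using i by (simp add: X_exp_def X_exp'_def)
  next
    case 3
    define n where "n = j - i"
    have jn: "j = i + n" using 3 by (simp add: n_def)
    define w where "w = X_weight r i j"
    define F where "F = t ^ Suc n / fact (Suc n) * w"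
    have L': "(if Suc j < r then X_exp r t i (Suc j) * X_weight r j (Suc j) else 0) =
        F * of_int (int (Suc j) * (int r - int (Suc j)))"
    proof (cases "Suc j < r")
      case True
      have "X_exp r t i (Suc j) = t ^ Suc n / fact (Suc n) * (w * X_weight r j (Suc j))"
        using X_weight_trans[of i j "Suc j" r] by (simp add: X_exp_def jn w_def del: fact_Suc)
      then have "X_exp r t i (Suc j) * X_weight r j (Suc j) =
          F * (X_weight r j (Suc j) * X_weight r j (Suc j))"
        by (simp add: F_def)
      then show ?thesis using True by (simp add: X_weight_square del: of_int_mult)
    next
      case False
      then have "r = Suc j" using j by simp
      then show ?thesis by simp
    qed
    have R': "(case i of 0 \<Rightarrow> 0 | Suc k \<Rightarrow> X_weight r k (Suc k) * X_exp r t k j) =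
        F * of_int (int i * (int r - int i))"
    proof (cases i)
      case (Suc k)
      have "X_exp r t k j = t ^ Suc n / fact (Suc n) * (X_weight r k (Suc k) * w)"
        using X_weight_trans[of k i j r] Suc jn by (simp add: X_exp_def w_def del: fact_Suc)
      then have "X_weight r k (Suc k) * X_exp r t k j =
          F * (X_weight r k (Suc k) * X_weight r k (Suc k))"
        by (simp add: F_def)
      then show ?thesis using Suc i by (simp add: X_weight_square del: of_int_mult)
    qed simp
    have E: "t * X_exp r t i j = F * of_nat (Suc n)"
      by (simp add: X_exp_def jn F_def w_def field_simps del: of_nat_Suc)
    have E': "X_exp' r t i j = F * (of_nat (Suc n) * of_nat n)"
    proof (cases n)
      case (Suc m)
      then show ?thesis by (simp add: X_exp'_def jn F_def w_def field_simps del: of_nat_Suc)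
    qed (simp add: X_exp'_def jn)
    have "F * of_int (int (Suc j) * (int r - int (Suc j))) =
        F * of_int (int i * (int r - int i) + int (Suc n) * H_weight r i - int (Suc n) * int n)"
      by (simp add: jn H_weight_def algebra_simps)
    moreover have "t * of_int (H_weight r i) * X_exp r t i j =
        F * of_nat (Suc n) * of_int (H_weight r i)"
      using E by (simp add: mult_ac)
    ultimately show ?thesis
      unfolding L R L' R' E' by (simp only:) (simp add: algebra_simps)
  qed
qed

lemma X_exp_X_plus_pow:
  assumes i: "i < r" and j: "j < r"
  shows "(\<Sum>l<r. X_exp r t i l * (X_plus r ^\<^sub>m k) $$ (l, j)) =
    (\<Sum>l<r. (X_plus r ^\<^sub>m k) $$ (i, l) * X_exp r t l j)"
proof -
  let ?c = "if i + k \<le> j then t ^ (j - i - k) / fact (j - i - k) * X_weight r i j else 0"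
  have "(\<Sum>l<r. X_exp r t i l * (X_plus r ^\<^sub>m k) $$ (l, j)) =
      (\<Sum>l<r. if l = j - k then (if k \<le> j then X_exp r t i l * X_weight r l j else 0) else 0)"
    using j by (intro sum.cong refl) (auto simp: X_plus_pow_index)
  also have "\<dots> = (if k \<le> j then X_exp r t i (j - k) * X_weight r (j - k) j else 0)"
    using j by auto
  also have "\<dots> = ?c"
    using X_weight_trans[of i "j - k" j r]
    by (auto simp: X_exp_def diff_right_commute add.commute[of k i] mult.assoc)
  finally have 1: "(\<Sum>l<r. X_exp r t i l * (X_plus r ^\<^sub>m k) $$ (l, j)) = ?c" .
  have "(\<Sum>l<r. (X_plus r ^\<^sub>m k) $$ (i, l) * X_exp r t l j) =
      (\<Sum>l<r. if l = i + k then X_weight r i l * X_exp r t l j else 0)"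
    using i by (intro sum.cong refl) (auto simp: X_plus_pow_index)
  also have "\<dots> = (if i + k < r then X_weight r i (i + k) * X_exp r t (i + k) j else 0)"
    by simp
  also have "\<dots> = ?c"
    using X_weight_trans[of i "i + k" j r] j by (auto simp: X_exp_def)
  finally show ?thesis unfolding 1 by simp
qed

text \<open>By [H, X_+] = 2 X_+, moving w^H from the right to the left of exp (t X_+) multiplies t
  by w^(-2).\<close>

lemma X_exp_scale:
  assumes "w \<noteq> 0"
  shows "X_exp r t i j * w powi H_weight r j = w powi H_weight r i * X_exp r (t * w powi (-2)) i j"
proof (cases "i \<le> j")
  case True
  then have H: "H_weight r j = H_weight r i + (-2) * int (j - i)"
    by (simp add: H_weight_def of_nat_diff)
  have "w powi H_weight r j = w powi H_weight r i * (w powi (-2)) ^ (j - i)"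
  proof -
    have "w powi (H_weight r i + (-2) * int (j - i)) = w powi H_weight r i * w powi ((-2) * int (j - i))"
      by (rule power_int_add) (simp add: assms)
    then show ?thesis unfolding H by (simp only: power_int_mult power_int_of_nat)
  qed
  then show ?thesis using True by (simp add: X_exp_def power_mult_distrib)
qed (simp add: X_exp_def)

section \<open>The Higgs field and its commutation with the exponential\<close>

lemma higgs_field_carrier [simp]: "higgs_field r q \<alpha> x \<in> carrier_mat r r"
  by (simp add: higgs_field_def)

lemma higgs_field_index:
  assumes "i < r" "j < r"
  shows "higgs_field r q \<alpha> x $$ (i, j) =
    X_minus r $$ (i, j) + (\<Sum>l = 2..r. q l \<alpha> x * (X_plus r ^\<^sub>m (l - 1)) $$ (i, j))"
  using assms by (simp add: higgs_field_def)

text \<open>The powers of X_+ commute with exp (t X_+), so the differentials leave the correction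
  found for X_- unchanged.\<close>

lemma X_exp_higgs_field:
  assumes i: "i < r" and j: "j < r"
  shows "(\<Sum>l<r. X_exp r t i l * higgs_field r q \<alpha> x $$ (l, j)) =
    (\<Sum>l<r. higgs_field r q \<alpha> x $$ (i, l) * X_exp r t l j) +
    t * of_int (H_weight r i) * X_exp r t i j - X_exp' r t i j"
proof -
  have "(\<Sum>l<r. X_exp r t i l * higgs_field r q \<alpha> x $$ (l, j)) =
      (\<Sum>l<r. X_exp r t i l * X_minus r $$ (l, j) +
        (\<Sum>k = 2..r. q k \<alpha> x * (X_exp r t i l * (X_plus r ^\<^sub>m (k - 1)) $$ (l, j))))"
    using j by (intro sum.cong refl) (simp add: higgs_field_index distrib_left sum_distrib_left mult_ac)
  also have "\<dots> = (\<Sum>l<r. X_exp r t i l * X_minus r $$ (l, j)) +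
      (\<Sum>k = 2..r. q k \<alpha> x * (\<Sum>l<r. X_exp r t i l * (X_plus r ^\<^sub>m (k - 1)) $$ (l, j)))"
    unfolding sum.distrib sum_distrib_left by (subst (2) sum.swap) (rule refl)
  finally have 1: "(\<Sum>l<r. X_exp r t i l * higgs_field r q \<alpha> x $$ (l, j)) = \<dots>" .
  have "(\<Sum>l<r. higgs_field r q \<alpha> x $$ (i, l) * X_exp r t l j) =
      (\<Sum>l<r. X_minus r $$ (i, l) * X_exp r t l j +
        (\<Sum>k = 2..r. q k \<alpha> x * ((X_plus r ^\<^sub>m (k - 1)) $$ (i, l) * X_exp r t l j)))"
    using i by (intro sum.cong refl) (simp add: higgs_field_index distrib_right distrib_left sum_distrib_left mult_ac)
  also have "\<dots> = (\<Sum>l<r. X_minus r $$ (i, l) * X_exp r t l j) +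
      (\<Sum>k = 2..r. q k \<alpha> x * (\<Sum>l<r. (X_plus r ^\<^sub>m (k - 1)) $$ (i, l) * X_exp r t l j))"
    unfolding sum.distrib sum_distrib_left by (subst (2) sum.swap) (rule refl)
  finally have 2: "(\<Sum>l<r. higgs_field r q \<alpha> x $$ (i, l) * X_exp r t l j) = \<dots>" .
  show ?thesis unfolding 1 2 X_exp_X_minus[OF i j] X_exp_X_plus_pow[OF i j] by simp
qed

section \<open>Coordinate changes and the theta characteristic\<close>

locale theta_curve =
  fixes X :: "('i, 'a::t2_space) atlas"
    and a b c d :: "'i \<Rightarrow> 'i \<Rightarrow> complex"
    and \<xi> :: "'i \<Rightarrow> 'i \<Rightarrow> 'a \<Rightarrow> complex"
  assumes pcs: "projective_coordinate_system X a b c d"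
    and theta: "theta_characteristic X c d \<xi>"
begin

lemma open_nbd: "open (nbd X \<alpha>)"
  using pcs by (simp add: projective_coordinate_system_def)

lemma nbd_cover: "\<exists>\<alpha>. p \<in> nbd X \<alpha>"
  using pcs by (auto simp: projective_coordinate_system_def)

lemma chart: "homeomorphism (nbd X \<alpha>) (crd X \<alpha> ` nbd X \<alpha>) (crd X \<alpha>) (pt X \<alpha>)"
  using pcs by (simp add: projective_coordinate_system_def)

lemma open_crd_nbd: "open (crd X \<alpha> ` nbd X \<alpha>)"
  using pcs by (simp add: projective_coordinate_system_def)

lemma pt_crd [simp]: "p \<in> nbd X \<alpha> \<Longrightarrow> pt X \<alpha> (crd X \<alpha> p) = p"
  using chart by (simp add: homeomorphism_def)

lemma pt_mem: "z \<in> crd X \<alpha> ` W \<Longrightarrow> W \<subseteq> nbd X \<alpha> \<Longrightarrow> pt X \<alpha> z \<in> W"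
  by auto

lemma open_crd_image:
  assumes "open W" "W \<subseteq> nbd X \<alpha>"
  shows "open (crd X \<alpha> ` W)"
proof -
  have "openin (top_of_set (crd X \<alpha> ` nbd X \<alpha>)) (crd X \<alpha> ` W)"
    using assms by (intro homeomorphism_imp_open_map[OF chart]) (auto simp: openin_open)
  then show ?thesis using open_crd_nbd openin_open_trans by blast
qed

lemma open_overlap: "open (crd X \<beta> ` (nbd X \<alpha> \<inter> nbd X \<beta>))"
  by (intro open_crd_image open_Int open_nbd) auto

lemma mobius:
  assumes "p \<in> nbd X \<alpha>" "p \<in> nbd X \<beta>"
  shows "a \<alpha> \<beta> * d \<alpha> \<beta> - b \<alpha> \<beta> * c \<alpha> \<beta> = 1"
    and "c \<alpha> \<beta> * crd X \<beta> p + d \<alpha> \<beta> \<noteq> 0"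
    and "crd X \<alpha> p = (a \<alpha> \<beta> * crd X \<beta> p + b \<alpha> \<beta>) / (c \<alpha> \<beta> * crd X \<beta> p + d \<alpha> \<beta>)"
  using pcs assms unfolding projective_coordinate_system_def by blast+

lemma xi_cases:
  assumes "p \<in> nbd X \<alpha>" "p \<in> nbd X \<beta>"
  shows "\<xi> \<alpha> \<beta> p = c \<alpha> \<beta> * crd X \<beta> p + d \<alpha> \<beta> \<or> \<xi> \<alpha> \<beta> p = - (c \<alpha> \<beta> * crd X \<beta> p + d \<alpha> \<beta>)"
  using theta assms unfolding theta_characteristic_def by blast

lemma xi_square:
  assumes "p \<in> nbd X \<alpha>" "p \<in> nbd X \<beta>"
  shows "\<xi> \<alpha> \<beta> p ^ 2 = (c \<alpha> \<beta> * crd X \<beta> p + d \<alpha> \<beta>) ^ 2"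
  using xi_cases[OF assms] by (metis power2_minus)

lemma xi_nonzero: "p \<in> nbd X \<alpha> \<Longrightarrow> p \<in> nbd X \<beta> \<Longrightarrow> \<xi> \<alpha> \<beta> p \<noteq> 0"
  using xi_cases[of p \<alpha> \<beta>] mobius(2)[of p \<alpha> \<beta>] by (metis neg_equal_0_iff_equal)

lemma xi_cocycle:
  "p \<in> nbd X \<alpha> \<Longrightarrow> p \<in> nbd X \<beta> \<Longrightarrow> p \<in> nbd X \<gamma> \<Longrightarrow> \<xi> \<alpha> \<beta> p * \<xi> \<beta> \<gamma> p = \<xi> \<alpha> \<gamma> p"
  using theta unfolding theta_characteristic_def by blast

lemma xi_same: "p \<in> nbd X \<alpha> \<Longrightarrow> \<xi> \<alpha> \<alpha> p = 1"
  using xi_cocycle[of p \<alpha> \<alpha> \<alpha>] xi_nonzero[of p \<alpha> \<alpha>] by simp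

lemma xi_inverse: "p \<in> nbd X \<alpha> \<Longrightarrow> p \<in> nbd X \<beta> \<Longrightarrow> \<xi> \<alpha> \<beta> p * \<xi> \<beta> \<alpha> p = 1"
  using xi_cocycle[of p \<alpha> \<beta> \<alpha>] xi_same[of p \<alpha>] by simp

lemma eventually_overlap:
  assumes "p \<in> nbd X \<alpha>" "p \<in> nbd X \<beta>"
  shows "\<forall>\<^sub>F z in nhds (crd X \<beta> p). z \<in> crd X \<beta> ` (nbd X \<alpha> \<inter> nbd X \<beta>)"
  using open_overlap[of \<beta> \<alpha>] assms by (intro eventually_nhds_in_open) auto

text \<open>By a d - b c = 1 the derivative is (c x + d)^(-2). The sign of \<xi> disappears in the
  square, and the reversed cocycle \<xi> \<beta> \<alpha> replaces the reciprocal.\<close>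

lemma crd_change_deriv:
  assumes p: "p \<in> nbd X \<alpha>" "p \<in> nbd X \<beta>"
  shows "((\<lambda>z. crd X \<alpha> (pt X \<beta> z)) has_field_derivative \<xi> \<beta> \<alpha> p ^ 2) (at (crd X \<beta> p))"
proof -
  let ?x = "crd X \<beta> p" and ?a = "a \<alpha> \<beta>" and ?b = "b \<alpha> \<beta>" and ?c = "c \<alpha> \<beta>" and ?d = "d \<alpha> \<beta>"
  have "((\<lambda>z. (?a * z + ?b) / (?c * z + ?d)) has_field_derivative 1 / (?c * ?x + ?d) ^ 2) (at ?x)"
    using mobius(1,2)[OF p]
    by (auto intro!: derivative_eq_intros simp: field_simps power2_eq_square)
  moreover have "\<forall>\<^sub>F z in nhds ?x. crd X \<alpha> (pt X \<beta> z) = (?a * z + ?b) / (?c * z + ?d)"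
    using eventually_overlap[OF p]
  proof eventually_elim
    case (elim z)
    then have "pt X \<beta> z \<in> nbd X \<alpha>" "pt X \<beta> z \<in> nbd X \<beta>" "crd X \<beta> (pt X \<beta> z) = z" by auto
    then show ?case using mobius(3)[of "pt X \<beta> z" \<alpha> \<beta>] by simp
  qed
  moreover have "1 / (?c * ?x + ?d) ^ 2 = \<xi> \<beta> \<alpha> p ^ 2"
  proof -
    have "(\<xi> \<alpha> \<beta> p * \<xi> \<beta> \<alpha> p) ^ 2 = 1" using xi_inverse[OF p] by simp
    then show ?thesis
      using mobius(2)[OF p] by (simp add: power_mult_distrib xi_square[OF p] field_simps)
  qed
  ultimately show ?thesis
    using DERIV_cong_ev[OF refl, of "\<lambda>z. crd X \<alpha> (pt X \<beta> z)" "\<lambda>z. (?a * z + ?b) / (?c * z + ?d)" ?x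
        "1 / (?c * ?x + ?d) ^ 2" "\<xi> \<beta> \<alpha> p ^ 2"] by simp
qed

lemma jac_eq: "p \<in> nbd X \<alpha> \<Longrightarrow> p \<in> nbd X \<beta> \<Longrightarrow> jac X \<alpha> \<beta> p = \<xi> \<beta> \<alpha> p ^ 2"
  unfolding jac_def dcrd_def by (rule DERIV_imp_deriv[OF crd_change_deriv])

text \<open>The quotient of \<xi> by c x + d is continuous with values 1 and -1; two such values at
  distance less than 1 coincide, so the sign \<epsilon> is locally constant. This is the source of
  the holomorphy of \<xi>, whose definition only asks for continuity.\<close>

lemma xi_local:
  assumes p: "p \<in> nbd X \<alpha>" "p \<in> nbd X \<beta>"
  obtains \<epsilon> where "\<epsilon> \<noteq> 0" "\<forall>\<^sub>F z in nhds (crd X \<beta> p). \<xi> \<alpha> \<beta> (pt X \<beta> z) = \<epsilon> * (c \<alpha> \<beta> * z + d \<alpha> \<beta>)"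
proof -
  let ?O = "crd X \<beta> ` (nbd X \<alpha> \<inter> nbd X \<beta>)"
  let ?l = "\<lambda>z. c \<alpha> \<beta> * z + d \<alpha> \<beta>"
  let ?g = "\<lambda>z. \<xi> \<alpha> \<beta> (pt X \<beta> z) / ?l z"
  let ?x = "crd X \<beta> p"
  have O: "pt X \<beta> z \<in> nbd X \<alpha>" "pt X \<beta> z \<in> nbd X \<beta>" "crd X \<beta> (pt X \<beta> z) = z" if "z \<in> ?O" for z
    using that by auto
  have l: "?l z \<noteq> 0" if "z \<in> ?O" for z
    using mobius(2)[OF O(1,2)[OF that]] O(3)[OF that] by simp
  have g: "?g z = 1 \<or> ?g z = -1" if "z \<in> ?O" for z
    using xi_cases[OF O(1,2)[OF that]] O(3)[OF that] l[OF that] by (auto simp: divide_simps)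
  have "continuous_on ?O (\<lambda>z. \<xi> \<alpha> \<beta> (pt X \<beta> z))"
  proof (rule continuous_on_compose2[of "nbd X \<alpha> \<inter> nbd X \<beta>" "\<xi> \<alpha> \<beta>" _ "pt X \<beta>"])
    show "continuous_on (nbd X \<alpha> \<inter> nbd X \<beta>) (\<xi> \<alpha> \<beta>)"
      using theta by (simp add: theta_characteristic_def)
    show "continuous_on ?O (pt X \<beta>)"
      using chart[of \<beta>] by (auto simp: homeomorphism_def elim: continuous_on_subset)
  qed auto
  then have "continuous_on ?O ?g"
    using l by (intro continuous_intros) auto
  moreover have x: "?x \<in> ?O" using p by simp
  ultimately have "isCont ?g ?x"
    using open_overlap continuous_on_eq_continuous_at by blast
  then have "(?g \<longlongrightarrow> ?g ?x) (nhds ?x)"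
    unfolding isCont_def by (rule tendsto_at_iff_tendsto_nhds[THEN iffD1])
  then have "\<forall>\<^sub>F z in nhds ?x. dist (?g z) (?g ?x) < 1"
    by (rule tendstoD) simp
  then have "\<forall>\<^sub>F z in nhds ?x. \<xi> \<alpha> \<beta> (pt X \<beta> z) = ?g ?x * ?l z"
    using eventually_overlap[OF p]
  proof eventually_elim
    case (elim z)
    then have "?g z = ?g ?x"
      using g[OF x] g[of z] by (auto simp: dist_norm)
    then show ?case using l[OF elim(2)] by (simp add: field_simps)
  qed
  moreover have "?g ?x \<noteq> 0" using g[OF x] by auto
  ultimately show ?thesis using that by blast
qed

definition xi_log :: "'i \<Rightarrow> 'i \<Rightarrow> complex \<Rightarrow> complex" where
  "xi_log \<alpha> \<beta> z = c \<alpha> \<beta> / (c \<alpha> \<beta> * z + d \<alpha> \<beta>)"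

lemma xi_deriv:
  assumes p: "p \<in> nbd X \<alpha>" "p \<in> nbd X \<beta>"
  shows "((\<lambda>z. \<xi> \<alpha> \<beta> (pt X \<beta> z)) has_field_derivative \<xi> \<alpha> \<beta> p * xi_log \<alpha> \<beta> (crd X \<beta> p))
    (at (crd X \<beta> p))"
proof -
  obtain \<epsilon> where \<epsilon>: "\<forall>\<^sub>F z in nhds (crd X \<beta> p). \<xi> \<alpha> \<beta> (pt X \<beta> z) = \<epsilon> * (c \<alpha> \<beta> * z + d \<alpha> \<beta>)"
    using xi_local[OF p] by blast
  have "((\<lambda>z. \<epsilon> * (c \<alpha> \<beta> * z + d \<alpha> \<beta>)) has_field_derivative \<epsilon> * c \<alpha> \<beta>) (at (crd X \<beta> p))"
    by (auto intro!: derivative_eq_intros)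
  moreover have "\<xi> \<alpha> \<beta> p * xi_log \<alpha> \<beta> (crd X \<beta> p) = \<epsilon> * c \<alpha> \<beta>"
    using eventually_nhds_x_imp_x[OF \<epsilon>] p mobius(2)[OF p] by (simp add: xi_log_def)
  ultimately show ?thesis
    using DERIV_cong_ev[OF refl \<epsilon>, of "\<xi> \<alpha> \<beta> p * xi_log \<alpha> \<beta> (crd X \<beta> p)" "\<epsilon> * c \<alpha> \<beta>"] by simp
qed

lemma dcrd_xi:
  assumes "p \<in> nbd X \<alpha>" "p \<in> nbd X \<beta>"
  shows "dcrd X \<beta> (\<xi> \<alpha> \<beta>) p / \<xi> \<alpha> \<beta> p = xi_log \<alpha> \<beta> (crd X \<beta> p)"
  unfolding dcrd_def DERIV_imp_deriv[OF xi_deriv[OF assms]] using xi_nonzero[OF assms] by simp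

lemma xi_log_deriv:
  assumes "p \<in> nbd X \<alpha>" "p \<in> nbd X \<beta>"
  shows "(xi_log \<alpha> \<beta> has_field_derivative - (xi_log \<alpha> \<beta> (crd X \<beta> p) ^ 2)) (at (crd X \<beta> p))"
  unfolding xi_log_def[abs_def] using mobius(2)[OF assms]
  by (auto intro!: derivative_eq_intros simp: power2_eq_square divide_simps)

lemma deriv_change_chart:
  assumes p: "p \<in> nbd X \<beta>" "p \<in> nbd X \<gamma>"
    and f: "((\<lambda>z. f (pt X \<beta> z)) has_field_derivative D) (at (crd X \<beta> p))"
  shows "((\<lambda>z. f (pt X \<gamma> z)) has_field_derivative D * \<xi> \<gamma> \<beta> p ^ 2) (at (crd X \<gamma> p))"
proof -
  have der: "((\<lambda>z. f (pt X \<beta> (crd X \<beta> (pt X \<gamma> z)))) has_field_derivative D * \<xi> \<gamma> \<beta> p ^ 2)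
      (at (crd X \<gamma> p))"
    by (rule DERIV_chain2[where f = "\<lambda>z. f (pt X \<beta> z)" and g = "\<lambda>z. crd X \<beta> (pt X \<gamma> z)"])
      (use f p crd_change_deriv[OF p] in auto)
  have ev: "\<forall>\<^sub>F z in nhds (crd X \<gamma> p). f (pt X \<gamma> z) = f (pt X \<beta> (crd X \<beta> (pt X \<gamma> z)))"
    using eventually_overlap[OF p] by eventually_elim auto
  show ?thesis
    by (rule DERIV_cong_ev[OF refl ev refl, THEN iffD2, OF der])
qed

text \<open>The logarithmic derivative with respect to x_\<gamma> of the cocycle identity for \<xi>;
  the first factor is differentiated through x_\<beta>, which contributes the chain factor
  dx_\<beta>/dx_\<gamma> = (\<xi> \<gamma> \<beta>)^2.\<close>

lemma xi_log_cocycle: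
  assumes p: "p \<in> nbd X \<alpha>" "p \<in> nbd X \<beta>" "p \<in> nbd X \<gamma>"
  shows "xi_log \<alpha> \<gamma> (crd X \<gamma> p) =
    xi_log \<alpha> \<beta> (crd X \<beta> p) * \<xi> \<gamma> \<beta> p ^ 2 + xi_log \<beta> \<gamma> (crd X \<gamma> p)"
proof -
  have der: "((\<lambda>z. \<xi> \<alpha> \<beta> (pt X \<gamma> z) * \<xi> \<beta> \<gamma> (pt X \<gamma> z)) has_field_derivative
      \<xi> \<alpha> \<beta> p * xi_log \<alpha> \<beta> (crd X \<beta> p) * \<xi> \<gamma> \<beta> p ^ 2 * \<xi> \<beta> \<gamma> p +
      \<xi> \<beta> \<gamma> p * xi_log \<beta> \<gamma> (crd X \<gamma> p) * \<xi> \<alpha> \<beta> p) (at (crd X \<gamma> p))"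
    using DERIV_mult[OF deriv_change_chart[OF p(2,3) xi_deriv[OF p(1,2)]] xi_deriv[OF p(2,3)]] p
    by simp
  have ev: "\<forall>\<^sub>F z in nhds (crd X \<gamma> p).
      \<xi> \<alpha> \<beta> (pt X \<gamma> z) * \<xi> \<beta> \<gamma> (pt X \<gamma> z) = \<xi> \<alpha> \<gamma> (pt X \<gamma> z)"
    using eventually_overlap[OF p(1,3)] eventually_overlap[OF p(2,3)]
  proof eventually_elim
    case (elim z)
    then have "pt X \<gamma> z \<in> nbd X \<alpha>" "pt X \<gamma> z \<in> nbd X \<beta>" "pt X \<gamma> z \<in> nbd X \<gamma>"
      using pt_mem[of z \<gamma> "nbd X \<alpha> \<inter> nbd X \<gamma>"] pt_mem[of z \<gamma> "nbd X \<beta> \<inter> nbd X \<gamma>"] by auto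
    then show ?case by (rule xi_cocycle)
  qed
  have "((\<lambda>z. \<xi> \<alpha> \<gamma> (pt X \<gamma> z)) has_field_derivative
      \<xi> \<alpha> \<beta> p * xi_log \<alpha> \<beta> (crd X \<beta> p) * \<xi> \<gamma> \<beta> p ^ 2 * \<xi> \<beta> \<gamma> p +
      \<xi> \<beta> \<gamma> p * xi_log \<beta> \<gamma> (crd X \<gamma> p) * \<xi> \<alpha> \<beta> p) (at (crd X \<gamma> p))"
    by (rule DERIV_cong_ev[OF refl ev refl, THEN iffD1, OF der])
  from DERIV_unique[OF this xi_deriv[OF p(1,3)]]
  have "\<xi> \<alpha> \<gamma> p * xi_log \<alpha> \<gamma> (crd X \<gamma> p) = \<xi> \<alpha> \<gamma> p *
      (xi_log \<alpha> \<beta> (crd X \<beta> p) * \<xi> \<gamma> \<beta> p ^ 2 + xi_log \<beta> \<gamma> (crd X \<gamma> p))"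
    unfolding xi_cocycle[OF p, symmetric] by (simp add: algebra_simps)
  then show ?thesis using xi_nonzero[OF p(1,3)] by simp
qed

end

section \<open>The oper bundle and the gauge law\<close>

lemma higgs_field_dims [simp]: "dim_row (higgs_field r q \<alpha> z) = r" "dim_col (higgs_field r q \<alpha> z) = r"
  by (simp_all add: higgs_field_def)

lemma one_smult_higgs: "1 \<cdot>\<^sub>m higgs_field r q \<alpha> z = higgs_field r q \<alpha> z"
  by (rule eq_matI) simp_all

lemma higgs_field_lower: "i < r \<Longrightarrow> Suc j < i \<Longrightarrow> higgs_field r q \<alpha> z $$ (i, j) = 0"
  by (auto simp: higgs_field_index X_minus_index X_plus_pow_index intro!: sum.neutral)

lemma higgs_field_subdiag: "Suc i < r \<Longrightarrow> higgs_field r q \<alpha> z $$ (Suc i, i) = X_weight r i (Suc i)"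
  by (simp add: higgs_field_index X_minus_index X_plus_pow_index)

lemma X_weight_nonzero: "Suc i < r \<Longrightarrow> X_weight r i (Suc i) \<noteq> 0"
  by (simp add: X_weight_Suc del: of_nat_Suc of_nat_mult mult_Suc)

text \<open>Evaluates the description in \<open>rees_of\<close>: the factor h cancels the 1 / h of
  the oper, and a polynomial is determined by its values off 0.\<close>

lemma the_constant_poly:
  "(THE p. \<forall>h. h \<noteq> 0 \<longrightarrow> poly p h = h * ((1 / h) * k)) = [:k:]" for k :: complex
proof (rule the_equality)
  fix p assume p: "\<forall>h. h \<noteq> 0 \<longrightarrow> poly p h = h * ((1 / h) * k)"
  show "p = [:k:]"
  proof (rule ccontr)
    assume "p \<noteq> [:k:]"
    then have "finite {x. poly (p - [:k:]) x = 0}" by (intro poly_roots_finite) simp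
    moreover have "UNIV - {0} \<subseteq> {x. poly (p - [:k:]) x = 0}" using p by auto
    ultimately have "finite (UNIV - {0 :: complex})" by (rule rev_finite_subset)
    then show False by (simp add: infinite_UNIV_char_0)
  qed
qed simp

lemma rees_of_oper_of:
  "rrank (rees_of (oper_of X \<xi> r q)) = r"
  "rtrans (rees_of (oper_of X \<xi> r q)) = Eh_trans X \<xi> r"
  "rconn (rees_of (oper_of X \<xi> r q)) = (\<lambda>\<alpha> z. map_mat (\<lambda>a. [:a:]) (higgs_field r q \<alpha> z))"
proof -
  show "rconn (rees_of (oper_of X \<xi> r q)) = (\<lambda>\<alpha> z. map_mat (\<lambda>a. [:a:]) (higgs_field r q \<alpha> z))"
  proof (intro ext eq_matI)
    fix \<alpha> z i j
    assume "i < dim_row (map_mat (\<lambda>a. [:a:]) (higgs_field r q \<alpha> z))"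
      "j < dim_col (map_mat (\<lambda>a. [:a:]) (higgs_field r q \<alpha> z))"
    then have ij: "i < r" "j < r" by simp_all
    have e: "((1 / h) \<cdot>\<^sub>m higgs_field r q \<alpha> z) $$ (i, j) = (1 / h) * higgs_field r q \<alpha> z $$ (i, j)" for h
      using ij by simp
    have "rconn (rees_of (oper_of X \<xi> r q)) \<alpha> z $$ (i, j) =
        (THE p. \<forall>h. h \<noteq> 0 \<longrightarrow> poly p h = h * ((1 / h) * higgs_field r q \<alpha> z $$ (i, j)))"
      using ij unfolding e[symmetric] by (simp add: rees_of_def oper_of_def)
    then show "rconn (rees_of (oper_of X \<xi> r q)) \<alpha> z $$ (i, j) =
        map_mat (\<lambda>a. [:a:]) (higgs_field r q \<alpha> z) $$ (i, j)"
      unfolding the_constant_poly using ij by simp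
  qed (simp_all add: rees_of_def oper_of_def)
qed (simp_all add: rees_of_def oper_of_def)

context theta_curve
begin

lemma Eh_trans_index:
  assumes p: "p \<in> nbd X \<alpha>" "p \<in> nbd X \<beta>" and ij: "i < r" "j < r"
  shows "Eh_trans X \<xi> r \<alpha> \<beta> h p $$ (i, j) =
    \<xi> \<alpha> \<beta> p powi H_weight r i * X_exp r (h * xi_log \<alpha> \<beta> (crd X \<beta> p)) i j"
proof -
  let ?A = "mat_exp (Ln (\<xi> \<alpha> \<beta> p) \<cdot>\<^sub>m H_mat r)"
  let ?B = "mat_exp ((h * xi_log \<alpha> \<beta> (crd X \<beta> p)) \<cdot>\<^sub>m X_plus r)"
  have dims: "dim_row ?A = r" "dim_col ?A = r" "dim_row ?B = r" "dim_col ?B = r"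
    by simp_all
  have "Eh_trans X \<xi> r \<alpha> \<beta> h p $$ (i, j) = (\<Sum>l<r. ?A $$ (i, l) * ?B $$ (l, j))"
    using ij dims by (simp add: Eh_trans_def dcrd_xi[OF p] scalar_prod_def atLeast0LessThan)
  also have "\<dots> = (\<Sum>l<r. if l = i then \<xi> \<alpha> \<beta> p powi H_weight r i *
      X_exp r (h * xi_log \<alpha> \<beta> (crd X \<beta> p)) i j else 0)"
    using ij by (intro sum.cong refl) (auto simp: mat_exp_H_mat[OF _ _ xi_nonzero[OF p]] mat_exp_X_plus)
  finally show ?thesis using ij by simp
qed

lemma Eh_trans_carrier: "Eh_trans X \<xi> r \<alpha> \<beta> h p \<in> carrier_mat r r"
  by (intro carrier_matI) (simp_all add: Eh_trans_def)

lemma Eh_trans_upper_triangular: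
  assumes "p \<in> nbd X \<alpha>" "p \<in> nbd X \<beta>"
  shows "upper_triangular (Eh_trans X \<xi> r \<alpha> \<beta> h p)"
  using carrier_matD[OF Eh_trans_carrier[of r \<alpha> \<beta> h p]]
  by (intro upper_triangularI) (simp add: Eh_trans_index[OF assms] X_exp_def)

lemma xi_holomorphic: "(\<lambda>z. \<xi> \<alpha> \<beta> (pt X \<beta> z)) holomorphic_on crd X \<beta> ` (nbd X \<alpha> \<inter> nbd X \<beta>)"
  unfolding holomorphic_on_open[OF open_overlap]
proof (rule ballI)
  fix z assume "z \<in> crd X \<beta> ` (nbd X \<alpha> \<inter> nbd X \<beta>)"
  then obtain p where p: "p \<in> nbd X \<alpha>" "p \<in> nbd X \<beta>" and z: "z = crd X \<beta> p" by auto
  show "\<exists>D. ((\<lambda>z. \<xi> \<alpha> \<beta> (pt X \<beta> z)) has_field_derivative D) (at z)"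
    unfolding z by (rule exI, rule xi_deriv[OF p])
qed

lemma xi_log_holomorphic: "xi_log \<alpha> \<beta> holomorphic_on crd X \<beta> ` (nbd X \<alpha> \<inter> nbd X \<beta>)"
  unfolding holomorphic_on_open[OF open_overlap]
proof (rule ballI)
  fix z assume "z \<in> crd X \<beta> ` (nbd X \<alpha> \<inter> nbd X \<beta>)"
  then obtain p where p: "p \<in> nbd X \<alpha>" "p \<in> nbd X \<beta>" and z: "z = crd X \<beta> p" by auto
  show "\<exists>D. (xi_log \<alpha> \<beta> has_field_derivative D) (at z)"
    unfolding z by (rule exI, rule xi_log_deriv[OF p])
qed

text \<open>For the cocycle condition, the diagonal factor w^H of the second transition is moved
  through the first exponential, which rescales its parameter by w^(-2) = dx_\<beta>/dx_\<gamma>.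
  The two parameters then add up by \<open>xi_log_cocycle\<close>. Invertibility is visible on the
  diagonal, whose entries are powers of \<xi>.\<close>

lemma vector_bundle_Eh: "vector_bundle X r (\<lambda>\<alpha> \<beta>. Eh_trans X \<xi> r \<alpha> \<beta> h)"
  unfolding vector_bundle_def
proof (intro conjI allI ballI impI)
  fix \<alpha> \<beta> p assume "p \<in> nbd X \<alpha> \<inter> nbd X \<beta>"
  then have p: "p \<in> nbd X \<alpha>" "p \<in> nbd X \<beta>" by auto
  let ?g = "Eh_trans X \<xi> r \<alpha> \<beta> h p"
  show g: "?g \<in> carrier_mat r r" by (rule Eh_trans_carrier)
  have "det ?g = prod_list (diag_mat ?g)"
    by (rule det_upper_triangular[OF Eh_trans_upper_triangular[OF p] g])
  moreover have "0 \<notin> set (diag_mat ?g)"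
    using carrier_matD[OF g] xi_nonzero[OF p]
    by (auto simp: diag_mat_def Eh_trans_index[OF p] X_exp_def)
  ultimately show "det ?g \<noteq> 0" by (simp add: prod_list_zero_iff)
next
  fix \<alpha> \<beta> i j assume ij: "i < r" "j < r"
  let ?O = "crd X \<beta> ` (nbd X \<alpha> \<inter> nbd X \<beta>)"
  have "(\<lambda>z. \<xi> \<alpha> \<beta> (pt X \<beta> z) powi H_weight r i * X_exp r (h * xi_log \<alpha> \<beta> z) i j) holomorphic_on ?O"
  proof -
    have "(\<lambda>z. X_exp r (h * xi_log \<alpha> \<beta> z) i j) holomorphic_on ?O"
      unfolding X_exp_def using xi_log_holomorphic[of \<alpha> \<beta>]
      by (cases "i \<le> j") (auto intro!: holomorphic_intros)
    then show ?thesis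
      by (intro holomorphic_intros xi_holomorphic) (use xi_nonzero in auto)
  qed
  then show "(\<lambda>z. Eh_trans X \<xi> r \<alpha> \<beta> h (pt X \<beta> z) $$ (i, j)) holomorphic_on ?O"
    by (rule holomorphic_transform) (auto simp: Eh_trans_index ij)
next
  fix \<alpha> \<beta> \<gamma> p assume "p \<in> nbd X \<alpha> \<inter> nbd X \<beta> \<inter> nbd X \<gamma>"
  then have p: "p \<in> nbd X \<alpha>" "p \<in> nbd X \<beta>" "p \<in> nbd X \<gamma>" by auto
  let ?s = "h * xi_log \<alpha> \<beta> (crd X \<beta> p)" and ?t = "h * xi_log \<beta> \<gamma> (crd X \<gamma> p)"
  let ?f = "Eh_trans X \<xi> r \<alpha> \<beta> h p" and ?g = "Eh_trans X \<xi> r \<beta> \<gamma> h p"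
  let ?w = "\<xi> \<beta> \<gamma> p"
  have inv: "?w powi (-2) = \<xi> \<gamma> \<beta> p ^ 2"
  proof -
    have "\<xi> \<gamma> \<beta> p = inverse ?w"
      using xi_inverse[OF p(2,3)] by (metis inverse_unique)
    then show ?thesis by (simp add: power_int_minus power_inverse)
  qed
  show "?f * ?g = Eh_trans X \<xi> r \<alpha> \<gamma> h p"
  proof (rule eq_matI)
    fix i j assume "i < dim_row (Eh_trans X \<xi> r \<alpha> \<gamma> h p)" "j < dim_col (Eh_trans X \<xi> r \<alpha> \<gamma> h p)"
    then have ij: "i < r" "j < r" using carrier_matD[OF Eh_trans_carrier[of r \<alpha> \<gamma> h p]] by auto
    have "(?f * ?g) $$ (i, j) = (\<Sum>l<r. ?f $$ (i, l) * ?g $$ (l, j))"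
      using ij carrier_matD[OF Eh_trans_carrier[of r \<alpha> \<beta> h p]]
        carrier_matD[OF Eh_trans_carrier[of r \<beta> \<gamma> h p]]
      by (simp add: scalar_prod_def atLeast0LessThan)
    also have "\<dots> = (\<Sum>l<r. \<xi> \<alpha> \<beta> p powi H_weight r i *
        (X_exp r ?s i l * ?w powi H_weight r l) * X_exp r ?t l j)"
      using ij p by (intro sum.cong refl) (simp add: Eh_trans_index mult_ac)
    also have "\<dots> = \<xi> \<alpha> \<beta> p powi H_weight r i * ?w powi H_weight r i *
        (\<Sum>l<r. X_exp r (?s * ?w powi (-2)) i l * X_exp r ?t l j)"
      unfolding X_exp_scale[OF xi_nonzero[OF p(2,3)]] by (simp add: sum_distrib_left mult_ac)
    also have "\<dots> = \<xi> \<alpha> \<gamma> p powi H_weight r i * X_exp r (?s * ?w powi (-2) + ?t) i j"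
      unfolding X_exp_add[OF ij] xi_cocycle[OF p, symmetric] by (simp add: power_int_mult_distrib)
    also have "?s * ?w powi (-2) + ?t = h * xi_log \<alpha> \<gamma> (crd X \<gamma> p)"
      unfolding inv xi_log_cocycle[OF p] by (simp add: algebra_simps)
    also have "\<xi> \<alpha> \<gamma> p powi H_weight r i * X_exp r (h * xi_log \<alpha> \<gamma> (crd X \<gamma> p)) i j =
        Eh_trans X \<xi> r \<alpha> \<gamma> h p $$ (i, j)"
      using ij p by (simp add: Eh_trans_index)
    finally show "(?f * ?g) $$ (i, j) = Eh_trans X \<xi> r \<alpha> \<gamma> h p $$ (i, j)" .
  qed (use carrier_matD[OF Eh_trans_carrier[of r]] in auto)
qed

text \<open>Conjugation by \<xi>^H scales X_- by \<xi>^2 and X_+^(k-1) by \<xi>^(-2(k-1)), while the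
  k-differential q_k contributes \<xi>^(2k). All summands therefore acquire the same factor \<xi>^2
  = dx_\<beta>/dx_\<alpha>.\<close>

lemma higgs_field_change_chart:
  assumes p: "p \<in> nbd X \<alpha>" "p \<in> nbd X \<beta>" "p \<notin> supp D" and ij: "i < r" "l < r"
    and q: "\<forall>l \<in> {2..r}. q l \<in> sections_KD X D l"
  shows "higgs_field r q \<alpha> (crd X \<alpha> p) $$ (i, l) * \<xi> \<alpha> \<beta> p powi H_weight r l =
    \<xi> \<alpha> \<beta> p ^ 2 * (\<xi> \<alpha> \<beta> p powi H_weight r i * higgs_field r q \<beta> (crd X \<beta> p) $$ (i, l))"
proof -
  let ?w = "\<xi> \<alpha> \<beta> p"
  have w: "?w \<noteq> 0" by (rule xi_nonzero[OF p(1,2)])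
  have qk: "q k \<alpha> (crd X \<alpha> p) = q k \<beta> (crd X \<beta> p) * (?w ^ 2) ^ k" if "k \<in> {2..r}" for k
  proof -
    have "q k \<in> sections_KD X D k" using q that by blast
    then have "\<forall>\<alpha> \<beta>. \<forall>p \<in> nbd X \<alpha> \<inter> nbd X \<beta> - supp D.
        q k \<alpha> (crd X \<alpha> p) = q k \<beta> (crd X \<beta> p) * jac X \<beta> \<alpha> p ^ k"
      unfolding sections_KD_def by simp
    then have "q k \<alpha> (crd X \<alpha> p) = q k \<beta> (crd X \<beta> p) * jac X \<beta> \<alpha> p ^ k"
      using p by blast
    then show ?thesis by (simp only: jac_eq[OF p(2,1)])
  qed
  have shift2: "?w powi (2 + n) = ?w ^ 2 * ?w powi n" for n
  proof -
    have "?w powi (2 + n) = ?w powi 2 * ?w powi n" by (rule power_int_add) (simp add: w)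
    then show ?thesis by simp
  qed
  have shift2k: "?w powi (2 * int k + n) = (?w ^ 2) ^ k * ?w powi n" for k n
  proof -
    have "?w powi (2 * int k + n) = ?w powi (2 * int k) * ?w powi n"
      by (rule power_int_add) (simp add: w)
    then show ?thesis by (simp add: power_int_mult)
  qed
  have X: "X_minus r $$ (i, l) * ?w powi H_weight r l =
      ?w ^ 2 * (?w powi H_weight r i * X_minus r $$ (i, l))"
  proof (cases "i = Suc l")
    case True
    then have "H_weight r l = 2 + H_weight r i" by (simp add: H_weight_def)
    then have "?w powi H_weight r l = ?w ^ 2 * ?w powi H_weight r i"
      by (simp only: shift2)
    then have "X_minus r $$ (i, l) * ?w powi H_weight r l =
        X_minus r $$ (i, l) * (?w ^ 2 * ?w powi H_weight r i)" by (rule arg_cong)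
    also have "\<dots> = ?w ^ 2 * (?w powi H_weight r i * X_minus r $$ (i, l))"
      by (simp only: mult_ac)
    finally show ?thesis .
  qed (use ij in \<open>simp add: X_minus_index\<close>)
  have Y: "q k \<alpha> (crd X \<alpha> p) * (X_plus r ^\<^sub>m (k - 1)) $$ (i, l) * ?w powi H_weight r l =
      ?w ^ 2 * (?w powi H_weight r i * (q k \<beta> (crd X \<beta> p) * (X_plus r ^\<^sub>m (k - 1)) $$ (i, l)))"
    if k: "k \<in> {2..r}" for k
  proof (cases "l = i + (k - 1)")
    case True
    then have "2 * int k + H_weight r l = 2 + H_weight r i"
      using k by (simp add: H_weight_def)
    then have "?w powi (2 * int k + H_weight r l) = ?w powi (2 + H_weight r i)" by simp
    then have eq: "(?w ^ 2) ^ k * ?w powi H_weight r l = ?w ^ 2 * ?w powi H_weight r i"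
      by (simp only: shift2 shift2k)
    let ?Y = "q k \<beta> (crd X \<beta> p) * (X_plus r ^\<^sub>m (k - 1)) $$ (i, l)"
    have "q k \<alpha> (crd X \<alpha> p) * (X_plus r ^\<^sub>m (k - 1)) $$ (i, l) * ?w powi H_weight r l =
        ?Y * ((?w ^ 2) ^ k * ?w powi H_weight r l)"
      unfolding qk[OF k] by (simp only: mult_ac)
    also have "\<dots> = ?w ^ 2 * (?w powi H_weight r i * ?Y)"
      unfolding eq by (simp only: mult_ac)
    finally show ?thesis .
  qed (use ij in \<open>simp add: X_plus_pow_index\<close>)
  have "higgs_field r q \<alpha> (crd X \<alpha> p) $$ (i, l) * ?w powi H_weight r l =
      X_minus r $$ (i, l) * ?w powi H_weight r l + (\<Sum>k = 2..r.
        q k \<alpha> (crd X \<alpha> p) * (X_plus r ^\<^sub>m (k - 1)) $$ (i, l) * ?w powi H_weight r l)"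
    using ij by (simp add: higgs_field_index distrib_right sum_distrib_right)
  also have "\<dots> = ?w ^ 2 * (?w powi H_weight r i * X_minus r $$ (i, l)) + (\<Sum>k = 2..r.
      ?w ^ 2 * (?w powi H_weight r i * (q k \<beta> (crd X \<beta> p) * (X_plus r ^\<^sub>m (k - 1)) $$ (i, l))))"
    unfolding X by (rule arg_cong2[where f = "(+)", OF refl], rule sum.cong[OF refl], rule Y)
  also have "\<dots> = ?w ^ 2 * (?w powi H_weight r i * higgs_field r q \<beta> (crd X \<beta> p) $$ (i, l))"
    using ij by (simp add: higgs_field_index distrib_left sum_distrib_left)
  finally show ?thesis .
qed

text \<open>For t = h u the rule u' = -u^2 becomes h t' = -t^2, and h times the logarithmic
  derivative of \<xi> is t. So h times the derivative of \<xi>^H exp (t X_+) is \<xi>^H (t H - t^2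
  X_+) exp (t X_+), the correction term of \<open>X_exp_higgs_field\<close>.\<close>

lemma dmat_Eh:
  assumes p: "p \<in> nbd X \<alpha>" "p \<in> nbd X \<beta>" and ij: "i < r" "j < r"
    and t_def: "t = h * xi_log \<alpha> \<beta> (crd X \<beta> p)"
  shows "h * dmat X r \<beta> (Eh_trans X \<xi> r \<alpha> \<beta> h) p $$ (i, j) =
    \<xi> \<alpha> \<beta> p powi H_weight r i * (t * of_int (H_weight r i) * X_exp r t i j - X_exp' r t i j)"
proof -
  let ?x = "crd X \<beta> p"
  let ?n = "H_weight r i"
  let ?u = "xi_log \<alpha> \<beta> ?x"
  let ?w = "\<xi> \<alpha> \<beta> p"
  let ?D = "if i < j then of_nat (j - i) * t ^ (j - i - 1) * (h * (- (?u ^ 2))) / fact (j - i) *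
    X_weight r i j else 0"
  have w: "?w \<noteq> 0" by (rule xi_nonzero[OF p])
  have 1: "((\<lambda>z. \<xi> \<alpha> \<beta> (pt X \<beta> z) powi ?n) has_field_derivative of_int ?n * ?w powi ?n * ?u) (at ?x)"
  proof -
    have "((\<lambda>z. \<xi> \<alpha> \<beta> (pt X \<beta> z) powi ?n) has_field_derivative
        of_int ?n * ?w powi (?n - 1) * (?w * ?u)) (at ?x)"
      using DERIV_power_int[OF xi_deriv[OF p], of ?n] p w by simp
    moreover have "?w powi (?n - 1) * ?w = ?w powi ?n"
      using w by (simp add: power_int_diff)
    moreover have "of_int ?n * ?w powi (?n - 1) * (?w * ?u) = of_int ?n * (?w powi (?n - 1) * ?w) * ?u"
      by (simp only: mult.assoc)
    ultimately show ?thesis by (simp only:)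
  qed
  have 2: "((\<lambda>z. X_exp r (h * xi_log \<alpha> \<beta> z) i j) has_field_derivative ?D) (at ?x)"
  proof (cases "i < j")
    case True
    have "((\<lambda>z. (h * xi_log \<alpha> \<beta> z) ^ (j - i)) has_field_derivative
        of_nat (j - i) * (h * (- (?u ^ 2)) * t ^ (j - i - 1))) (at ?x)"
      using DERIV_power[OF DERIV_cmult[OF xi_log_deriv[OF p], of h], of "j - i"] by (simp add: t_def)
    from DERIV_cmult_right[OF DERIV_cdivide[OF this, of "fact (j - i)"], of "X_weight r i j"]
    show ?thesis using True by (simp add: X_exp_def mult_ac)
  next
    case False
    then have "X_exp r (h * xi_log \<alpha> \<beta> z) i j = X_exp r t i j" for z
      by (auto simp: X_exp_def)
    then show ?thesis using False by simp
  qed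
  have "((\<lambda>z. Eh_trans X \<xi> r \<alpha> \<beta> h (pt X \<beta> z) $$ (i, j)) has_field_derivative
      of_int ?n * ?w powi ?n * ?u * X_exp r t i j + ?D * ?w powi ?n) (at ?x)"
  proof -
    have ev: "\<forall>\<^sub>F z in nhds ?x. Eh_trans X \<xi> r \<alpha> \<beta> h (pt X \<beta> z) $$ (i, j) =
        \<xi> \<alpha> \<beta> (pt X \<beta> z) powi ?n * X_exp r (h * xi_log \<alpha> \<beta> z) i j"
      using eventually_overlap[OF p] by eventually_elim (auto simp: Eh_trans_index ij)
    have der: "((\<lambda>z. \<xi> \<alpha> \<beta> (pt X \<beta> z) powi ?n * X_exp r (h * xi_log \<alpha> \<beta> z) i j)
        has_field_derivative of_int ?n * ?w powi ?n * ?u * X_exp r t i j + ?D * ?w powi ?n) (at ?x)"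
      using DERIV_mult[OF 1 2] p by (simp add: t_def)
    show ?thesis by (rule DERIV_cong_ev[OF refl ev refl, THEN iffD2, OF der])
  qed
  then have dE: "dcrd X \<beta> (\<lambda>p'. Eh_trans X \<xi> r \<alpha> \<beta> h p' $$ (i, j)) p =
      of_int ?n * ?w powi ?n * ?u * X_exp r t i j + ?D * ?w powi ?n"
    unfolding dcrd_def by (rule DERIV_imp_deriv)
  have hD: "h * ?D = - X_exp' r t i j"
  proof (cases "i < j")
    case True
    then obtain m where m: "j - i = Suc m" by (cases "j - i") auto
    have "of_nat (Suc m) * t ^ m * (h * (- (?u ^ 2))) / fact (Suc m) =
        t ^ m * (h * (- (?u ^ 2))) / (fact m :: complex)"
      unfolding fact_Suc mult.assoc by (rule mult_divide_mult_cancel_left) (rule of_nat_neq_0)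
    moreover have "t ^ Suc (Suc m) = t ^ m * (h * (h * ?u ^ 2))"
      by (simp add: t_def power2_eq_square power_mult_distrib mult_ac)
    ultimately show ?thesis
      using True unfolding X_exp'_def m by (simp only: if_True diff_Suc_1) simp
  qed (simp add: X_exp'_def)
  have "h * dmat X r \<beta> (Eh_trans X \<xi> r \<alpha> \<beta> h) p $$ (i, j) =
      h * (of_int ?n * ?w powi ?n * ?u * X_exp r t i j) + h * ?D * ?w powi ?n"
    using ij by (simp only: dmat_def index_mat(1) prod.case dE distrib_left mult.assoc)
  also have "\<dots> = ?w powi ?n * (t * of_int ?n * X_exp r t i j - X_exp' r t i j)"
    unfolding hD by (simp add: t_def algebra_simps)
  finally show ?thesis .
qed

text \<open>The diagonal factor turns the field of one chart into that of the other and produces the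
  Jacobian; commuting the field past the exponential leaves precisely h times the derivative of the
  transition matrix.\<close>

lemma gauge_entry:
  assumes p: "p \<in> nbd X \<alpha>" "p \<in> nbd X \<beta>" "p \<notin> supp D" and ij: "i < r" "j < r"
    and q: "\<forall>l \<in> {2..r}. q l \<in> sections_KD X D l"
  shows "(\<Sum>l<r. higgs_field r q \<alpha> (crd X \<alpha> p) $$ (i, l) * Eh_trans X \<xi> r \<alpha> \<beta> h p $$ (l, j)) =
    jac X \<beta> \<alpha> p * ((\<Sum>l<r. Eh_trans X \<xi> r \<alpha> \<beta> h p $$ (i, l) * higgs_field r q \<beta> (crd X \<beta> p) $$ (l, j))
      - h * dmat X r \<beta> (Eh_trans X \<xi> r \<alpha> \<beta> h) p $$ (i, j))"
proof -
  let ?t = "h * xi_log \<alpha> \<beta> (crd X \<beta> p)" and ?w = "\<xi> \<alpha> \<beta> p" and ?n = "H_weight r i"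
  let ?\<phi> = "\<lambda>i l. higgs_field r q \<beta> (crd X \<beta> p) $$ (i, l)"
  have "(\<Sum>l<r. higgs_field r q \<alpha> (crd X \<alpha> p) $$ (i, l) * Eh_trans X \<xi> r \<alpha> \<beta> h p $$ (l, j)) =
      (\<Sum>l<r. (higgs_field r q \<alpha> (crd X \<alpha> p) $$ (i, l) * ?w powi H_weight r l) * X_exp r ?t l j)"
    using ij by (intro sum.cong refl) (simp add: Eh_trans_index[OF p(1,2)] mult.assoc)
  also have "\<dots> = (\<Sum>l<r. ?w ^ 2 * (?w powi ?n * ?\<phi> i l) * X_exp r ?t l j)"
    using ij by (intro sum.cong refl) (simp add: higgs_field_change_chart[OF p _ _ q])
  also have "\<dots> = ?w ^ 2 * ?w powi ?n * (\<Sum>l<r. ?\<phi> i l * X_exp r ?t l j)"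
    by (simp add: sum_distrib_left mult_ac)
  also have "(\<Sum>l<r. ?\<phi> i l * X_exp r ?t l j) = (\<Sum>l<r. X_exp r ?t i l * ?\<phi> l j) -
      (?t * of_int ?n * X_exp r ?t i j - X_exp' r ?t i j)"
    unfolding X_exp_higgs_field[OF ij] by simp
  also have "?w ^ 2 * ?w powi ?n * \<dots> = ?w ^ 2 * ((\<Sum>l<r. ?w powi ?n * X_exp r ?t i l * ?\<phi> l j) -
      ?w powi ?n * (?t * of_int ?n * X_exp r ?t i j - X_exp' r ?t i j))"
    by (simp add: sum_distrib_left right_diff_distrib mult_ac)
  also have "(\<Sum>l<r. ?w powi ?n * X_exp r ?t i l * ?\<phi> l j) =
      (\<Sum>l<r. Eh_trans X \<xi> r \<alpha> \<beta> h p $$ (i, l) * ?\<phi> l j)"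
    using ij by (intro sum.cong refl) (simp add: Eh_trans_index[OF p(1,2)])
  finally show ?thesis unfolding dmat_Eh[OF p(1,2) ij refl] jac_eq[OF p(2,1)] .
qed

text \<open>The scalar k covers three uses at once: k = 1 / h with h' = 1 is the oper, k = 1 with h'
  = h the Rees module, and k = 1 with h = h' = 0 the Higgs field.\<close>

lemma gauge_compatibleI:
  assumes q: "\<forall>l \<in> {2..r}. q l \<in> sections_KD X D l"
    and A: "\<And>\<alpha> z. A \<alpha> z = k \<cdot>\<^sub>m higgs_field r q \<alpha> z" and h: "h' = k * h"
  shows "gauge_compatible X D r h' (\<lambda>\<alpha> \<beta>. Eh_trans X \<xi> r \<alpha> \<beta> h) A"
  unfolding gauge_compatible_def
proof (intro allI ballI)
  fix \<alpha> \<beta> p assume "p \<in> nbd X \<alpha> \<inter> nbd X \<beta> - supp D"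
  then have p: "p \<in> nbd X \<alpha>" "p \<in> nbd X \<beta>" "p \<notin> supp D" by auto
  let ?g = "Eh_trans X \<xi> r \<alpha> \<beta> h"
  have g: "dim_row (?g p) = r" "dim_col (?g p) = r"
    using carrier_matD[OF Eh_trans_carrier[of r \<alpha> \<beta> h p]] by auto
  have f: "dim_row (higgs_field r q \<gamma> z) = r" "dim_col (higgs_field r q \<gamma> z) = r" for \<gamma> z
    by (simp_all add: higgs_field_def)
  have dm: "dim_row (dmat X r \<beta> ?g p) = r" "dim_col (dmat X r \<beta> ?g p) = r"
    by (simp_all add: dmat_def)
  show "A \<alpha> (crd X \<alpha> p) * ?g p = jac X \<beta> \<alpha> p \<cdot>\<^sub>m (?g p * A \<beta> (crd X \<beta> p) - h' \<cdot>\<^sub>m dmat X r \<beta> ?g p)"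
  proof (rule eq_matI)
    fix i j
    assume "i < dim_row (jac X \<beta> \<alpha> p \<cdot>\<^sub>m (?g p * A \<beta> (crd X \<beta> p) - h' \<cdot>\<^sub>m dmat X r \<beta> ?g p))"
      "j < dim_col (jac X \<beta> \<alpha> p \<cdot>\<^sub>m (?g p * A \<beta> (crd X \<beta> p) - h' \<cdot>\<^sub>m dmat X r \<beta> ?g p))"
    then have ij: "i < r" "j < r" by (auto simp: dm)
    have "(A \<alpha> (crd X \<alpha> p) * ?g p) $$ (i, j) =
        k * (\<Sum>l<r. higgs_field r q \<alpha> (crd X \<alpha> p) $$ (i, l) * ?g p $$ (l, j))"
      using ij by (simp add: A f g scalar_prod_def atLeast0LessThan sum_distrib_left mult_ac)
    also have "\<dots> = jac X \<beta> \<alpha> p * (k * (\<Sum>l<r. ?g p $$ (i, l) * higgs_field r q \<beta> (crd X \<beta> p) $$ (l, j))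
      - h' * dmat X r \<beta> ?g p $$ (i, j))"
      unfolding gauge_entry[OF p ij q] h by (simp add: algebra_simps)
    also have "\<dots> = (jac X \<beta> \<alpha> p \<cdot>\<^sub>m (?g p * A \<beta> (crd X \<beta> p) - h' \<cdot>\<^sub>m dmat X r \<beta> ?g p)) $$ (i, j)"
      using ij by (simp add: A f g dm scalar_prod_def atLeast0LessThan sum_distrib_left mult_ac)
    finally show "(A \<alpha> (crd X \<alpha> p) * ?g p) $$ (i, j) = \<dots>" .
  qed (simp_all add: A f g dm)
qed

text \<open>At h = 0 the second exponential is the identity, so the bundle of the Higgs field
  inherits cocycle, holomorphy and gauge law from the family.\<close>

lemma E0_trans_eq_Eh:
  assumes p: "p \<in> nbd X \<alpha>" "p \<in> nbd X \<beta>"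
  shows "E0_trans \<xi> r \<alpha> \<beta> p = Eh_trans X \<xi> r \<alpha> \<beta> 0 p"
proof (rule eq_matI)
  have dims: "dim_row (Eh_trans X \<xi> r \<alpha> \<beta> 0 p) = r" "dim_col (Eh_trans X \<xi> r \<alpha> \<beta> 0 p) = r"
    using Eh_trans_carrier[of r \<alpha> \<beta> 0 p] by auto
  then show "dim_row (E0_trans \<xi> r \<alpha> \<beta> p) = dim_row (Eh_trans X \<xi> r \<alpha> \<beta> 0 p)"
    "dim_col (E0_trans \<xi> r \<alpha> \<beta> p) = dim_col (Eh_trans X \<xi> r \<alpha> \<beta> 0 p)"
    by (simp_all add: E0_trans_def)
  fix i j assume "i < dim_row (Eh_trans X \<xi> r \<alpha> \<beta> 0 p)" "j < dim_col (Eh_trans X \<xi> r \<alpha> \<beta> 0 p)"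
  then have ij: "i < r" "j < r" using dims by auto
  have "int r - 2 * int (Suc i) + 1 = H_weight r i" by (simp add: H_weight_def)
  moreover have "E0_trans \<xi> r \<alpha> \<beta> p $$ (i, j) =
      (if i = j then \<xi> \<alpha> \<beta> p powi (int r - 2 * int (Suc i) + 1) else 0)"
    using ij by (simp add: E0_trans_def)
  ultimately show "E0_trans \<xi> r \<alpha> \<beta> p $$ (i, j) = Eh_trans X \<xi> r \<alpha> \<beta> 0 p $$ (i, j)"
    using ij by (simp only: Eh_trans_index[OF p] X_exp_0 mult_zero_left) simp
qed

lemma vector_bundle_E0: "vector_bundle X r (E0_trans \<xi> r)"
proof -
  have "(\<lambda>z. E0_trans \<xi> r \<alpha> \<beta> (pt X \<beta> z) $$ (i, j)) holomorphic_on crd X \<beta> ` (nbd X \<alpha> \<inter> nbd X \<beta>)"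
    if "i < r" "j < r" for \<alpha> \<beta> i j
  proof (rule holomorphic_transform)
    show "(\<lambda>z. Eh_trans X \<xi> r \<alpha> \<beta> 0 (pt X \<beta> z) $$ (i, j))
        holomorphic_on crd X \<beta> ` (nbd X \<alpha> \<inter> nbd X \<beta>)"
      using vector_bundle_Eh[of r 0] that by (simp add: vector_bundle_def)
  qed (auto simp: E0_trans_eq_Eh)
  then show ?thesis
    using vector_bundle_Eh[of r 0] unfolding vector_bundle_def by (simp add: E0_trans_eq_Eh)
qed

section \<open>Meromorphy, and the Higgs bundle, oper and Rees module\<close>

context
  fixes r :: nat and D :: "'a \<Rightarrow> nat" and q :: "nat \<Rightarrow> 'i \<Rightarrow> complex \<Rightarrow> complex"
  assumes q: "\<forall>l \<in> {2..r}. q l \<in> sections_KD X D l"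
begin

lemma differential_meromorphic:
  assumes "l \<in> {2..r}"
  shows "q l \<alpha> meromorphic_on crd X \<alpha> ` nbd X \<alpha>"
proof (subst meromorphic_on_meromorphic_at, rule ballI)
  fix z assume "z \<in> crd X \<alpha> ` nbd X \<alpha>"
  then obtain p where p: "p \<in> nbd X \<alpha>" and z: "z = crd X \<alpha> p" by auto
  have "q l \<in> sections_KD X D l" using q assms by blast
  then have "\<forall>\<alpha>. \<forall>p \<in> nbd X \<alpha>. \<exists>N g. open N \<and> crd X \<alpha> p \<in> N \<and> g holomorphic_on N \<and>
        (\<forall>z \<in> N - {crd X \<alpha> p}. q l \<alpha> z * (z - crd X \<alpha> p) ^ (l * D p) = g z)"
    unfolding sections_KD_def by blast
  then obtain N g where N: "open N" "z \<in> N" and g: "g holomorphic_on N"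
    and qg: "\<And>w. w \<in> N - {z} \<Longrightarrow> q l \<alpha> w * (w - z) ^ (l * D p) = g w"
    using p z by meson
  have "g analytic_on {z}" using N g analytic_at by blast
  then have "(\<lambda>w. g w / (w - z) ^ (l * D p)) meromorphic_on {z}"
    by (intro meromorphic_intros analytic_on_imp_meromorphic_on analytic_intros)
  moreover have "\<forall>\<^sub>F w in at z. g w / (w - z) ^ (l * D p) = q l \<alpha> w"
  proof -
    have "\<forall>\<^sub>F w in at z. w \<in> N - {z}"
      using N by (rule eventually_at_in_open)
    then show ?thesis
    proof eventually_elim
      case (elim w)
      have "g w / (w - z) ^ (l * D p) = q l \<alpha> w * (w - z) ^ (l * D p) / (w - z) ^ (l * D p)"
        using qg[OF elim] by simp
      also have "\<dots> = q l \<alpha> w" using elim by simp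
      finally show ?case .
    qed
  qed
  ultimately show "q l \<alpha> meromorphic_on {z}"
    using meromorphic_on_cong[of "{z}" "\<lambda>w. g w / (w - z) ^ (l * D p)" "q l \<alpha>" "{z}"] by simp
qed

lemma differential_holomorphic:
  assumes "l \<in> {2..r}"
  shows "q l \<alpha> holomorphic_on crd X \<alpha> ` (nbd X \<alpha> - supp D)"
  using q assms unfolding sections_KD_def by blast

lemma higgs_field_holomorphic:
  assumes "i < r" "j < r"
  shows "(\<lambda>z. higgs_field r q \<alpha> z $$ (i, j)) holomorphic_on crd X \<alpha> ` (nbd X \<alpha> - supp D)"
  unfolding higgs_field_index[OF assms]
  by (intro holomorphic_intros differential_holomorphic)

lemma higgs_field_meromorphic:
  assumes "i < r" "j < r"
  shows "(\<lambda>z. higgs_field r q \<alpha> z $$ (i, j)) meromorphic_on crd X \<alpha> ` nbd X \<alpha>"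
  unfolding higgs_field_index[OF assms]
  by (intro meromorphic_intros differential_meromorphic)

lemma meromorphic_matrix_higgs: "meromorphic_matrix X D r \<alpha> (\<lambda>z. k \<cdot>\<^sub>m higgs_field r q \<alpha> z)"
  unfolding meromorphic_matrix_def
proof (intro conjI ballI allI impI)
  fix i j assume ij: "i < r" "j < r"
  have eq: "(k \<cdot>\<^sub>m higgs_field r q \<alpha> z) $$ (i, j) = k * higgs_field r q \<alpha> z $$ (i, j)" for z
    using ij by simp
  show "(\<lambda>z. (k \<cdot>\<^sub>m higgs_field r q \<alpha> z) $$ (i, j)) holomorphic_on crd X \<alpha> ` (nbd X \<alpha> - supp D)"
    unfolding eq by (intro holomorphic_intros higgs_field_holomorphic ij)
  show "(\<lambda>z. (k \<cdot>\<^sub>m higgs_field r q \<alpha> z) $$ (i, j)) meromorphic_on crd X \<alpha> ` nbd X \<alpha>"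
    unfolding eq by (intro meromorphic_intros higgs_field_meromorphic ij)
qed simp

lemma meromorphic_higgs_bundle_higgs:
  "meromorphic_higgs_bundle X D r (E0_trans \<xi> r) (higgs_field r q)"
  unfolding meromorphic_higgs_bundle_def
proof (intro conjI allI ballI)
  show "vector_bundle X r (E0_trans \<xi> r)" by (rule vector_bundle_E0)
  show "meromorphic_matrix X D r \<alpha> (higgs_field r q \<alpha>)" for \<alpha>
    using meromorphic_matrix_higgs[of \<alpha> 1] by (simp only: one_smult_higgs)
  fix \<alpha> \<beta> p assume p: "p \<in> nbd X \<alpha> \<inter> nbd X \<beta> - supp D"
  have "gauge_compatible X D r 0 (\<lambda>\<alpha> \<beta>. Eh_trans X \<xi> r \<alpha> \<beta> 0) (higgs_field r q)"
    by (rule gauge_compatibleI[OF q, of _ 1]) (simp_all add: one_smult_higgs)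
  then have "higgs_field r q \<alpha> (crd X \<alpha> p) * Eh_trans X \<xi> r \<alpha> \<beta> 0 p =
      jac X \<beta> \<alpha> p \<cdot>\<^sub>m (Eh_trans X \<xi> r \<alpha> \<beta> 0 p * higgs_field r q \<beta> (crd X \<beta> p) -
        0 \<cdot>\<^sub>m dmat X r \<beta> (Eh_trans X \<xi> r \<alpha> \<beta> 0) p)"
    using p unfolding gauge_compatible_def by blast
  also have "Eh_trans X \<xi> r \<alpha> \<beta> 0 p * higgs_field r q \<beta> (crd X \<beta> p) -
        0 \<cdot>\<^sub>m dmat X r \<beta> (Eh_trans X \<xi> r \<alpha> \<beta> 0) p =
      Eh_trans X \<xi> r \<alpha> \<beta> 0 p * higgs_field r q \<beta> (crd X \<beta> p)"
    using carrier_matD[OF Eh_trans_carrier[of r \<alpha> \<beta> 0 p]]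
    by (intro eq_matI) (simp_all add: dmat_def)
  finally show "higgs_field r q \<alpha> (crd X \<alpha> p) * E0_trans \<xi> r \<alpha> \<beta> p =
      jac X \<beta> \<alpha> p \<cdot>\<^sub>m (E0_trans \<xi> r \<alpha> \<beta> p * higgs_field r q \<beta> (crd X \<beta> p))"
    using p by (simp add: E0_trans_eq_Eh)
qed

lemma meromorphic_oper_oper_of: "meromorphic_oper X D (oper_of X \<xi> r q)"
  unfolding meromorphic_oper_def
proof (intro allI impI conjI ballI)
  fix h :: complex assume h: "h \<noteq> 0"
  show "vector_bundle X (frank (oper_of X \<xi> r q)) (\<lambda>\<alpha> \<beta>. ftrans (oper_of X \<xi> r q) \<alpha> \<beta> h)"
    by (simp add: oper_of_def vector_bundle_Eh)
  show "meromorphic_matrix X D (frank (oper_of X \<xi> r q)) \<alpha> (fconn (oper_of X \<xi> r q) \<alpha> h)" for \<alpha>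
    by (simp add: oper_of_def meromorphic_matrix_higgs)
  show "gauge_compatible X D (frank (oper_of X \<xi> r q)) 1
      (\<lambda>\<alpha> \<beta>. ftrans (oper_of X \<xi> r q) \<alpha> \<beta> h) (\<lambda>\<alpha>. fconn (oper_of X \<xi> r q) \<alpha> h)"
    using h by (simp add: oper_of_def gauge_compatibleI[OF q, of _ "1 / h"])
  show "upper_triangular (ftrans (oper_of X \<xi> r q) \<alpha> \<beta> h p)" if "p \<in> nbd X \<alpha> \<inter> nbd X \<beta>" for \<alpha> \<beta> p
    using that by (simp add: oper_of_def Eh_trans_upper_triangular)
  fix \<alpha> p i j assume "i < frank (oper_of X \<xi> r q)" "j < frank (oper_of X \<xi> r q)"
  then have ij: "i < r" "j < r" by (simp_all add: oper_of_def)
  have eq: "fconn (oper_of X \<xi> r q) \<alpha> h (crd X \<alpha> p) $$ (i, j) =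
      1 / h * higgs_field r q \<alpha> (crd X \<alpha> p) $$ (i, j)"
    using ij by (simp add: oper_of_def)
  show "fconn (oper_of X \<xi> r q) \<alpha> h (crd X \<alpha> p) $$ (i, j) = 0" if "Suc j < i"
    unfolding eq by (simp add: higgs_field_lower[OF ij(1) that])
  show "fconn (oper_of X \<xi> r q) \<alpha> h (crd X \<alpha> p) $$ (i, j) \<noteq> 0" if "i = Suc j"
    unfolding eq using X_weight_nonzero[of j r] ij that h by (simp add: higgs_field_subdiag)
qed

lemma meromorphic_rees_module_rees_of: "meromorphic_rees_module X D (rees_of (oper_of X \<xi> r q))"
  unfolding meromorphic_rees_module_def rees_of_oper_of
proof (intro conjI allI impI)
  show "vector_bundle X r (\<lambda>\<alpha> \<beta>. Eh_trans X \<xi> r \<alpha> \<beta> h)" for h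
    by (rule vector_bundle_Eh)
  show "\<exists>n t. (\<forall>m \<le> n. t m holomorphic_on crd X \<beta> ` (nbd X \<alpha> \<inter> nbd X \<beta>)) \<and>
        (\<forall>p \<in> nbd X \<alpha> \<inter> nbd X \<beta>. \<forall>h.
           Eh_trans X \<xi> r \<alpha> \<beta> h p $$ (i, j) = (\<Sum>m\<le>n. t m (crd X \<beta> p) * h ^ m))"
    if ij: "i < r" "j < r" for \<alpha> \<beta> i j
  proof -
    \<comment> \<open>The entry (i, j) contains h only through the factor h^(j - i), so it is a
      monomial in h and a single coefficient is nonzero.\<close>
    define t where "t m z = (if m = j - i \<and> i \<le> j then \<xi> \<alpha> \<beta> (pt X \<beta> z) powi H_weight r i *
      (xi_log \<alpha> \<beta> z ^ m / fact m * X_weight r i j) else 0)" for m z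
    have "t m holomorphic_on crd X \<beta> ` (nbd X \<alpha> \<inter> nbd X \<beta>)" for m
    proof (cases "m = j - i \<and> i \<le> j")
      case True
      then have "t m = (\<lambda>z. \<xi> \<alpha> \<beta> (pt X \<beta> z) powi H_weight r i *
          (xi_log \<alpha> \<beta> z ^ m / fact m * X_weight r i j))"
        by (intro ext) (simp add: t_def)
      then show ?thesis
        by (simp only:) (intro holomorphic_intros xi_holomorphic xi_log_holomorphic;
          use xi_nonzero in auto)
    next
      case False
      then have "t m = (\<lambda>z. 0)" by (intro ext) (auto simp: t_def)
      then show ?thesis by simp
    qed
    moreover have "Eh_trans X \<xi> r \<alpha> \<beta> h p $$ (i, j) = (\<Sum>m\<le>j - i. t m (crd X \<beta> p) * h ^ m)"
      if "p \<in> nbd X \<alpha> \<inter> nbd X \<beta>" for p h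
    proof -
      have p: "p \<in> nbd X \<alpha>" "p \<in> nbd X \<beta>" using that by auto
      have "(\<Sum>m\<le>j - i. t m (crd X \<beta> p) * h ^ m) =
          (\<Sum>m\<le>j - i. if m = j - i then t m (crd X \<beta> p) * h ^ m else 0)"
        by (intro sum.cong refl) (simp add: t_def)
      also have "\<dots> = t (j - i) (crd X \<beta> p) * h ^ (j - i)" by simp
      also have "\<dots> = Eh_trans X \<xi> r \<alpha> \<beta> h p $$ (i, j)"
        using p by (simp add: t_def Eh_trans_index[OF p ij] X_exp_def power_mult_distrib)
      finally show ?thesis by simp
    qed
    ultimately show ?thesis by blast
  qed
  show "\<exists>n. \<forall>z \<in> crd X \<alpha> ` nbd X \<alpha>. \<forall>i < r. \<forall>j < r.
        degree (map_mat (\<lambda>a. [:a:]) (higgs_field r q \<alpha> z) $$ (i, j)) \<le> n" for \<alpha>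
    by (intro exI[of _ 0]) simp
  show "meromorphic_matrix X D r \<alpha>
      (\<lambda>z. map_mat (\<lambda>p. coeff p m) (map_mat (\<lambda>a. [:a:]) (higgs_field r q \<alpha> z)))" for \<alpha> m
  proof -
    have "map_mat (\<lambda>p. coeff p m) (map_mat (\<lambda>a. [:a:]) (higgs_field r q \<alpha> z)) =
        (if m = 0 then 1 else 0) \<cdot>\<^sub>m higgs_field r q \<alpha> z" for z
      by (rule eq_matI) (cases m; simp)+
    then show ?thesis by (simp only: meromorphic_matrix_higgs)
  qed
  show "gauge_compatible X D r h (\<lambda>\<alpha> \<beta>. Eh_trans X \<xi> r \<alpha> \<beta> h)
        (\<lambda>\<alpha> z. map_mat (\<lambda>p. poly p h) (map_mat (\<lambda>a. [:a:]) (higgs_field r q \<alpha> z)))" for h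
  proof (rule gauge_compatibleI[OF q, of _ 1])
    show "map_mat (\<lambda>p. poly p h) (map_mat (\<lambda>a. [:a:]) (higgs_field r q \<alpha> z)) =
        1 \<cdot>\<^sub>m higgs_field r q \<alpha> z" for \<alpha> z
      by (rule eq_matI) simp_all
  qed simp
qed

end

end

section \<open>Holomorphic functions of two variables\<close>

lemma holomorphic2_onD:
  assumes "holomorphic2_on f N" "x \<in> N"
  obtains a b where "(f has_derivative (\<lambda>(s, t). a * s + b * t)) (at x)"
  using assms unfolding holomorphic2_on_def by blast

lemma holomorphic2_atI:
  assumes "(f has_derivative F) (at x)" and "\<And>s t. F (s, t) = a * s + b * t"
  shows "\<exists>a b. (f has_derivative (\<lambda>(s, t). a * s + b * t)) (at x)"
proof -
  have "F = (\<lambda>(s, t). a * s + b * t)" using assms(2) by auto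
  then show ?thesis using assms(1) by blast
qed

lemma holomorphic2_on_const: "holomorphic2_on (\<lambda>x. k) N"
  unfolding holomorphic2_on_def
  by (intro ballI holomorphic2_atI[of _ "\<lambda>_. 0" _ 0 0]) simp_all

lemma holomorphic2_on_snd: "holomorphic2_on snd N"
  unfolding holomorphic2_on_def
  by (intro ballI holomorphic2_atI[of _ snd _ 0 1]) (auto intro!: derivative_eq_intros)

lemma holomorphic2_on_fst:
  assumes "f holomorphic_on V" "open V"
  shows "holomorphic2_on (\<lambda>x. f (fst x)) (V \<times> UNIV)"
  unfolding holomorphic2_on_def
proof
  fix x :: "complex \<times> complex" assume "x \<in> V \<times> UNIV"
  then have "(f has_derivative (*) (deriv f (fst x))) (at (fst x))"
    using holomorphic_derivI[OF assms, of "fst x"] by (auto simp: has_field_derivative_def)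
  then have "((\<lambda>x. f (fst x)) has_derivative (\<lambda>v. deriv f (fst x) * fst v)) (at x)"
    by (rule has_derivative_compose[rotated]) (auto intro!: derivative_intros)
  then show "\<exists>a b. ((\<lambda>x. f (fst x)) has_derivative (\<lambda>(s, t). a * s + b * t)) (at x)"
    by (rule holomorphic2_atI[of _ _ _ "deriv f (fst x)" 0]) simp
qed

lemma holomorphic2_on_add:
  assumes "holomorphic2_on f N" "holomorphic2_on g N"
  shows "holomorphic2_on (\<lambda>x. f x + g x) N"
  unfolding holomorphic2_on_def
proof
  fix x assume x: "x \<in> N"
  obtain a b where f: "(f has_derivative (\<lambda>(s, t). a * s + b * t)) (at x)"
    using holomorphic2_onD[OF assms(1) x] .
  obtain a' b' where g: "(g has_derivative (\<lambda>(s, t). a' * s + b' * t)) (at x)"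
    using holomorphic2_onD[OF assms(2) x] .
  show "\<exists>a b. ((\<lambda>x. f x + g x) has_derivative (\<lambda>(s, t). a * s + b * t)) (at x)"
    by (rule holomorphic2_atI[of _ _ _ "a + a'" "b + b'", OF has_derivative_add[OF f g]])
      (simp add: algebra_simps)
qed

lemma holomorphic2_on_mult:
  assumes "holomorphic2_on f N" "holomorphic2_on g N"
  shows "holomorphic2_on (\<lambda>x. f x * g x) N"
  unfolding holomorphic2_on_def
proof
  fix x assume x: "x \<in> N"
  obtain a b where f: "(f has_derivative (\<lambda>(s, t). a * s + b * t)) (at x)"
    using holomorphic2_onD[OF assms(1) x] .
  obtain a' b' where g: "(g has_derivative (\<lambda>(s, t). a' * s + b' * t)) (at x)"
    using holomorphic2_onD[OF assms(2) x] .
  show "\<exists>a b. ((\<lambda>x. f x * g x) has_derivative (\<lambda>(s, t). a * s + b * t)) (at x)"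
    by (rule holomorphic2_atI[of _ _ _ "f x * a' + a * g x" "f x * b' + b * g x", OF has_derivative_mult[OF f g]])
      (simp add: algebra_simps)
qed

lemma holomorphic2_on_power: "holomorphic2_on f N \<Longrightarrow> holomorphic2_on (\<lambda>x. f x ^ n) N"
  by (induction n) (simp_all add: holomorphic2_on_const holomorphic2_on_mult)

lemma holomorphic2_on_sum:
  "(\<And>i. i \<in> I \<Longrightarrow> holomorphic2_on (f i) N) \<Longrightarrow> holomorphic2_on (\<lambda>x. \<Sum>i\<in>I. f i x) N"
  by (induction I rule: infinite_finite_induct)
    (simp_all add: holomorphic2_on_const holomorphic2_on_add)

lemma holomorphic2_on_compose:
  assumes "holomorphic2_on k N'" "holomorphic2_on f N" "holomorphic2_on g N"
    and "\<And>x. x \<in> N \<Longrightarrow> (f x, g x) \<in> N'"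
  shows "holomorphic2_on (\<lambda>x. k (f x, g x)) N"
  unfolding holomorphic2_on_def
proof
  fix x assume x: "x \<in> N"
  obtain a b where f: "(f has_derivative (\<lambda>(s, t). a * s + b * t)) (at x)"
    using holomorphic2_onD[OF assms(2) x] .
  obtain a' b' where g: "(g has_derivative (\<lambda>(s, t). a' * s + b' * t)) (at x)"
    using holomorphic2_onD[OF assms(3) x] .
  obtain u v where k: "(k has_derivative (\<lambda>(s, t). u * s + v * t)) (at (f x, g x))"
    using holomorphic2_onD[OF assms(1) assms(4)[OF x]] .
  show "\<exists>a b. ((\<lambda>x. k (f x, g x)) has_derivative (\<lambda>(s, t). a * s + b * t)) (at x)"
    by (rule holomorphic2_atI[of _ _ _ "u * a + v * a'" "u * b + v * b'", OF has_derivative_compose[OF has_derivative_Pair[OF f g] k]])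
      (simp add: algebra_simps)
qed

lemma holomorphic2_on_subset: "holomorphic2_on f N \<Longrightarrow> N' \<subseteq> N \<Longrightarrow> holomorphic2_on f N'"
  unfolding holomorphic2_on_def by blast

lemma holomorphic2_on_transform:
  assumes "holomorphic2_on f N" "open N" "\<And>x. x \<in> N \<Longrightarrow> f x = g x"
  shows "holomorphic2_on g N"
  unfolding holomorphic2_on_def
proof
  fix x assume x: "x \<in> N"
  obtain a b where "(f has_derivative (\<lambda>(s, t). a * s + b * t)) (at x)"
    using holomorphic2_onD[OF assms(1) x] .
  then have "(g has_derivative (\<lambda>(s, t). a * s + b * t)) (at x)"
    by (rule has_derivative_transform_within_open[OF _ assms(2) x assms(3)])
  then show "\<exists>a b. (g has_derivative (\<lambda>(s, t). a * s + b * t)) (at x)" by blast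
qed

text \<open>The uniform degree bound replaces the range of summation, which depends on the point, by
  a fixed one, so that the sum can be differentiated term by term.\<close>

lemma holomorphic2_on_hol_family:
  assumes F: "hol_family V F" and V: "open V"
  shows "holomorphic2_on (\<lambda>x. poly (F (fst x)) (snd x)) (V \<times> UNIV)"
proof -
  obtain n where n: "\<forall>z\<in>V. degree (F z) \<le> n" using F unfolding hol_family_def by blast
  have "holomorphic2_on (\<lambda>x. \<Sum>k\<le>n. coeff (F (fst x)) k * snd x ^ k) (V \<times> UNIV)"
    using F unfolding hol_family_def
    by (intro holomorphic2_on_sum holomorphic2_on_mult holomorphic2_on_power holomorphic2_on_snd
        holomorphic2_on_fst V) blast
  then show ?thesis
  proof (rule holomorphic2_on_transform)
    show "open (V \<times> (UNIV :: complex set))" using V by (simp add: open_Times)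
    fix x :: "complex \<times> complex" assume "x \<in> V \<times> UNIV"
    then have "degree (F (fst x)) \<le> n" using n by auto
    then show "(\<Sum>k\<le>n. coeff (F (fst x)) k * snd x ^ k) = poly (F (fst x)) (snd x)"
      unfolding poly_altdef by (intro sum.mono_neutral_right) (auto simp: coeff_eq_0 not_le)
  qed
qed

section \<open>The divisors\<close>

lemma multiples_at_mono:
  assumes V: "open V" "fst x \<in> V" "V \<subseteq> crd X \<alpha> ` nbd X \<alpha>"
    and K: "holomorphic2_on K (V \<times> UNIV)"
    and FG: "\<And>u. u \<in> V \<times> UNIV \<Longrightarrow> F u = K u * G u"
  shows "multiples_at X \<alpha> F x \<subseteq> multiples_at X \<alpha> G x"
proof
  fix g assume "g \<in> multiples_at X \<alpha> F x"
  then obtain N h where N: "open N" "x \<in> N" "N \<subseteq> par_dom X \<alpha>" and h: "holomorphic2_on h N"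
    and g: "\<And>u. u \<in> N \<Longrightarrow> g (par_fin X \<alpha> u) = h u * F u"
    unfolding multiples_at_def by blast
  let ?N = "N \<inter> V \<times> UNIV"
  have "open ?N" using N(1) V(1) by (intro open_Int open_Times) auto
  moreover have "x \<in> ?N" using N(2) V(2) by (simp add: mem_Times_iff)
  moreover have "?N \<subseteq> par_dom X \<alpha>" using N(3) by blast
  moreover have "holomorphic2_on (\<lambda>u. h u * K u) ?N"
    by (intro holomorphic2_on_mult holomorphic2_on_subset[OF h] holomorphic2_on_subset[OF K]) auto
  moreover have "g (par_fin X \<alpha> u) = h u * K u * G u" if "u \<in> ?N" for u
    using that g FG[of u] by (simp add: mult.assoc)
  ultimately show "g \<in> multiples_at X \<alpha> G x"
    unfolding multiples_at_def by (intro CollectI exI[of _ ?N] exI[of _ "\<lambda>u. h u * K u"]) simp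
qed

lemma poly_char_poly_uminus:
  fixes A :: "complex mat"
  assumes "A \<in> carrier_mat n n"
  shows "poly (char_poly (- A)) y = det (y \<cdot>\<^sub>m 1\<^sub>m n + A)"
  unfolding char_poly_def
  by (rule poly_det_cong[of _ n]) (use assms in \<open>auto simp: char_poly_matrix_def\<close>)

definition char_fun :: "nat \<Rightarrow> (nat \<Rightarrow> 'i \<Rightarrow> complex \<Rightarrow> complex) \<Rightarrow> 'i \<Rightarrow> complex \<times> complex \<Rightarrow> complex" where
  "char_fun r q \<alpha> = (\<lambda>(x, y). poly (char_poly (- higgs_field r q \<alpha> x)) y)"

lemma char_fun_det: "char_fun r q \<alpha> (x, y) = det (y \<cdot>\<^sub>m 1\<^sub>m r + higgs_field r q \<alpha> x)"
  by (simp add: char_fun_def poly_char_poly_uminus[OF higgs_field_carrier])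

text \<open>A closure sees its divisor only over the complement of S. This makes the limit unique,
  since the witness \<open>Z\<^sub>0\<close> is pinned down only there.\<close>

lemma divisor_closure_cong:
  "(\<And>P. P \<in> cotangent_off X S \<Longrightarrow> Z P = Z' P) \<Longrightarrow> divisor_closure X S Z = divisor_closure X S Z'"
  unfolding divisor_closure_def by auto

lemma spectral_curve_eq:
  "spectral_curve X D (\<lambda>\<alpha> x. - higgs_field r q \<alpha> x) =
    divisor_closure X (supp D) (divisor_of_zeros X (supp D) (char_fun r q))"
proof -
  have "char_fun r q = (\<lambda>\<alpha> (x, y). poly (char_poly (- higgs_field r q \<alpha> x)) y)"
    by (intro ext) (simp add: char_fun_def)
  then show ?thesis by (simp only: spectral_curve_def)
qed

text \<open>A line contains at most one pair with last coordinate 1, so a finite point of the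
  compactification determines its covector.\<close>

lemma line_1_inj: "line \<omega> 1 = line \<omega>' 1 \<Longrightarrow> \<omega> = \<omega>'"
proof -
  assume eq: "line \<omega> 1 = line \<omega>' 1"
  have "(\<omega>, 1) = (\<lambda>t. (\<lambda>\<alpha>. t * \<omega> \<alpha>, t * 1)) 1" by simp
  then have "(\<omega>, 1) \<in> line \<omega> 1" unfolding line_def by blast
  then have "(\<omega>, 1) \<in> line \<omega>' 1" using eq by simp
  then obtain t where "(\<omega>, 1) = (\<lambda>\<alpha>. t * \<omega>' \<alpha>, t * 1)" unfolding line_def by blast
  then show "\<omega> = \<omega>'" by simp
qed

section \<open>Charts of the cotangent bundle and change of chart\<close>

context theta_curve
begin

lemma jac_same: "p \<in> nbd X \<alpha> \<Longrightarrow> jac X \<alpha> \<alpha> p = 1"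
  by (simp add: jac_eq xi_same)

lemma jac_trans:
  assumes "p \<in> nbd X \<alpha>" "p \<in> nbd X \<beta>" "p \<in> nbd X \<gamma>"
  shows "jac X \<alpha> \<beta> p * jac X \<beta> \<gamma> p = jac X \<alpha> \<gamma> p"
  using assms xi_cocycle[of p \<gamma> \<beta> \<alpha>]
  by (simp add: jac_eq power_mult_distrib[symmetric] mult.commute)

lemma form_at_mem: "p \<in> nbd X \<alpha> \<Longrightarrow> form_at X \<alpha> p y \<in> cotangent_space X p"
  by (auto simp: cotangent_space_def form_at_def mult.assoc jac_trans)

lemma form_at_change:
  assumes "p \<in> nbd X \<alpha>" "p \<in> nbd X \<beta>"
  shows "form_at X \<beta> p (y * jac X \<alpha> \<beta> p) = form_at X \<alpha> p y"
  using assms by (auto simp: form_at_def mult.assoc jac_trans)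

lemma form_at_cotangent:
  assumes \<alpha>: "p \<in> nbd X \<alpha>" and \<omega>: "\<omega> \<in> cotangent_space X p"
  shows "form_at X \<alpha> p (\<omega> \<alpha>) = \<omega>"
proof
  fix \<beta>
  show "form_at X \<alpha> p (\<omega> \<alpha>) \<beta> = \<omega> \<beta>"
  proof (cases "p \<in> nbd X \<beta>")
    case True
    then have "\<omega> \<beta> = \<omega> \<alpha> * jac X \<alpha> \<beta> p" using \<alpha> \<omega> unfolding cotangent_space_def by blast
    then show ?thesis using True by (simp only: form_at_def if_True)
  next
    case False
    then show ?thesis using \<omega> by (simp add: form_at_def cotangent_space_def)
  qed
qed

lemma par_fin_cotangent_off:
  assumes "W \<subseteq> nbd X \<alpha> - S" "x \<in> crd X \<alpha> ` W \<times> UNIV"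
  shows "par_fin X \<alpha> x \<in> cotangent_off X S"
proof -
  obtain p y where x: "x = (crd X \<alpha> p, y)" and p: "p \<in> nbd X \<alpha>" "p \<notin> S"
    using assms by (cases x) auto
  show ?thesis
    unfolding cotangent_off_def par_fin_def x using p form_at_mem[OF p(1)] by auto
qed

lemma cotangent_off_par_fin:
  assumes "P \<in> cotangent_off X S"
  obtains \<alpha> x where "x \<in> crd X \<alpha> ` (nbd X \<alpha> - S) \<times> UNIV" "par_fin X \<alpha> x = P"
proof -
  obtain p \<omega> where P: "P = (p, line \<omega> 1)" and \<omega>: "\<omega> \<in> cotangent_space X p" and p: "p \<notin> S"
    using assms unfolding cotangent_off_def by blast
  obtain \<alpha> where \<alpha>: "p \<in> nbd X \<alpha>" using nbd_cover by blast
  have "(crd X \<alpha> p, \<omega> \<alpha>) \<in> crd X \<alpha> ` (nbd X \<alpha> - S) \<times> UNIV" using \<alpha> p by blast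
  moreover have "par_fin X \<alpha> (crd X \<alpha> p, \<omega> \<alpha>) = P"
    using \<alpha> by (simp add: par_fin_def P form_at_cotangent[OF \<alpha> \<omega>])
  ultimately show ?thesis by (rule that)
qed

lemma par_fin_off:
  assumes x: "x \<in> par_dom X \<alpha>" and P: "par_fin X \<alpha> x \<in> cotangent_off X S"
  shows "x \<in> crd X \<alpha> ` (nbd X \<alpha> - S) \<times> UNIV"
proof -
  obtain p y where xp: "x = (crd X \<alpha> p, y)" and p: "p \<in> nbd X \<alpha>"
    using x by (cases x) (auto simp: par_dom_def)
  have "p \<notin> S" using P p by (auto simp: xp par_fin_def cotangent_off_def)
  then show ?thesis using p by (simp add: xp)
qed

context
  fixes r :: nat and D :: "'a \<Rightarrow> nat" and q :: "nat \<Rightarrow> 'i \<Rightarrow> complex \<Rightarrow> complex"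
  assumes q: "\<forall>l \<in> {2..r}. q l \<in> sections_KD X D l"
begin

text \<open>Since y dx_\<alpha> = y w dx_\<beta> with w the Jacobian, the gauge law at h = 0 reads
  (y w + \<phi>_\<beta>) g = w g (y + \<phi>_\<alpha>). Taking determinants and cancelling det g
  leaves the unit w^r, as for a section of the pullback of K^r.\<close>

lemma char_fun_change_chart:
  assumes p: "p \<in> nbd X \<alpha>" "p \<in> nbd X \<beta>" "p \<notin> supp D"
  shows "char_fun r q \<beta> (crd X \<beta> p, y * jac X \<alpha> \<beta> p) = jac X \<alpha> \<beta> p ^ r * char_fun r q \<alpha> (crd X \<alpha> p, y)"
proof -
  let ?w = "jac X \<alpha> \<beta> p"
  let ?g = "Eh_trans X \<xi> r \<beta> \<alpha> 0 p"
  let ?A = "(y * ?w) \<cdot>\<^sub>m 1\<^sub>m r + higgs_field r q \<beta> (crd X \<beta> p)"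
  let ?B = "y \<cdot>\<^sub>m 1\<^sub>m r + higgs_field r q \<alpha> (crd X \<alpha> p)"
  have A: "?A \<in> carrier_mat r r" and B: "?B \<in> carrier_mat r r" by simp_all
  have g: "?g \<in> carrier_mat r r" by (rule Eh_trans_carrier)
  have gd: "dim_row ?g = r" "dim_col ?g = r" using g by auto
  have "?A * ?g = ?w \<cdot>\<^sub>m (?g * ?B)"
  proof (rule eq_matI)
    fix i j assume "i < dim_row (?w \<cdot>\<^sub>m (?g * ?B))" "j < dim_col (?w \<cdot>\<^sub>m (?g * ?B))"
    then have ij: "i < r" "j < r" using A B gd by auto
    have "(?A * ?g) $$ (i, j) = (\<Sum>l<r. (y * ?w * (if l = i then 1 else 0) +
        higgs_field r q \<beta> (crd X \<beta> p) $$ (i, l)) * ?g $$ (l, j))"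
      using ij gd A by (auto simp: scalar_prod_def atLeast0LessThan intro!: sum.cong)
    also have "\<dots> = (\<Sum>l<r. if l = i then y * ?w * ?g $$ (i, j) else 0) +
        (\<Sum>l<r. higgs_field r q \<beta> (crd X \<beta> p) $$ (i, l) * ?g $$ (l, j))"
      unfolding sum.distrib[symmetric] by (intro sum.cong refl) (auto simp: algebra_simps)
    also have "\<dots> = y * ?w * ?g $$ (i, j) +
        ?w * (\<Sum>l<r. ?g $$ (i, l) * higgs_field r q \<alpha> (crd X \<alpha> p) $$ (l, j))"
      unfolding gauge_entry[OF p(2,1,3) ij q] using ij by simp
    also have "\<dots> = ?w * ((\<Sum>l<r. if l = j then ?g $$ (i, l) * y else 0) +
        (\<Sum>l<r. ?g $$ (i, l) * higgs_field r q \<alpha> (crd X \<alpha> p) $$ (l, j)))"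
      using ij by (simp add: algebra_simps)
    also have "\<dots> = ?w * (\<Sum>l<r. ?g $$ (i, l) * (y * (if l = j then 1 else 0) +
        higgs_field r q \<alpha> (crd X \<alpha> p) $$ (l, j)))"
      unfolding sum.distrib[symmetric]
      by (intro arg_cong[where f = "(*) ?w"] sum.cong refl) (auto simp: algebra_simps)
    also have "\<dots> = (?w \<cdot>\<^sub>m (?g * ?B)) $$ (i, j)"
      using ij gd B by (auto simp: scalar_prod_def atLeast0LessThan intro!: sum.cong)
    finally show "(?A * ?g) $$ (i, j) = (?w \<cdot>\<^sub>m (?g * ?B)) $$ (i, j)" .
  qed (use gd A B in auto)
  then have "det (?A * ?g) = det (?w \<cdot>\<^sub>m (?g * ?B))" by (rule arg_cong)
  also have "\<dots> = ?w ^ r * det (?g * ?B)" by simp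
  finally have "det ?A * det ?g = ?w ^ r * (det ?g * det ?B)"
    unfolding det_mult[OF A g] det_mult[OF g B] .
  moreover have "det ?g \<noteq> 0"
    using vector_bundle_Eh[of r 0] p unfolding vector_bundle_def by blast
  ultimately show ?thesis unfolding char_fun_det
    by (simp only: mult.left_commute[of _ "det ?g"] mult.commute[of _ "det ?g"] mult_cancel_left) simp
qed

text \<open>A multiplier in the chart \<beta> is pulled back along the change of coordinates and
  multiplied by the Jacobian to the power r, both holomorphic.\<close>

lemma multiples_at_change_chart:
  assumes x: "x \<in> par_dom X \<alpha>" and x': "x' \<in> par_dom X \<beta>"
    and eq: "par_fin X \<alpha> x = par_fin X \<beta> x'" and off: "par_fin X \<alpha> x \<in> cotangent_off X (supp D)"
    and fin: "finite (supp D)"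
  shows "multiples_at X \<beta> (char_fun r q \<beta>) x' \<subseteq> multiples_at X \<alpha> (char_fun r q \<alpha>) x"
proof
  fix f assume "f \<in> multiples_at X \<beta> (char_fun r q \<beta>) x'"
  then obtain N h where N: "open N" "x' \<in> N" "N \<subseteq> par_dom X \<beta>" and h: "holomorphic2_on h N"
    and f: "\<And>u. u \<in> N \<Longrightarrow> f (par_fin X \<beta> u) = h u * char_fun r q \<beta> u"
    unfolding multiples_at_def by blast
  obtain p y where xp: "x = (crd X \<alpha> p, y)" and p: "p \<in> nbd X \<alpha>" "p \<notin> supp D"
    using par_fin_off[OF x off] by (cases x) auto
  obtain p' y' where xp': "x' = (crd X \<beta> p', y')" and p': "p' \<in> nbd X \<beta>"
    using x' by (cases x') (auto simp: par_dom_def)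
  have "p' = p" using eq p p' by (simp add: xp xp' par_fin_def)
  then have pb: "p \<in> nbd X \<beta>" and xp': "x' = (crd X \<beta> p, y')" using p' xp' by auto
  have "form_at X \<alpha> p y = form_at X \<beta> p y'"
    using eq p pb by (intro line_1_inj) (simp add: xp xp' par_fin_def)
  then have "form_at X \<alpha> p y \<beta> = form_at X \<beta> p y' \<beta>" by simp
  then have y': "y' = y * jac X \<alpha> \<beta> p" using pb by (simp add: form_at_def jac_same)
  define Q where "Q = crd X \<alpha> ` (nbd X \<beta> \<inter> nbd X \<alpha> - supp D)"
  have "open (nbd X \<beta> \<inter> nbd X \<alpha> - supp D)"
    using open_nbd fin by (intro open_Diff open_Int finite_imp_closed)
  then have Q: "open Q" unfolding Q_def by (rule open_crd_image) auto
  let ?l = "\<lambda>z. c \<beta> \<alpha> * z + d \<beta> \<alpha>"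
  let ?\<tau> = "\<lambda>z. (a \<beta> \<alpha> * z + b \<beta> \<alpha>) / ?l z"
  have Q_pt: "pt X \<alpha> z \<in> nbd X \<alpha>" "pt X \<alpha> z \<in> nbd X \<beta>" "pt X \<alpha> z \<notin> supp D"
    "crd X \<alpha> (pt X \<alpha> z) = z" if "z \<in> Q" for z
    using that by (auto simp: Q_def)
  have l: "?l z \<noteq> 0" "crd X \<beta> (pt X \<alpha> z) = ?\<tau> z" "jac X \<alpha> \<beta> (pt X \<alpha> z) = ?l z ^ 2" if "z \<in> Q" for z
    using mobius(2,3)[OF Q_pt(2,1)[OF that]] xi_square[OF Q_pt(2,1)[OF that]] Q_pt[OF that]
    by (simp_all add: jac_eq)
  have hol_\<tau>: "holomorphic2_on (\<lambda>u. ?\<tau> (fst u)) (Q \<times> UNIV)"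
    using l(1) by (intro holomorphic2_on_fst Q holomorphic_intros) auto
  have hol_l: "holomorphic2_on (\<lambda>u. ?l (fst u) ^ 2) (Q \<times> UNIV)"
    by (intro holomorphic2_on_fst Q holomorphic_intros)
  have hol_y: "holomorphic2_on (\<lambda>u. snd u * ?l (fst u) ^ 2) (Q \<times> UNIV)"
    by (intro holomorphic2_on_mult holomorphic2_on_snd hol_l)
  \<comment> \<open>The change of cotangent coordinates, written with the Moebius formula instead of
    the charts so that its holomorphy and continuity are visible.\<close>
  let ?T = "\<lambda>u. (?\<tau> (fst u), snd u * ?l (fst u) ^ 2)"
  define N' where "N' = Q \<times> UNIV \<inter> ?T -` N"
  have "continuous_on (Q \<times> UNIV) ?T"
    using l(1) by (intro continuous_intros) auto
  then have "open N'"
    unfolding N'_def using Q N(1) by (intro continuous_open_preimage) (auto intro: open_Times)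
  moreover have "x \<in> N'"
  proof -
    have "crd X \<alpha> p \<in> Q" using p pb by (simp add: Q_def)
    moreover from l[OF this] have "?T x = x'" using p y' by (simp add: xp xp')
    ultimately show ?thesis using N(2) by (simp add: N'_def xp)
  qed
  moreover have "N' \<subseteq> par_dom X \<alpha>" by (auto simp: N'_def Q_def par_dom_def)
  moreover have "holomorphic2_on (\<lambda>u. h (?T u) * (?l (fst u) ^ 2) ^ r) N'"
  proof (rule holomorphic2_on_mult[OF _ holomorphic2_on_power])
    show "holomorphic2_on (\<lambda>u. h (?T u)) N'"
      by (rule holomorphic2_on_compose[OF h holomorphic2_on_subset[OF hol_\<tau>]
            holomorphic2_on_subset[OF hol_y]]) (auto simp: N'_def)
    show "holomorphic2_on (\<lambda>u. ?l (fst u) ^ 2) N'"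
      by (rule holomorphic2_on_subset[OF hol_l]) (auto simp: N'_def)
  qed
  moreover have "f (par_fin X \<alpha> u) = h (?T u) * (?l (fst u) ^ 2) ^ r * char_fun r q \<alpha> u" if u: "u \<in> N'" for u
  proof -
    obtain z w where uz: "u = (z, w)" by (cases u)
    have z: "z \<in> Q" and T: "?T u \<in> N" using u by (auto simp: N'_def uz)
    let ?p = "pt X \<alpha> z"
    have T_eq: "?T u = (crd X \<beta> ?p, w * jac X \<alpha> \<beta> ?p)"
      using l[OF z] by (simp add: uz)
    have "par_fin X \<beta> (?T u) = par_fin X \<alpha> u"
      unfolding T_eq using Q_pt[OF z] form_at_change[OF Q_pt(1,2)[OF z], of w]
      by (simp add: par_fin_def uz)
    then have "f (par_fin X \<alpha> u) = h (?T u) * char_fun r q \<beta> (?T u)" using f[OF T] by simp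
    also have "char_fun r q \<beta> (?T u) = (?l z ^ 2) ^ r * char_fun r q \<alpha> u"
      unfolding T_eq char_fun_change_chart[OF Q_pt(1-3)[OF z]] using Q_pt(4)[OF z] l(3)[OF z]
      by (simp add: uz)
    finally show ?thesis by (simp add: uz mult.assoc)
  qed
  ultimately show "f \<in> multiples_at X \<alpha> (char_fun r q \<alpha>) x"
    unfolding multiples_at_def
    by (intro CollectI exI[of _ N'] exI[of _ "\<lambda>u. h (?T u) * (?l (fst u) ^ 2) ^ r"]) blast
qed

end

end

section \<open>Comparison of the symbols with the characteristic function\<close>

context theta_curve
begin

context
  fixes r :: nat and D :: "'a \<Rightarrow> nat" and q :: "nat \<Rightarrow> 'i \<Rightarrow> complex \<Rightarrow> complex"
  assumes r2: "r \<ge> 2" and q: "\<forall>l \<in> {2..r}. q l \<in> sections_KD X D l" and fin: "finite (supp D)"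
begin

text \<open>The constants come from X_- alone: the powers of X_+ in the field have exponent at least
  1 and lie strictly above the diagonal.\<close>

lemma hessenberg_field_higgs:
  assumes "open W" "W \<subseteq> nbd X \<alpha> - supp D"
  shows "hessenberg_field (crd X \<alpha> ` W) (higgs_field r q \<alpha>) (\<lambda>i. X_weight r (i - 1) i) r"
proof
  show "open (crd X \<alpha> ` W)" using assms by (intro open_crd_image) auto
  show "(\<lambda>z. higgs_field r q \<alpha> z $$ (i, j)) holomorphic_on crd X \<alpha> ` W" if "i < r" "j < r" for i j
    by (rule holomorphic_on_subset[OF higgs_field_holomorphic[OF q that]]) (use assms in auto)
qed (use r2 in \<open>auto simp: higgs_field_lower higgs_field_subdiag X_weight_nonzero\<close>)

lemma locally_cyclic_exists:
  "\<exists>P. locally_cyclic X D (rees_of (oper_of X \<xi> r q)) \<alpha> (nbd X \<alpha> - supp D) P"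
proof -
  let ?W = "nbd X \<alpha> - supp D"
  have W: "open ?W" using open_nbd fin by (intro open_Diff finite_imp_closed)
  interpret hessenberg_field "crd X \<alpha> ` ?W" "higgs_field r q \<alpha>" "\<lambda>i. X_weight r (i - 1) i" r
    by (rule hessenberg_field_higgs[OF W order_refl])
  show ?thesis
  proof (rule cyclic_presentation_exists)
    fix P e
    assume "P \<in> rees_ring (crd X \<alpha> ` ?W)" "e \<in> rees_rows (crd X \<alpha> ` ?W) r"
      and "\<And>V. open V \<Longrightarrow> V \<subseteq> crd X \<alpha> ` ?W \<Longrightarrow>
        (\<forall>B \<in> rees_ring V.
           (\<lambda>i. B \<odot> hop_restrict V (e i)) \<in> system_relations V r A \<longleftrightarrow>
           (\<exists>Q \<in> rees_ring V. B = Q \<odot> hop_restrict V P)) \<and>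
        (\<forall>v \<in> rees_rows V r. \<exists>B \<in> rees_ring V.
           (\<lambda>i k m z. v i k m z - (B \<odot> hop_restrict V (e i)) k m z) \<in> system_relations V r A)"
    then have "locally_cyclic X D (rees_of (oper_of X \<xi> r q)) \<alpha> ?W P"
      unfolding locally_cyclic_def rees_of_oper_of using W
      by (intro conjI bexI[of _ e] order_refl allI impI) simp_all
    then show ?thesis by (rule exI[of _ P])
  qed
qed

text \<open>On a product of a disc with the plane the symbol and the characteristic function divide
  each other with holomorphic quotients, so they generate the same ideal at x.\<close>

lemma multiples_at_symbol0:
  assumes cyc: "locally_cyclic X D (rees_of (oper_of X \<xi> r q)) \<alpha> W P"
    and x: "x \<in> crd X \<alpha> ` W \<times> UNIV"
  shows "multiples_at X \<alpha> (symbol0 P) x = multiples_at X \<alpha> (char_fun r q \<alpha>) x"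
proof -
  have W: "open W" "W \<subseteq> nbd X \<alpha> - supp D" and P: "P \<in> rees_ring (crd X \<alpha> ` W)"
    using cyc unfolding locally_cyclic_def by auto
  interpret hessenberg_field "crd X \<alpha> ` W" "higgs_field r q \<alpha>" "\<lambda>i. X_weight r (i - 1) i" r
    by (rule hessenberg_field_higgs[OF W])
  obtain e where e: "e \<in> rees_rows (crd X \<alpha> ` W) r"
    and pres: "\<forall>V. open V \<and> connected V \<and> V \<subseteq> crd X \<alpha> ` W \<longrightarrow>
      (\<forall>B \<in> rees_ring V.
         (\<lambda>i. B \<odot> hop_restrict V (e i)) \<in> system_relations V r A \<longleftrightarrow>
         (\<exists>Q \<in> rees_ring V. B = Q \<odot> hop_restrict V P)) \<and>
      (\<forall>v \<in> rees_rows V r. \<exists>B \<in> rees_ring V.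
         (\<lambda>i k m z. v i k m z - (B \<odot> hop_restrict V (e i)) k m z) \<in> system_relations V r A)"
    using cyc unfolding locally_cyclic_def rees_of_oper_of by (elim conjE bexE)
  have "fst x \<in> crd X \<alpha> ` W" using x by auto
  \<comment> \<open>The presentation is granted over connected open sets; a ball around the base
    point is one.\<close>
  then obtain \<epsilon> where \<epsilon>: "\<epsilon> > 0" "ball (fst x) \<epsilon> \<subseteq> crd X \<alpha> ` W"
    using U open_contains_ball by blast
  define V where "V = ball (fst x) \<epsilon>"
  have V: "open V" "connected V" "V \<subseteq> crd X \<alpha> ` W" "fst x \<in> V"
    using \<epsilon> by (auto simp: V_def)
  have V': "V \<subseteq> crd X \<alpha> ` nbd X \<alpha>" using V(3) W(2) by blast
  have P': "hop_restrict V P \<in> rees_ring V" by (rule hop_restrict_mem[OF V(3) P])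
  have e': "(\<lambda>i. hop_restrict V (e i)) \<in> rees_rows V r"
    using e hop_restrict_mem[OF V(3)] by (auto simp: rees_rows_def hop_restrict_def fun_eq_iff)
  note presV = pres[THEN spec[of _ V], THEN mp, OF conjI[OF V(1) conjI[OF V(2,3)]]]
  have ann: "(\<lambda>i. B \<odot> hop_restrict V (e i)) \<in> system_relations V r A \<longleftrightarrow>
      (\<exists>Q \<in> rees_ring V. B = Q \<odot> hop_restrict V P)" if "B \<in> rees_ring V" for B
    using presV[THEN conjunct1, THEN bspec, OF that] .
  have gen: "\<exists>B \<in> rees_ring V. (\<lambda>i. v i - B \<odot> hop_restrict V (e i)) \<in> system_relations V r A"
    if v: "v \<in> rees_rows V r" for v
  proof -
    obtain B where B: "B \<in> rees_ring V"
      and "(\<lambda>i k m z. v i k m z - (B \<odot> hop_restrict V (e i)) k m z) \<in> system_relations V r A"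
      using presV[THEN conjunct2, THEN bspec, OF v] by (elim bexE)
    moreover have "(\<lambda>i k m z. v i k m z - (B \<odot> hop_restrict V (e i)) k m z) =
        (\<lambda>i. v i - B \<odot> hop_restrict V (e i))"
      by (simp add: fun_eq_iff)
    ultimately show ?thesis by (intro bexI[OF _ B]) (simp only:)
  qed
  have sym: "symbol0 P u = poly (sym0 (hop_restrict V P) (fst u)) (snd u)" if "u \<in> V \<times> UNIV" for u :: "complex \<times> complex"
  proof -
    have "sym0 P (fst u) = sym0 (hop_restrict V P) (fst u)"
      using that by (auto simp: sym0_def hop_restrict_def)
    then show ?thesis using symbol0_eq_poly_sym0[OF P, of "fst u" "snd u"] by simp
  qed
  have chr: "char_fun r q \<alpha> u = poly (char_poly (- higgs_field r q \<alpha> (fst u))) (snd u)" for u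
    by (simp add: char_fun_def split_beta)
  show ?thesis
  proof (rule symbol_associated_char_poly[OF V(1,3) P' e' ann gen])
    fix K L assume K: "hol_family V K" and L: "hol_family V L"
      and PK: "\<And>z. z \<in> V \<Longrightarrow> sym0 (hop_restrict V P) z = K z * char_poly (- higgs_field r q \<alpha> z)"
      and PL: "\<And>z. z \<in> V \<Longrightarrow> char_poly (- higgs_field r q \<alpha> z) = L z * sym0 (hop_restrict V P) z"
    have "multiples_at X \<alpha> (symbol0 P) x \<subseteq> multiples_at X \<alpha> (char_fun r q \<alpha>) x"
    proof (rule multiples_at_mono[OF V(1,4) V' holomorphic2_on_hol_family[OF K V(1)]])
      fix u :: "complex \<times> complex" assume u: "u \<in> V \<times> UNIV"
      then have "fst u \<in> V" by auto
      then show "symbol0 P u = poly (K (fst u)) (snd u) * char_fun r q \<alpha> u"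
        unfolding sym[OF u] chr by (simp only: PK poly_mult)
    qed
    moreover have "multiples_at X \<alpha> (char_fun r q \<alpha>) x \<subseteq> multiples_at X \<alpha> (symbol0 P) x"
    proof (rule multiples_at_mono[OF V(1,4) V' holomorphic2_on_hol_family[OF L V(1)]])
      fix u :: "complex \<times> complex" assume u: "u \<in> V \<times> UNIV"
      then have "fst u \<in> V" by auto
      then show "char_fun r q \<alpha> u = poly (L (fst u)) (snd u) * symbol0 P u"
        unfolding sym[OF u] chr poly_mult[symmetric] by (rule arg_cong2[OF PL refl])
    qed
    ultimately show ?thesis by (rule antisym)
  qed
qed

text \<open>A zero divisor is defined by membership in every chart; the change of chart reduces this
  to the single chart at hand.\<close>

lemma divisor_of_zeros_char_fun:
  assumes x: "x \<in> par_dom X \<alpha>" and off: "par_fin X \<alpha> x \<in> cotangent_off X (supp D)"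
  shows "divisor_of_zeros X (supp D) (char_fun r q) (par_fin X \<alpha> x) = multiples_at X \<alpha> (char_fun r q \<alpha>) x"
proof
  show "divisor_of_zeros X (supp D) (char_fun r q) (par_fin X \<alpha> x) \<subseteq> multiples_at X \<alpha> (char_fun r q \<alpha>) x"
    unfolding divisor_of_zeros_def using x by blast
  show "multiples_at X \<alpha> (char_fun r q \<alpha>) x \<subseteq> divisor_of_zeros X (supp D) (char_fun r q) (par_fin X \<alpha> x)"
  proof
    fix g assume g: "g \<in> multiples_at X \<alpha> (char_fun r q \<alpha>) x"
    have "g \<in> multiples_at X \<beta> (char_fun r q \<beta>) x'"
      if "x' \<in> par_dom X \<beta>" "par_fin X \<beta> x' = par_fin X \<alpha> x" for \<beta> x'
      using multiples_at_change_chart[OF q that(1) x that(2) _ fin] off g that(2) by auto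
    then show "g \<in> divisor_of_zeros X (supp D) (char_fun r q) (par_fin X \<alpha> x)"
      unfolding divisor_of_zeros_def using off by blast
  qed
qed

text \<open>Uniqueness holds because every point over the complement of the support has some
  presentation, which fixes the stalk of \<open>Z\<^sub>0\<close> there. Existence holds because the
  stalk given by any presentation is that of the characteristic function.\<close>

lemma is_semiclassical_limit_iff:
  "is_semiclassical_limit X D (rees_of (oper_of X \<xi> r q)) Z \<longleftrightarrow>
    Z = spectral_curve X D (\<lambda>\<alpha> x. - higgs_field r q \<alpha> x)"
proof
  let ?M = "rees_of (oper_of X \<xi> r q)" and ?Z = "divisor_of_zeros X (supp D) (char_fun r q)"
  assume "is_semiclassical_limit X D ?M Z"
  then obtain Z\<^sub>0 where Z\<^sub>0: "\<And>\<alpha> W P x. locally_cyclic X D ?M \<alpha> W P \<Longrightarrow> x \<in> crd X \<alpha> ` W \<times> UNIV \<Longrightarrow>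
        Z\<^sub>0 (par_fin X \<alpha> x) = multiples_at X \<alpha> (symbol0 P) x"
    and Z: "Z = divisor_closure X (supp D) Z\<^sub>0"
    unfolding is_semiclassical_limit_def by blast
  have "Z\<^sub>0 P = ?Z P" if P: "P \<in> cotangent_off X (supp D)" for P
  proof -
    obtain \<alpha> x where x: "x \<in> crd X \<alpha> ` (nbd X \<alpha> - supp D) \<times> UNIV" and xP: "par_fin X \<alpha> x = P"
      using cotangent_off_par_fin[OF P] .
    obtain Q where Q: "locally_cyclic X D ?M \<alpha> (nbd X \<alpha> - supp D) Q"
      using locally_cyclic_exists by blast
    have "Z\<^sub>0 P = multiples_at X \<alpha> (char_fun r q \<alpha>) x"
      using Z\<^sub>0[OF Q x] multiples_at_symbol0[OF Q x] xP by simp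
    also have "\<dots> = ?Z (par_fin X \<alpha> x)"
      by (rule divisor_of_zeros_char_fun[symmetric]) (use x xP P in \<open>auto simp: par_dom_def\<close>)
    finally show ?thesis by (simp add: xP)
  qed
  then show "Z = spectral_curve X D (\<lambda>\<alpha> x. - higgs_field r q \<alpha> x)"
    unfolding Z spectral_curve_eq by (rule divisor_closure_cong)
next
  let ?M = "rees_of (oper_of X \<xi> r q)" and ?Z = "divisor_of_zeros X (supp D) (char_fun r q)"
  assume Z: "Z = spectral_curve X D (\<lambda>\<alpha> x. - higgs_field r q \<alpha> x)"
  show "is_semiclassical_limit X D ?M Z"
    unfolding is_semiclassical_limit_def
  proof (intro conjI allI impI exI[of _ ?Z] ballI)
    fix p assume "p \<notin> supp D"
    moreover obtain \<alpha> where "p \<in> nbd X \<alpha>" using nbd_cover by blast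
    ultimately show "\<exists>\<alpha> W P. p \<in> W \<and> locally_cyclic X D ?M \<alpha> W P"
      using locally_cyclic_exists[of \<alpha>] by blast
  next
    fix \<alpha> W P and x :: "complex \<times> complex"
    assume cyc: "locally_cyclic X D ?M \<alpha> W P" and x: "x \<in> crd X \<alpha> ` W \<times> UNIV"
    have W: "W \<subseteq> nbd X \<alpha> - supp D" using cyc unfolding locally_cyclic_def by blast
    have "x \<in> par_dom X \<alpha>" using x W by (auto simp: par_dom_def)
    from divisor_of_zeros_char_fun[OF this par_fin_cotangent_off[OF W x]]
    show "?Z (par_fin X \<alpha> x) = multiples_at X \<alpha> (symbol0 P) x"
      unfolding multiples_at_symbol0[OF cyc x] .
  qed (simp add: Z spectral_curve_eq)
qed

end

end

theorem theorem3p15: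
  fixes X :: "('i, 'a::t2_space) atlas"
    and a b c d :: "'i \<Rightarrow> 'i \<Rightarrow> complex"
    and \<xi> :: "'i \<Rightarrow> 'i \<Rightarrow> 'a \<Rightarrow> complex"
    and r :: nat
    and D :: "'a \<Rightarrow> nat"
    and q :: "nat \<Rightarrow> 'i \<Rightarrow> complex \<Rightarrow> complex"
  assumes "projective_coordinate_system X a b c d"
    and "theta_characteristic X c d \<xi>"
    and "r \<ge> 2"
    and "finite (supp D)"
    and "\<forall>l \<in> {2..r}. q l \<in> sections_KD X D l"
  shows "meromorphic_higgs_bundle X D r (E0_trans \<xi> r) (higgs_field r q) \<and>
    meromorphic_oper X D (oper_of X \<xi> r q) \<and>
    meromorphic_rees_module X D (rees_of (oper_of X \<xi> r q)) \<and>
    (\<forall>Z. is_semiclassical_limit X D (rees_of (oper_of X \<xi> r q)) Z \<longleftrightarrow>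
       Z = spectral_curve X D (\<lambda>\<alpha> x. - higgs_field r q \<alpha> x)) \<and>
    spectral_curve X D (\<lambda>\<alpha> x. - higgs_field r q \<alpha> x) =
      divisor_closure X (supp D) (divisor_of_zeros X (supp D)
        (\<lambda>\<alpha> (x, y). det (y \<cdot>\<^sub>m 1\<^sub>m r + higgs_field r q \<alpha> x)))"
proof -
  interpret theta_curve X a b c d \<xi> by unfold_locales (rule assms(1,2))+
  have "char_fun r q = (\<lambda>\<alpha> (x, y). det (y \<cdot>\<^sub>m 1\<^sub>m r + higgs_field r q \<alpha> x))"
    by (intro ext) (auto simp: char_fun_det)
  then show ?thesis
    using meromorphic_higgs_bundle_higgs[OF assms(5)] meromorphic_oper_oper_of[OF assms(5)]
      meromorphic_rees_module_rees_of[OF assms(5)] is_semiclassical_limit_iff[OF assms(3,5,4)]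
      spectral_curve_eq[of X D r q]
    by simp
qed

end
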